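(* Let $\Omega$ be a bounded domain of $\mathbb{R}^N$, $N\ge3$, containing the origin. If $(v_n)$ is a bounded sequence in $W_0^{1,2}(|x|^{-(N-2)},\Omega)$, then $u_n=|x|^{-(N-2)/2}v_n$ is a bounded sequence in $H(\Omega)$ and, up to a subsequence, $u_n$ converges in $L^q(\Omega)$ to some $u$, for any $1\le q<\frac{2N}{N-2}$. Thus the imbeddings $$W_0^{1,2}(|x|^{-(N-2)},\Omega)\hookrightarrow L^q(|x|^{-q(N-2)/2},\Omega),\qquad\text{for any }1\le q<\frac{2N}{N-2},$$ and $$W_0^{1,2}(|x|^{-(N-2)},\Omega)\hookrightarrow L^q(|x|^{-(N-2)/2},\Omega),\qquad\text{for any }1\le q<\frac{2N}{N-2},$$ are compact.
   Context: $W_0^{1,2}(|x|^{-(N-2)},\Omega)$ is the completion of $C_0^\infty(\Omega)$ under the norm $\|v\|^2=\int_\Omega|x|^{-(N-2)}|\nabla v|^2dx$. For a weight $w(x)$, $L^q(w(x),\Omega)$ is the closure of $C_0^\infty(\Omega)$ under the norm $\|\phi\|_{L^q(w(x),\Omega)}=\left(\int_\Omega w(x)|\phi|^q\,dx\right)^{1/q}$. $H(\Omega)$ is the completion of the set $\{|x|^{-\frac{N-2}{2}}\phi(x):\phi\in C_0^\infty(\Omega)\}$ under the norm $$\|u\|_{H(\Omega)}^2=\int_\Omega|\nabla u|^2dx-\left(\frac{N-2}{2}\right)^2\int_\Omega\frac{u^2}{|x|^2}dx-L^2(u).$$ Here $L(u)=\left(\frac{N(N-2)}{2}\omega_N\right)^{1/2}\lim_{|x|\to0}|x|^{\frac{N-2}{2}}u_r(|x|)$,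 where $\omega_N$ is the Lebesgue measure of the unit ball of $\mathbb{R}^N$ and, extending $u$ by zero outside $\Omega$, $u_r(\rho)=\frac1{|\partial B_\rho|}\int_{\partial B_\rho}u\,ds$. The difference of the two integrals in the norm is understood as the limit as $\varepsilon\to0$ of the same difference over $\Omega\setminus B_\varepsilon(0)$ for $u$ in the dense set above, and the whole expression is extended to $H(\Omega)$ by completion. *)

theory Defs
  imports "HOL-Analysis.Analysis"
begin

primrec C_k :: "nat \<Rightarrow> ('a::euclidean_space \<Rightarrow> real) \<Rightarrow> bool" where
  "C_k 0 f \<longleftrightarrow> continuous_on UNIV f"
| "C_k (Suc k) f \<longleftrightarrow>
     (\<forall>x. f differentiable (at x)) \<and> (\<forall>h. C_k k (\<lambda>x. frechet_derivative f (at x) h))"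

text \<open>Functions on \<open>\<Omega>\<close> are represented by functions on the whole space; test functions
  vanish outside \<open>\<Omega>\<close>.\<close>

definition test_functions :: "'a::euclidean_space set \<Rightarrow> ('a \<Rightarrow> real) set" where
  "test_functions \<Omega> = {\<phi>. (\<forall>k. C_k k \<phi>) \<and>
     compact (closure {x. \<phi> x \<noteq> 0}) \<and> closure {x. \<phi> x \<noteq> 0} \<subseteq> \<Omega>}"

definition grad :: "('a::euclidean_space \<Rightarrow> real) \<Rightarrow> 'a \<Rightarrow> 'a" where
  "grad f x = (\<Sum>b\<in>Basis. frechet_derivative f (at x) b *\<^sub>R b)"

definition Cauchy_wrt :: "(('a \<Rightarrow> real) \<Rightarrow> real) \<Rightarrow> (nat \<Rightarrow> 'a \<Rightarrow> real) \<Rightarrow> bool" where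
  "Cauchy_wrt nrm s \<longleftrightarrow>
     (\<forall>e>0. \<exists>M. \<forall>m\<ge>M. \<forall>n\<ge>M. nrm (\<lambda>x. s m x - s n x) < e)"

definition tendsto_L1_loc ::
    "'a::euclidean_space set \<Rightarrow> (nat \<Rightarrow> 'a \<Rightarrow> real) \<Rightarrow> ('a \<Rightarrow> real) \<Rightarrow> bool" where
  "tendsto_L1_loc \<Omega> s v \<longleftrightarrow>
     (\<forall>K. compact K \<and> K \<subseteq> \<Omega> \<longrightarrow>
        (\<forall>k. set_integrable lebesgue K (\<lambda>x. s k x - v x)) \<and>
        (\<lambda>k. LINT x:K|lebesgue. \<bar>s k x - v x\<bar>) \<longlonglongrightarrow> 0)"

text \<open>An element of the completion of \<open>D\<close> under \<open>nrm\<close> is the class of a Cauchy sequence in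
  \<open>D\<close>; it is identified with the function to which that sequence converges in
  \<open>L\<^sup>1\<^sub>l\<^sub>o\<^sub>c(\<Omega>)\<close>.  Functions are compared almost everywhere on \<open>\<Omega>\<close>.\<close>

definition represents ::
    "('a::euclidean_space \<Rightarrow> real) set \<Rightarrow> (('a \<Rightarrow> real) \<Rightarrow> real) \<Rightarrow> 'a set \<Rightarrow>
     (nat \<Rightarrow> 'a \<Rightarrow> real) \<Rightarrow> ('a \<Rightarrow> real) \<Rightarrow> bool" where
  "represents D nrm \<Omega> s v \<longleftrightarrow>
     (\<forall>k. s k \<in> D) \<and> Cauchy_wrt nrm s \<and> tendsto_L1_loc \<Omega> s v"

definition completion ::
    "('a::euclidean_space \<Rightarrow> real) set \<Rightarrow> (('a \<Rightarrow> real) \<Rightarrow> real) \<Rightarrow> 'a set \<Rightarrow>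
     ('a \<Rightarrow> real) set" where
  "completion D nrm \<Omega> = {v. \<exists>s. represents D nrm \<Omega> s v}"

text \<open>The norm of the completion is the limit of the norms along a representing sequence.
  For the two norms below this limit does not depend on the sequence (they are closable in
  \<open>L\<^sup>1\<^sub>l\<^sub>o\<^sub>c(\<Omega>)\<close>), so the infimum is over a singleton; it is used in order that the definition
  make sense without reference to that fact.\<close>

definition completion_norm ::
    "('a::euclidean_space \<Rightarrow> real) set \<Rightarrow> (('a \<Rightarrow> real) \<Rightarrow> real) \<Rightarrow> 'a set \<Rightarrow>
     ('a \<Rightarrow> real) \<Rightarrow> real" where
  "completion_norm D nrm \<Omega> v =
     Inf {r. \<exists>s. represents D nrm \<Omega> s v \<and> (\<lambda>k. nrm (s k)) \<longlonglongrightarrow> r}"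

definition W_norm0 :: "'a::euclidean_space set \<Rightarrow> ('a \<Rightarrow> real) \<Rightarrow> real" where
  "W_norm0 \<Omega> v = sqrt (LINT x:\<Omega>|lebesgue.
     norm x powr (- (real DIM('a) - 2)) * (norm (grad v x))\<^sup>2)"

definition W_space :: "'a::euclidean_space set \<Rightarrow> ('a \<Rightarrow> real) set" where
  "W_space \<Omega> = completion (test_functions \<Omega>) (W_norm0 \<Omega>) \<Omega>"

definition W_norm :: "'a::euclidean_space set \<Rightarrow> ('a \<Rightarrow> real) \<Rightarrow> real" where
  "W_norm \<Omega> = completion_norm (test_functions \<Omega>) (W_norm0 \<Omega>) \<Omega>"

text \<open>Surface measure on the sphere of radius \<open>\<rho>\<close> about the origin, as the normalised cone
  measure: the area of \<open>A\<close> is \<open>N / \<rho>\<close> times the volume of the cone \<open>{t x | x \<in> A, 0 < t < 1}\<close>.\<close>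

definition sphere_measure :: "real \<Rightarrow> 'a::euclidean_space measure" where
  "sphere_measure \<rho> = scale_measure (ennreal (real DIM('a) / \<rho>))
     (distr (restrict_space lborel (ball 0 \<rho> - {0})) borel (\<lambda>x. (\<rho> / norm x) *\<^sub>R x))"

definition sphere_mean :: "('a::euclidean_space \<Rightarrow> real) \<Rightarrow> real \<Rightarrow> real" where
  "sphere_mean u \<rho> =
     (LINT x:sphere 0 \<rho>|sphere_measure \<rho>. u x) / measure (sphere_measure \<rho>) (sphere (0::'a) \<rho>)"

definition L_functional :: "('a::euclidean_space \<Rightarrow> real) \<Rightarrow> real" where
  "L_functional u =
     sqrt (real DIM('a) * (real DIM('a) - 2) / 2 * measure lebesgue (ball (0::'a) 1)) *
     Lim (at_right 0) (\<lambda>\<rho>. \<rho> powr ((real DIM('a) - 2) / 2) * sphere_mean u \<rho>)"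

definition H_norm0 :: "'a::euclidean_space set \<Rightarrow> ('a \<Rightarrow> real) \<Rightarrow> real" where
  "H_norm0 \<Omega> u = sqrt (
     Lim (at_right 0) (\<lambda>\<epsilon>.
       (LINT x:\<Omega> - ball 0 \<epsilon>|lebesgue. (norm (grad u x))\<^sup>2)
       - ((real DIM('a) - 2) / 2)\<^sup>2 * (LINT x:\<Omega> - ball 0 \<epsilon>|lebesgue. (u x)\<^sup>2 / (norm x)\<^sup>2))
     - (L_functional u)\<^sup>2)"

text \<open>Multiplication by \<open>|x|\<^bsup>-(N-2)/2\<^esup>\<close>; the value at the origin, where the weight is infinite,
  is 0 by convention and plays no role.\<close>

definition ground_mult :: "('a::euclidean_space \<Rightarrow> real) \<Rightarrow> 'a \<Rightarrow> real" where
  "ground_mult v x = norm x powr (- (real DIM('a) - 2) / 2) * v x"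

definition H_space :: "'a::euclidean_space set \<Rightarrow> ('a \<Rightarrow> real) set" where
  "H_space \<Omega> = completion (ground_mult ` test_functions \<Omega>) (H_norm0 \<Omega>) \<Omega>"

definition H_norm :: "'a::euclidean_space set \<Rightarrow> ('a \<Rightarrow> real) \<Rightarrow> real" where
  "H_norm \<Omega> = completion_norm (ground_mult ` test_functions \<Omega>) (H_norm0 \<Omega>) \<Omega>"

definition Lq_norm ::
    "('a::euclidean_space \<Rightarrow> real) \<Rightarrow> 'a set \<Rightarrow> real \<Rightarrow> ('a \<Rightarrow> real) \<Rightarrow> real" where
  "Lq_norm w \<Omega> q f = (LINT x:\<Omega>|lebesgue. w x * \<bar>f x\<bar> powr q) powr (1 / q)"

definition Lq_finite ::
    "('a::euclidean_space \<Rightarrow> real) \<Rightarrow> 'a set \<Rightarrow> real \<Rightarrow> ('a \<Rightarrow> real) set" where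
  "Lq_finite w \<Omega> q = {f. set_borel_measurable lebesgue \<Omega> f \<and>
     set_integrable lebesgue \<Omega> (\<lambda>x. w x * \<bar>f x\<bar> powr q)}"

definition Lq_closure ::
    "('a::euclidean_space \<Rightarrow> real) \<Rightarrow> 'a set \<Rightarrow> real \<Rightarrow> ('a \<Rightarrow> real) set" where
  "Lq_closure w \<Omega> q = {f \<in> Lq_finite w \<Omega> q.
     \<exists>\<phi>. (\<forall>k. \<phi> k \<in> test_functions \<Omega> \<inter> Lq_finite w \<Omega> q) \<and>
         (\<lambda>k. Lq_norm w \<Omega> q (\<lambda>x. \<phi> k x - f x)) \<longlonglongrightarrow> 0}"

definition bounded_seq_in ::
    "('a \<Rightarrow> real) set \<Rightarrow> (('a \<Rightarrow> real) \<Rightarrow> real) \<Rightarrow> (nat \<Rightarrow> 'a \<Rightarrow> real) \<Rightarrow> bool" where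
  "bounded_seq_in X nX v \<longleftrightarrow> (\<forall>n. v n \<in> X) \<and> (\<exists>B. \<forall>n. nX (v n) \<le> B)"

definition compactly_imbedded ::
    "('a \<Rightarrow> real) set \<Rightarrow> (('a \<Rightarrow> real) \<Rightarrow> real) \<Rightarrow>
     ('a \<Rightarrow> real) set \<Rightarrow> (('a \<Rightarrow> real) \<Rightarrow> real) \<Rightarrow> bool" where
  "compactly_imbedded X nX Y nY \<longleftrightarrow>
     X \<subseteq> Y \<and> (\<exists>C. \<forall>v\<in>X. nY v \<le> C * nX v) \<and>
     (\<forall>v. bounded_seq_in X nX v \<longrightarrow>
        (\<exists>r u. strict_mono (r :: nat \<Rightarrow> nat) \<and> u \<in> Y \<and>
           (\<lambda>n. nY (\<lambda>x. v (r n) x - u x)) \<longlonglongrightarrow> 0))"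

end

theory Submission
  imports Defs "HOL-Complex_Analysis.Great_Picard" "HOL-Library.Diagonal_Subsequence"
begin

text \<open>Write \<open>a = (N - 2) / 2\<close>. For a test function \<open>\<phi>\<close> and \<open>u = |x|\<^bsup>-a\<^esup> \<phi>\<close>, the cross term in \<open>|\<nabla>u|\<^sup>2\<close> is
  \<open>-a |x|\<^bsup>-N\<^esup> x \<bullet> \<nabla>(\<phi>\<^sup>2)\<close>, whose integral is a multiple of \<open>\<phi>(0)\<^sup>2\<close> because \<open>x / |x|\<^sup>N\<close> is a fundamental vector
  field. This makes \<open>\<phi> \<mapsto> u\<close> an isometry onto the dense set of \<open>H(\<Omega>)\<close>.
  The same identity, translated, represents \<open>\<phi>\<close> by its gradient. Since \<open>|y|\<^sup>a \<le> 2\<^sup>a (|x|\<^sup>a + |x - y|\<^sup>a)\<close>, it bounds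
  \<open>|u|\<close> by two Riesz-type potentials of \<open>|y|\<^bsup>-a\<^esup> |\<nabla>\<phi>| \<in> L\<^sup>2\<close>, which a Schur-type argument controls in every \<open>L\<^sup>q\<close>
  with \<open>q < 2N / (N - 2)\<close>. Compactness holds in \<open>L\<^sup>1\<close> by Rellich's theorem (averages over small balls and
  Arzela--Ascoli), and interpolation with the \<open>L\<^sup>p\<close> bounds carries it to all subcritical \<open>q\<close>. Every bound
  passes to the completion by Fatou's lemma.\<close>

section \<open>Polar coordinates and power singularities\<close>

text \<open>The second potential is the obstacle. Its kernel |x - y|^(-N/2) has a square that just
  fails to be locally integrable, so plain Cauchy-Schwarz against a function in L^2 diverges. A
  small part of the power of the kernel is therefore left with the function, and Jensen's inequality
  raises that part to the power \<theta> = q/2. There it has to coexist with |x|^(-2 a \<theta>),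
  which is locally integrable iff \<theta> < N/(N - 2); the other kernel leads to the same
  threshold. Rellich's theorem is applied to \<phi>, whose gradient is bounded in L^1, and not to u.
  The singular weight comes back afterwards: the L^2 bound on u prevents concentration at the
  origin. Estimates use integrals with values in [0, \<infinity>], so that Tonelli's theorem applies
  without prior integrability; the one signed identity is split into positive and negative parts.
  The norm of the completion is an infimum over representing sequences. Bounds are therefore proved
  for every number \<rho> above the norm, and \<rho> is lowered at the end.\<close>

lemma measurable_in_ball [measurable]:
  fixes f :: "'b \<Rightarrow> 'a::euclidean_space"
  assumes "f \<in> borel_measurable M"
  shows "Measurable.pred M (\<lambda>x. f x \<in> ball c r)"
proof -
  have "Measurable.pred M (\<lambda>x. dist c (f x) < r)"
    using assms by measurable
  then show ?thesis by (simp add: mem_ball)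
qed

lemma measurable_in_greaterThan [measurable]:
  fixes f g :: "'b \<Rightarrow> real"
  assumes "f \<in> borel_measurable M" "g \<in> borel_measurable M"
  shows "Measurable.pred M (\<lambda>x. f x \<in> {g x<..})"
  using assms by simp

lemma nn_integral_lborel_scaleR:
  fixes F :: "'a::euclidean_space \<Rightarrow> ennreal"
  assumes [measurable]: "F \<in> borel_measurable borel" and "c \<noteq> 0"
  shows "(\<integral>\<^sup>+x. F x \<partial>lborel) = ennreal (\<bar>c\<bar> ^ DIM('a)) * (\<integral>\<^sup>+y. F (t + c *\<^sub>R y) \<partial>lborel)"
proof -
  have "(\<integral>\<^sup>+x. F x \<partial>lborel) =
    (\<integral>\<^sup>+x. F x \<partial>density (distr lborel borel (\<lambda>x. t + c *\<^sub>R x)) (\<lambda>_. ennreal (\<bar>c\<bar> ^ DIM('a))))"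
    using lborel_affine[OF assms(2), of t] by simp
  also have "\<dots> = ennreal (\<bar>c\<bar> ^ DIM('a)) * (\<integral>\<^sup>+y. F (t + c *\<^sub>R y) \<partial>lborel)"
    by (simp add: nn_integral_density nn_integral_distr nn_integral_cmult)
  finally show ?thesis .
qed

lemma nn_integral_lborel_translate:
  fixes F :: "'a::euclidean_space \<Rightarrow> ennreal"
  assumes "F \<in> borel_measurable borel"
  shows "(\<integral>\<^sup>+x. F (t + x) \<partial>lborel) = (\<integral>\<^sup>+x. F x \<partial>lborel)"
  using nn_integral_lborel_scaleR[OF assms, of 1 t] by simp

lemma nn_integral_powr_tail:
  fixes r c :: real
  assumes "r > 0" "c > 0"
  shows "(\<integral>\<^sup>+s. ennreal (s powr (- c - 1)) * indicator {r<..} s \<partial>lborel) = ennreal (r powr (- c) / c)"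
proof -
  have "(\<integral>\<^sup>+s. ennreal (s powr (- c - 1)) * indicator {r<..} s \<partial>lborel) =
      (\<integral>\<^sup>+s. ennreal (s powr (- c - 1)) * indicator {r..} s \<partial>lborel)"
    by (intro nn_integral_cong_AE, use AE_lborel_singleton[of r] in eventually_elim)
       (auto simp: indicator_def)
  also have "\<dots> = ennreal (0 - (- (r powr (- c) / c)))"
  proof (rule nn_integral_FTC_atLeast)
    show "((\<lambda>s. - (s powr - c / c)) has_real_derivative x powr (- c - 1)) (at x)" if "r \<le> x" for x
      using that assms by (auto intro!: derivative_eq_intros simp: field_simps)
    have "((\<lambda>s. - (s powr - c / c)) \<longlongrightarrow> - (0 / c)) at_top"
      by (intro tendsto_intros tendsto_neg_powr filterlim_ident) (use assms in auto)
    then show "((\<lambda>s. - (s powr - c / c)) \<longlongrightarrow> 0) at_top" by simp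
  qed auto
  finally show ?thesis by simp
qed

text \<open>Polar coordinates without surface measure: integrating the radial integral over the whole
  unit ball instead of over the sphere costs only the factor \<open>N\<close>.\<close>

lemma nn_integral_polar:
  fixes F :: "'a::euclidean_space \<Rightarrow> ennreal"
  assumes [measurable]: "F \<in> borel_measurable borel"
  shows "(\<integral>\<^sup>+x. F x * ennreal (norm x powr (- real DIM('a))) \<partial>lborel) =
    ennreal (real DIM('a)) * (\<integral>\<^sup>+y. (\<integral>\<^sup>+s. F (s *\<^sub>R y) * ennreal (1 / s) * indicator {0<..} s \<partial>lborel)
        * indicator (ball 0 1) y \<partial>lborel)"
proof -
  let ?N = "real DIM('a)"
  have "(\<integral>\<^sup>+y. (\<integral>\<^sup>+s. F (s *\<^sub>R y) * ennreal (1 / s) * indicator {0<..} s \<partial>lborel)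
        * indicator (ball 0 1) y \<partial>lborel) =
     (\<integral>\<^sup>+y. (\<integral>\<^sup>+s. F (s *\<^sub>R y) * ennreal (1 / s) * indicator {0<..} s * indicator (ball 0 1) y \<partial>lborel)
        \<partial>lborel)"
    by (intro nn_integral_cong nn_integral_multc[symmetric]) measurable
  also have "\<dots> = (\<integral>\<^sup>+s. (\<integral>\<^sup>+y. F (s *\<^sub>R y) * ennreal (1 / s) * indicator {0<..} s * indicator (ball 0 1) y
        \<partial>lborel) \<partial>lborel)"
    by (rule lborel_pair.Fubini') measurable
  \<comment> \<open>Substituting x = s y turns dy into s^(-N) dx and |y| < 1 into s > |x|; the
    integral of s^(-N-1) over that range is |x|^(-N) / N.\<close>
  also have "\<dots> = (\<integral>\<^sup>+s. (\<integral>\<^sup>+x. F x * (ennreal (s powr (- ?N - 1)) * indicator {0<..} s * indicator {norm x<..} s)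
        \<partial>lborel) \<partial>lborel)"
  proof (rule nn_integral_cong)
    fix s :: real
    show "(\<integral>\<^sup>+y. F (s *\<^sub>R y) * ennreal (1 / s) * indicator {0<..} s * indicator (ball (0::'a) 1) y \<partial>lborel)
      = (\<integral>\<^sup>+x. F x * (ennreal (s powr (- ?N - 1)) * indicator {0<..} s * indicator {norm x<..} s) \<partial>lborel)"
    proof (cases "s > 0")
      case True
      have p: "s ^ DIM('a) * s powr (- ?N - 1) = 1 / s"
        using True by (simp add: powr_realpow[symmetric] powr_add[symmetric] powr_minus divide_simps)
      have "(\<integral>\<^sup>+x. F x * (ennreal (s powr (- ?N - 1)) * indicator {0<..} s * indicator {norm x<..} s) \<partial>lborel)
        = (\<integral>\<^sup>+x. F x * ennreal (s powr (- ?N - 1)) * indicator (ball 0 s) x \<partial>lborel)"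
        using True by (intro nn_integral_cong) (auto simp: indicator_def)
      also have "\<dots> = ennreal (\<bar>s\<bar> ^ DIM('a)) *
          (\<integral>\<^sup>+x. F (0 + s *\<^sub>R x) * ennreal (s powr (- ?N - 1)) * indicator (ball 0 s) (0 + s *\<^sub>R x) \<partial>lborel)"
        using True by (intro nn_integral_lborel_scaleR) auto
      also have "\<dots> = (\<integral>\<^sup>+x. ennreal (\<bar>s\<bar> ^ DIM('a)) *
          (F (0 + s *\<^sub>R x) * ennreal (s powr (- ?N - 1)) * indicator (ball 0 s) (0 + s *\<^sub>R x)) \<partial>lborel)"
        by (intro nn_integral_cmult[symmetric]) measurable
      also have "\<dots> = (\<integral>\<^sup>+y. F (s *\<^sub>R y) * ennreal (1 / s) * indicator {0<..} s * indicator (ball (0::'a) 1) y \<partial>lborel)"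
      proof (intro nn_integral_cong)
        fix y :: 'a
        have "ennreal (\<bar>s\<bar> ^ DIM('a)) * (F (0 + s *\<^sub>R y) * ennreal (s powr (- ?N - 1)) * indicator (ball 0 s) (0 + s *\<^sub>R y))
          = F (s *\<^sub>R y) * (ennreal (s ^ DIM('a)) * ennreal (s powr (- ?N - 1))) * indicator (ball 0 s) (s *\<^sub>R y)"
          using True by (simp add: mult_ac)
        also have "ennreal (s ^ DIM('a)) * ennreal (s powr (- ?N - 1)) = ennreal (1 / s)"
          using True by (simp add: ennreal_mult[symmetric] p)
        also have "indicator (ball 0 s) (s *\<^sub>R y) = (indicator {0<..} s * indicator (ball 0 1) y :: ennreal)"
          using True by (simp add: indicator_def)
        finally show "ennreal (\<bar>s\<bar> ^ DIM('a)) * (F (0 + s *\<^sub>R y) * ennreal (s powr (- ?N - 1)) * indicator (ball 0 s) (0 + s *\<^sub>R y))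
          = F (s *\<^sub>R y) * ennreal (1 / s) * indicator {0<..} s * indicator (ball (0::'a) 1) y"
          by (simp add: mult_ac)
      qed
      finally show ?thesis by simp
    qed simp
  qed
  also have "\<dots> = (\<integral>\<^sup>+x. (\<integral>\<^sup>+s. F x * (ennreal (s powr (- ?N - 1)) * indicator {0<..} s * indicator {norm x<..} s)
        \<partial>lborel) \<partial>lborel)"
    by (rule lborel_pair.Fubini'[symmetric]) measurable
  also have "\<dots> = (\<integral>\<^sup>+x. F x * ennreal (norm x powr (- ?N) / ?N) \<partial>lborel)"
  proof (intro nn_integral_cong_AE, use AE_lborel_singleton[of "0::'a"] in eventually_elim)
    fix x :: 'a assume x: "x \<noteq> 0"
    have "(\<integral>\<^sup>+s. F x * (ennreal (s powr (- ?N - 1)) * indicator {0<..} s * indicator {norm x<..} s) \<partial>lborel)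
      = F x * (\<integral>\<^sup>+s. ennreal (s powr (- ?N - 1)) * indicator {0<..} s * indicator {norm x<..} s \<partial>lborel)"
      by (intro nn_integral_cmult) measurable
    also have "(\<integral>\<^sup>+s. ennreal (s powr (- ?N - 1)) * indicator {0<..} s * indicator {norm x<..} s \<partial>lborel)
      = (\<integral>\<^sup>+s. ennreal (s powr (- ?N - 1)) * indicator {norm x<..} s \<partial>lborel)"
      by (intro nn_integral_cong) (auto simp: indicator_def dest: le_less_trans[OF norm_ge_zero])
    also have "\<dots> = ennreal (norm x powr (- ?N) / ?N)"
      using nn_integral_powr_tail[of "norm x" ?N] x by simp
    finally show "(\<integral>\<^sup>+s. F x * (ennreal (s powr (- ?N - 1)) * indicator {0<..} s * indicator {norm x<..} s) \<partial>lborel)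
      = F x * ennreal (norm x powr (- ?N) / ?N)" .
  qed
  finally have "ennreal ?N * (\<integral>\<^sup>+y. (\<integral>\<^sup>+s. F (s *\<^sub>R y) * ennreal (1 / s) * indicator {0<..} s \<partial>lborel)
        * indicator (ball 0 1) y \<partial>lborel) = ennreal ?N * (\<integral>\<^sup>+x. F x * ennreal (norm x powr (- ?N) / ?N) \<partial>lborel)"
    by simp
  also have "\<dots> = (\<integral>\<^sup>+x. ennreal ?N * (F x * ennreal (norm x powr (- ?N) / ?N)) \<partial>lborel)"
    by (intro nn_integral_cmult[symmetric]) measurable
  also have "\<dots> = (\<integral>\<^sup>+x. F x * ennreal (norm x powr (- ?N)) \<partial>lborel)"
  proof (intro nn_integral_cong)
    fix x :: 'a
    have "ennreal ?N * (F x * ennreal (norm x powr (- ?N) / ?N)) = F x * (ennreal ?N * ennreal (norm x powr (- ?N) / ?N))"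
      by (simp add: mult_ac)
    also have "ennreal ?N * ennreal (norm x powr (- ?N) / ?N) = ennreal (norm x powr (- ?N))"
      by (subst ennreal_mult[symmetric]) auto
    finally show "ennreal ?N * (F x * ennreal (norm x powr (- ?N) / ?N)) = F x * ennreal (norm x powr (- ?N))" .
  qed
  finally show ?thesis by simp
qed

text \<open>In polar form the radial integrand is |y|^e r^(e-1) with e = N - s > 0, and its integral
  up to r = R/|y| is R^e / e for every y. Translation makes the constant uniform in the centre, as
  needed for kernels centred at variable points.\<close>

lemma nn_integral_ball_powr:
  fixes R s :: real
  assumes "s < real DIM('a::euclidean_space)" "R > 0"
  shows "\<exists>C\<ge>0. \<forall>z::'a. (\<integral>\<^sup>+x. ennreal (norm (x - z) powr (- s)) * indicator (ball z R) x \<partial>lborel) \<le> ennreal C"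
proof -
  let ?N = "real DIM('a)"
  define e where "e = ?N - s"
  have e: "e > 0" using assms by (simp add: e_def)
  have "(\<integral>\<^sup>+x. ennreal (norm (x::'a) powr (- s)) * indicator (ball 0 R) x \<partial>lborel) =
     (\<integral>\<^sup>+x. ennreal (norm (x::'a) powr e) * indicator (ball 0 R) x * ennreal (norm x powr (- ?N)) \<partial>lborel)"
  proof (intro nn_integral_cong)
    fix x :: 'a
    have "norm x powr (- s) = norm x powr e * norm x powr (- ?N)"
      by (simp add: e_def powr_add[symmetric])
    then show "ennreal (norm x powr (- s)) * indicator (ball 0 R) x =
      ennreal (norm x powr e) * indicator (ball 0 R) x * ennreal (norm x powr (- ?N))"
      by (simp add: ennreal_mult mult_ac)
  qed
  also have "\<dots> = ennreal ?N * (\<integral>\<^sup>+y. (\<integral>\<^sup>+r. ennreal (norm (r *\<^sub>R y :: 'a) powr e) * indicator (ball 0 R) (r *\<^sub>R y) * ennreal (1 / r)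
       * indicator {0<..} r \<partial>lborel) * indicator (ball 0 1) y \<partial>lborel)"
    by (rule nn_integral_polar) measurable
  also have "\<dots> \<le> ennreal ?N * (\<integral>\<^sup>+y. ennreal (R powr e / e) * indicator (ball (0::'a) 1) y \<partial>lborel)"
  proof (intro mult_left_mono nn_integral_mono_AE, use AE_lborel_singleton[of "0::'a"] in eventually_elim)
    fix y :: 'a assume y: "y \<noteq> 0"
    let ?S = "R / norm y"
    have "(\<integral>\<^sup>+r. ennreal (norm (r *\<^sub>R y) powr e) * indicator (ball 0 R) (r *\<^sub>R y) * ennreal (1 / r)
       * indicator {0<..} r \<partial>lborel) \<le> (\<integral>\<^sup>+r. ennreal (norm y powr e) * (ennreal (r powr (e - 1)) * indicator {0 .. ?S} r) \<partial>lborel)"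
    proof (intro nn_integral_mono)
      fix r :: real
      show "ennreal (norm (r *\<^sub>R y) powr e) * indicator (ball 0 R) (r *\<^sub>R y) * ennreal (1 / r)
       * indicator {0<..} r \<le> ennreal (norm y powr e) * (ennreal (r powr (e - 1)) * indicator {0 .. ?S} r)"
      proof (cases "r > 0 \<and> r * norm y < R")
        case True
        have "norm (r *\<^sub>R y) powr e * (1 / r) = norm y powr e * r powr (e - 1)"
          using True by (simp add: powr_mult powr_diff)
        then show ?thesis using True y by (simp add: ennreal_mult[symmetric] field_simps)
      next
        case False
        then show ?thesis by (auto simp: indicator_def)
      qed
    qed
    also have "\<dots> = ennreal (norm y powr e) * (\<integral>\<^sup>+r. ennreal (r powr (e - 1)) * indicator {0 .. ?S} r \<partial>lborel)"
      by (intro nn_integral_cmult) measurable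
    also have "(\<integral>\<^sup>+r. ennreal (r powr (e - 1)) * indicator {0 .. ?S} r \<partial>lborel) = ennreal (?S powr e / e)"
    proof -
      have "((\<lambda>r. r powr (e - 1)) has_integral (?S powr (e - 1 + 1) / (e - 1 + 1))) {0..?S}"
        using has_integral_powr_from_0[of "e - 1" ?S] e assms(2) by auto
      then have "(\<integral>\<^sup>+r. ennreal (indicator {0 .. ?S} r * r powr (e - 1)) \<partial>lborel) = ennreal (?S powr e / e)"
        by (intro nn_integral_has_integral_lebesgue) auto
      then show ?thesis by (simp add: ennreal_mult ennreal_indicator mult.commute)
    qed
    also have "ennreal (norm y powr e) * ennreal (?S powr e / e) = ennreal (R powr e / e)"
      using y assms e by (simp add: ennreal_mult[symmetric] powr_divide)
    finally show "(\<integral>\<^sup>+r. ennreal (norm (r *\<^sub>R y) powr e) * indicator (ball 0 R) (r *\<^sub>R y) * ennreal (1 / r)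
       * indicator {0<..} r \<partial>lborel) * indicator (ball 0 1) y \<le> ennreal (R powr e / e) * indicator (ball 0 1) y"
      by (intro mult_right_mono) auto
  qed simp
  also have "\<dots> = ennreal ?N * (ennreal (R powr e / e) * emeasure lborel (ball (0::'a) 1))"
    by (subst nn_integral_cmult_indicator) auto
  also have "\<dots> < \<infinity>"
    using emeasure_lborel_ball_finite[of "0::'a" 1] by (simp add: ennreal_mult_less_top)
  finally have fin: "(\<integral>\<^sup>+x. ennreal (norm (x::'a) powr (- s)) * indicator (ball 0 R) x \<partial>lborel) < \<infinity>" .
  define C where "C = enn2real (\<integral>\<^sup>+x. ennreal (norm (x::'a) powr (- s)) * indicator (ball 0 R) x \<partial>lborel)"
  show ?thesis
  proof (intro exI[of _ C] conjI allI)
    fix z :: 'a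
    have "(\<integral>\<^sup>+x. ennreal (norm (x - z) powr (- s)) * indicator (ball z R) x \<partial>lborel) =
      (\<integral>\<^sup>+x. ennreal (norm (z + x - z) powr (- s)) * indicator (ball z R) (z + x) \<partial>lborel)"
      by (rule nn_integral_lborel_translate[symmetric]) measurable
    also have "\<dots> = ennreal C"
      using fin by (simp add: C_def indicator_def dist_norm)
    finally show "(\<integral>\<^sup>+x. ennreal (norm (x - z) powr (- s)) * indicator (ball z R) x \<partial>lborel) \<le> ennreal C" by simp
  qed (simp add: C_def)
qed

section \<open>Continuously differentiable functions of compact support\<close>

lemma emeasure_lborel_ball:
  "emeasure lborel (ball c r) = ennreal (measure lborel (ball (c::'a::euclidean_space) r))"
  using emeasure_lborel_ball_finite[of c r] by (intro emeasure_eq_ennreal_measure) auto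

text \<open>The gradient \<open>g\<close> is a parameter of its own, so that the square of a
  function, with gradient \<open>(2 * \<phi> x) *\<^sub>R g x\<close>, is again an instance. One
  \<open>R\<close> for a whole family keeps constants uniform.\<close>

locale C1_supported =
  fixes \<phi> :: "'a::euclidean_space \<Rightarrow> real" and g :: "'a \<Rightarrow> 'a" and R :: real
  assumes deriv: "(\<phi> has_derivative (\<lambda>h. g x \<bullet> h)) (at x)"
    and cont: "continuous_on UNIV g"
    and R: "R > 0"
    and outside: "norm x \<ge> R \<Longrightarrow> \<phi> x = 0" "norm x \<ge> R \<Longrightarrow> g x = 0"
begin

lemma cont_fun: "continuous_on UNIV \<phi>"
  using deriv by (meson continuous_at_imp_continuous_on has_derivative_continuous)

lemma measurable_fun [measurable]: "\<phi> \<in> borel_measurable borel"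
  by (intro borel_measurable_continuous_onI cont_fun)

lemma measurable_grad [measurable]: "g \<in> borel_measurable borel"
  by (intro borel_measurable_continuous_onI cont)

lemma grad_bounded: "\<exists>C>0. \<forall>x. norm (g x) \<le> C"
proof -
  have "bounded (g ` cball 0 R)"
    by (intro compact_imp_bounded compact_continuous_image continuous_on_subset[OF cont]) auto
  then obtain C where "C > 0" "\<forall>x\<in>cball 0 R. norm (g x) \<le> C"
    by (auto simp: bounded_pos)
  then show ?thesis
    by (metis cball_def dist_0_norm le_cases mem_Collect_eq norm_zero outside(2) less_imp_le)
qed

lemma fun_bounded: "\<exists>C>0. \<forall>x. \<bar>\<phi> x\<bar> \<le> C"
proof -
  have "bounded (\<phi> ` cball 0 R)"
    by (intro compact_imp_bounded compact_continuous_image continuous_on_subset[OF cont_fun]) auto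
  then obtain C where "C > 0" "\<forall>x\<in>cball 0 R. norm (\<phi> x) \<le> C"
    by (auto simp: bounded_pos)
  then show ?thesis
    by (metis cball_def dist_0_norm le_cases mem_Collect_eq norm_zero outside(1) less_imp_le real_norm_def)
qed

section \<open>The fundamental theorem along rays, and its consequences\<close>

lemma ray_integral:
  assumes "T \<ge> 0"
  shows "((\<lambda>t. g (x + t *\<^sub>R h) \<bullet> h) has_integral (\<phi> (x + T *\<^sub>R h) - \<phi> x)) {0..T}"
proof -
  have "((\<lambda>t. g (x + t *\<^sub>R h) \<bullet> h) has_integral (\<phi> (x + T *\<^sub>R h) - \<phi> (x + 0 *\<^sub>R h))) {0..T}"
  proof (rule fundamental_theorem_of_calculus[OF assms])
    fix t :: real
    have "((\<lambda>t. \<phi> (x + t *\<^sub>R h)) has_derivative (\<lambda>s. g (x + t *\<^sub>R h) \<bullet> (s *\<^sub>R h))) (at t)"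
      by (rule has_derivative_compose[of "\<lambda>t. x + t *\<^sub>R h" "\<lambda>s. s *\<^sub>R h" t UNIV \<phi> "\<lambda>h'. g (x + t *\<^sub>R h) \<bullet> h'"])
         (auto intro!: derivative_eq_intros deriv)
    then show "((\<lambda>t. \<phi> (x + t *\<^sub>R h)) has_vector_derivative g (x + t *\<^sub>R h) \<bullet> h) (at t within {0..T})"
      unfolding has_vector_derivative_def
      by (auto intro: has_derivative_at_withinI)
  qed
  then show ?thesis by simp
qed

lemma ray_bochner:
  assumes "T \<ge> 0"
  shows "has_bochner_integral lborel (\<lambda>t. indicator {0..T} t * (g (x + t *\<^sub>R h) \<bullet> h)) (\<phi> (x + T *\<^sub>R h) - \<phi> x)"
proof -
  have c: "continuous_on {0..T} (\<lambda>t. g (x + t *\<^sub>R h) \<bullet> h)"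
    by (intro continuous_intros continuous_on_compose2[OF cont]) auto
  have i: "set_integrable lborel {0..T} (\<lambda>t. g (x + t *\<^sub>R h) \<bullet> h)"
    by (rule borel_integrable_atLeastAtMost') (rule c)
  have "(LINT t:{0..T}|lborel. g (x + t *\<^sub>R h) \<bullet> h) = \<phi> (x + T *\<^sub>R h) - \<phi> x"
    using set_borel_integral_eq_integral(2)[OF i] integral_unique[OF ray_integral[OF assms]] by simp
  with i show ?thesis
    by (simp add: has_bochner_integral_iff set_integrable_def set_lebesgue_integral_def)
qed

lemma ray_bound:
  assumes "T \<ge> 0"
  shows "ennreal \<bar>\<phi> (x + T *\<^sub>R h) - \<phi> x\<bar> \<le> (\<integral>\<^sup>+t. ennreal (norm (g (x + t *\<^sub>R h)) * norm h) * indicator {0..T} t \<partial>lborel)"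
proof -
  have "ennreal \<bar>\<phi> (x + T *\<^sub>R h) - \<phi> x\<bar> \<le> (\<integral>\<^sup>+t. ennreal (norm (indicator {0..T} t * (g (x + t *\<^sub>R h) \<bullet> h))) \<partial>lborel)"
    using ray_bochner[OF assms, of x h] integral_norm_bound_ennreal by (force simp: has_bochner_integral_iff)
  also have "\<dots> \<le> (\<integral>\<^sup>+t. ennreal (norm (g (x + t *\<^sub>R h)) * norm h) * indicator {0..T} t \<partial>lborel)"
    by (intro nn_integral_mono) (auto simp: indicator_def norm_mult Cauchy_Schwarz_ineq2 ennreal_leI)
  finally show ?thesis .
qed

text \<open>The increment along the segment from x to x + h is integrated in x first; by translation
  invariance each point of the segment contributes the same mass of |g|. The gradient estimates in
  the Rellich argument all come from this one.\<close>

lemma translation_bound: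
  "(\<integral>\<^sup>+x. ennreal \<bar>\<phi> (x + h) - \<phi> x\<bar> \<partial>lborel) \<le> ennreal (norm h) * (\<integral>\<^sup>+x. ennreal (norm (g x)) \<partial>lborel)"
proof -
  have "(\<integral>\<^sup>+x. ennreal \<bar>\<phi> (x + h) - \<phi> x\<bar> \<partial>lborel) \<le>
     (\<integral>\<^sup>+x. (\<integral>\<^sup>+t. ennreal (norm (g (x + t *\<^sub>R h)) * norm h) * indicator {0..1::real} t \<partial>lborel) \<partial>lborel)"
    using ray_bound[of 1 _ h] by (intro nn_integral_mono) auto
  also have "\<dots> = (\<integral>\<^sup>+t. (\<integral>\<^sup>+x. ennreal (norm (g (x + t *\<^sub>R h)) * norm h) * indicator {0..1::real} t \<partial>lborel) \<partial>lborel)"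
    by (rule lborel_pair.Fubini') measurable
  also have "\<dots> = (\<integral>\<^sup>+t. (ennreal (norm h) * (\<integral>\<^sup>+x. ennreal (norm (g x)) \<partial>lborel)) * indicator {0..1::real} t \<partial>lborel)"
  proof (intro nn_integral_cong)
    fix t :: real
    have "(\<integral>\<^sup>+x. ennreal (norm (g (x + t *\<^sub>R h)) * norm h) * indicator {0..1::real} t \<partial>lborel)
       = (\<integral>\<^sup>+x. (ennreal (norm h) * indicator {0..1::real} t) * ennreal (norm (g (t *\<^sub>R h + x))) \<partial>lborel)"
      by (intro nn_integral_cong) (simp add: ennreal_mult mult_ac add_ac)
    also have "\<dots> = (ennreal (norm h) * indicator {0..1::real} t) * (\<integral>\<^sup>+x. ennreal (norm (g (t *\<^sub>R h + x))) \<partial>lborel)"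
      by (intro nn_integral_cmult) measurable
    also have "(\<integral>\<^sup>+x. ennreal (norm (g (t *\<^sub>R h + x))) \<partial>lborel) = (\<integral>\<^sup>+x. ennreal (norm (g x)) \<partial>lborel)"
      by (intro nn_integral_lborel_translate) measurable
    finally show "(\<integral>\<^sup>+x. ennreal (norm (g (x + t *\<^sub>R h)) * norm h) * indicator {0..1::real} t \<partial>lborel)
      = (ennreal (norm h) * (\<integral>\<^sup>+x. ennreal (norm (g x)) \<partial>lborel)) * indicator {0..1::real} t"
      by (simp add: mult_ac)
  qed
  also have "\<dots> = ennreal (norm h) * (\<integral>\<^sup>+x. ennreal (norm (g x)) \<partial>lborel)"
    by (subst nn_integral_cmult_indicator) auto
  finally show ?thesis .
qed

text \<open>Every ray from z leaves the support, so |\<phi>(z)| is at most the integral of |g| along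
  it. Averaging over the directions y in the unit ball and undoing the polar form gives a Riesz
  potential; the constant on the left is the area of the unit sphere.\<close>

lemma point_bound:
  "ennreal (real DIM('a) * measure lborel (ball (0::'a) 1) * \<bar>\<phi> z\<bar>) \<le>
    (\<integral>\<^sup>+y. ennreal (norm (g y) * norm (y - z) powr (1 - real DIM('a))) \<partial>lborel)"
proof -
  let ?N = "real DIM('a)"
  define F where "F x = ennreal (norm (g (z + x)) * norm x)" for x
  have [measurable]: "F \<in> borel_measurable borel" unfolding F_def by measurable
  have "ennreal (?N * measure lborel (ball (0::'a) 1) * \<bar>\<phi> z\<bar>)
      = ennreal ?N * (\<integral>\<^sup>+y. ennreal \<bar>\<phi> z\<bar> * indicator (ball (0::'a) 1) y \<partial>lborel)"
    by (subst nn_integral_cmult_indicator)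
       (auto simp: ennreal_mult emeasure_lborel_ball mult_ac)
  also have "\<dots> \<le> ennreal ?N * (\<integral>\<^sup>+y. (\<integral>\<^sup>+s. F (s *\<^sub>R y) * ennreal (1 / s) * indicator {0<..} s \<partial>lborel)
        * indicator (ball 0 1) y \<partial>lborel)"
  proof (intro mult_left_mono nn_integral_mono_AE, use AE_lborel_singleton[of "0::'a"] in eventually_elim)
    fix y :: 'a assume y: "y \<noteq> 0"
    \<comment> \<open>Then |T y| = R + |z|, so z + T y lies outside the ball of radius R.\<close>
    define T where "T = (R + norm z) / norm y"
    have T: "T \<ge> 0" using R by (simp add: T_def)
    have "norm (T *\<^sub>R y) - norm z \<ge> R" using y R by (simp add: T_def)
    then have "norm (z + T *\<^sub>R y) \<ge> R" using norm_diff_ineq[of "T *\<^sub>R y" z] by (simp add: add.commute)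
    then have "\<phi> (z + T *\<^sub>R y) = 0" by (rule outside)
    then have "ennreal \<bar>\<phi> z\<bar> \<le> (\<integral>\<^sup>+t. ennreal (norm (g (z + t *\<^sub>R y)) * norm y) * indicator {0..T} t \<partial>lborel)"
      using ray_bound[OF T, of z y] by simp
    also have "\<dots> \<le> (\<integral>\<^sup>+s. F (s *\<^sub>R y) * ennreal (1 / s) * indicator {0<..} s \<partial>lborel)"
    proof (intro nn_integral_mono_AE, use AE_lborel_singleton[of "0::real"] in eventually_elim)
      fix s :: real assume "s \<noteq> 0"
      then show "ennreal (norm (g (z + s *\<^sub>R y)) * norm y) * indicator {0..T} s \<le> F (s *\<^sub>R y) * ennreal (1 / s) * indicator {0<..} s"
        by (auto simp: F_def indicator_def ennreal_mult[symmetric] intro!: ennreal_leI)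
    qed
    finally show "ennreal \<bar>\<phi> z\<bar> * indicator (ball 0 1) y \<le>
      (\<integral>\<^sup>+s. F (s *\<^sub>R y) * ennreal (1 / s) * indicator {0<..} s \<partial>lborel) * indicator (ball 0 1) y"
      by (intro mult_right_mono) auto
  qed simp
  also have "\<dots> = (\<integral>\<^sup>+x. F x * ennreal (norm x powr (- ?N)) \<partial>lborel)"
    by (rule nn_integral_polar[symmetric]) measurable
  also have "\<dots> = (\<integral>\<^sup>+x. ennreal (norm (g (z + x)) * norm ((z + x) - z) powr (1 - ?N)) \<partial>lborel)"
  proof (intro nn_integral_cong)
    fix x :: 'a
    have "norm x powr (1 - ?N) = norm x * norm x powr (- ?N)"
      using powr_add[of "norm x" 1 "- ?N"] by simp
    then show "F x * ennreal (norm x powr (- ?N)) = ennreal (norm (g (z + x)) * norm ((z + x) - z) powr (1 - ?N))"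
      by (simp add: F_def ennreal_mult[symmetric] mult_ac)
  qed
  also have "\<dots> = (\<integral>\<^sup>+y. ennreal (norm (g y) * norm (y - z) powr (1 - ?N)) \<partial>lborel)"
    by (rule nn_integral_lborel_translate[of "\<lambda>y. ennreal (norm (g y) * norm (y - z) powr (1 - ?N))" z]) measurable
  finally show ?thesis .
qed

text \<open>The fundamental solution identity \<open>div (x / |x|\<^sup>N) = N \<omega>\<^sub>N \<delta>\<^sub>0\<close>, tested against \<open>\<phi>\<close>.\<close>

lemma radial_derivative_integral:
  "has_bochner_integral lborel (\<lambda>x. norm x powr (- real DIM('a)) * (g x \<bullet> x))
     (- real DIM('a) * measure lborel (ball (0::'a) 1) * \<phi> 0)"
proof -
  let ?N = "real DIM('a)" and ?w = "measure lborel (ball (0::'a) 1)"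
  \<comment> \<open>\<open>ennreal\<close> cuts off negative values, so c = 1 and c = -1 give the
    positive and the negative part of the integrand, and \<open>nn_integral_polar\<close> applies to
    each.\<close>
  define F where "F c x = ennreal (c * (g x \<bullet> x))" for c x
  define A where "A c y = (\<integral>\<^sup>+s. F c (s *\<^sub>R y) * ennreal (1 / s) * indicator {0<..} s \<partial>lborel)" for c y
  define P where "P c = (\<integral>\<^sup>+x. F c x * ennreal (norm x powr (- ?N)) \<partial>lborel)" for c
  have [measurable]: "F c \<in> borel_measurable borel" for c unfolding F_def by measurable
  have [measurable]: "A c \<in> borel_measurable borel" for c unfolding A_def by measurable
  \<comment> \<open>Along the ray through y the positive part minus the negative part is -\<phi>(0).
    The identity is written with additions only, since subtraction in \<open>ennreal\<close> is
    truncated.\<close>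
  have A_eq: "A 1 y + ennreal (\<phi> 0) = A (-1) y + ennreal (- \<phi> 0)" if y: "y \<noteq> 0" for y
  proof -
    define T where "T = R / norm y"
    have T: "T \<ge> 0" using R by (simp add: T_def)
    have out: "norm (t *\<^sub>R y) \<ge> R" if "t \<ge> T" for t
    proof -
      have "t * norm y \<ge> T * norm y" using that by (intro mult_right_mono) auto
      also have "T * norm y = R" using y by (simp add: T_def)
      finally show ?thesis using that T by simp
    qed
    let ?h = "\<lambda>t. indicator {0..T} t * (g (t *\<^sub>R y) \<bullet> y)"
    have h: "has_bochner_integral lborel ?h (- \<phi> 0)"
      using ray_bochner[OF T, of 0 y] outside(1)[OF out[of T]] by simp
    have AI: "A c y = (\<integral>\<^sup>+t. ennreal (c * ?h t) \<partial>lborel)" for c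
      unfolding A_def
    proof (intro nn_integral_cong_AE, use AE_lborel_singleton[of "0::real"] in eventually_elim)
      fix t :: real assume "t \<noteq> 0"
      show "F c (t *\<^sub>R y) * ennreal (1 / t) * indicator {0<..} t = ennreal (c * ?h t)"
      proof (cases "t > 0")
        case True
        have "F c (t *\<^sub>R y) * ennreal (1 / t) = ennreal (c * (g (t *\<^sub>R y) \<bullet> (t *\<^sub>R y)) * (1 / t))"
          unfolding F_def using True by (intro ennreal_mult''[symmetric]) auto
        also have "c * (g (t *\<^sub>R y) \<bullet> (t *\<^sub>R y)) * (1 / t) = c * (g (t *\<^sub>R y) \<bullet> y)" using True by simp
        finally show ?thesis using True outside(2)[OF out[of t]] by (auto simp: indicator_def)
      next
        case False
        with \<open>t \<noteq> 0\<close> show ?thesis by (auto simp: indicator_def)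
      qed
    qed
    have hi: "integrable lborel ?h" and he: "integral\<^sup>L lborel ?h = - \<phi> 0"
      using h by (auto simp: has_bochner_integral_iff)
    have "A 1 y < \<infinity>" "A (-1) y < \<infinity>"
      using real_integrable_def[of lborel ?h] hi by (auto simp: AI less_top)
    moreover have "enn2real (A 1 y) - enn2real (A (-1) y) = - \<phi> 0"
      using real_lebesgue_integral_def[OF hi] he by (simp add: AI)
    ultimately have "\<exists>p m. p \<ge> 0 \<and> m \<ge> 0 \<and> A 1 y = ennreal p \<and> A (-1) y = ennreal m \<and> p - m = - \<phi> 0"
      by (intro exI[of _ "enn2real (A 1 y)"] exI[of _ "enn2real (A (-1) y)"]) auto
    then obtain p m where "p \<ge> 0" "m \<ge> 0" "A 1 y = ennreal p" "A (-1) y = ennreal m" "p - m = - \<phi> 0"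
      by blast
    then show ?thesis
      by (cases "\<phi> 0 \<ge> 0") (auto simp: ennreal_neg simp flip: ennreal_plus)
  qed
  have PA: "P c + ennreal ?N * (ennreal (c * \<phi> 0) * ennreal ?w) =
      ennreal ?N * (\<integral>\<^sup>+y. (A c y + ennreal (c * \<phi> 0)) * indicator (ball 0 1) y \<partial>lborel)" for c
  proof -
    have "(\<integral>\<^sup>+y. (A c y + ennreal (c * \<phi> 0)) * indicator (ball 0 1) y \<partial>lborel) =
       (\<integral>\<^sup>+y. A c y * indicator (ball 0 1) y \<partial>lborel) + (\<integral>\<^sup>+y. ennreal (c * \<phi> 0) * indicator (ball (0::'a) 1) y \<partial>lborel)"
      by (subst nn_integral_add[symmetric]) (auto simp: distrib_right)
    also have "(\<integral>\<^sup>+y. ennreal (c * \<phi> 0) * indicator (ball (0::'a) 1) y \<partial>lborel) = ennreal (c * \<phi> 0) * ennreal ?w"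
      by (subst nn_integral_cmult_indicator)
         (auto simp: emeasure_lborel_ball)
    finally show ?thesis
      unfolding P_def by (subst nn_integral_polar) (auto simp: A_def distrib_left)
  qed
  have "P 1 + ennreal ?N * (ennreal (1 * \<phi> 0) * ennreal ?w) = P (-1) + ennreal ?N * (ennreal (-1 * \<phi> 0) * ennreal ?w)"
    unfolding PA
    by (intro arg_cong[where f="\<lambda>x. ennreal ?N * x"] nn_integral_cong_AE, use AE_lborel_singleton[of "0::'a"] in eventually_elim)
       (use A_eq in simp)
  then have PP: "P 1 + ennreal (?N * ?w * \<phi> 0) = P (-1) + ennreal (?N * ?w * (- \<phi> 0))"
    by (simp add: ennreal_mult'[symmetric] ennreal_mult''[symmetric] mult_ac)
  \<comment> \<open>The integrand is at most C |x|^(1-N) on the ball and zero outside, and N - 1 <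
    N.\<close>
  have fin: "P c < \<infinity>" if c: "\<bar>c\<bar> \<le> 1" for c
  proof -
    obtain C where C: "C > 0" "\<And>x. norm (g x) \<le> C" using grad_bounded by auto
    obtain K where K: "\<And>z::'a. (\<integral>\<^sup>+x. ennreal (norm (x - z) powr (- (?N - 1))) * indicator (ball z R) x \<partial>lborel) \<le> ennreal K"
      using nn_integral_ball_powr[where 'a='a, of "?N - 1" R] R by auto
    have "P c \<le> (\<integral>\<^sup>+x. ennreal C * (ennreal (norm (x - (0::'a)) powr (- (?N - 1))) * indicator (ball 0 R) x) \<partial>lborel)"
      unfolding P_def
    proof (intro nn_integral_mono)
      fix x :: 'a
      show "F c x * ennreal (norm x powr (- ?N)) \<le> ennreal C * (ennreal (norm (x - 0) powr (- (?N - 1))) * indicator (ball 0 R) x)"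
      proof (cases "norm x < R")
        case True
        have "c * (g x \<bullet> x) \<le> \<bar>c\<bar> * \<bar>g x \<bullet> x\<bar>" by (metis abs_ge_self abs_mult)
        also have "\<dots> \<le> 1 * (norm (g x) * norm x)"
          using c by (intro mult_mono Cauchy_Schwarz_ineq2) auto
        also have "\<dots> \<le> C * norm x" using C by (simp add: mult_right_mono)
        finally have "F c x * ennreal (norm x powr (- ?N)) \<le> ennreal (C * norm x) * ennreal (norm x powr (- ?N))"
          unfolding F_def by (intro mult_right_mono ennreal_leI) auto
        also have "\<dots> = ennreal (C * (norm x * norm x powr (- ?N)))"
          using C by (simp add: ennreal_mult[symmetric] mult_ac)
        also have "norm x * norm x powr (- ?N) = norm x powr (- (?N - 1))"
          using powr_add[of "norm x" 1 "- ?N"] by simp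
        finally show ?thesis using True C by (simp add: ennreal_mult)
      next
        case False
        then show ?thesis using outside(2)[of x] by (simp add: F_def)
      qed
    qed
    also have "\<dots> = ennreal C * (\<integral>\<^sup>+x. ennreal (norm (x - 0) powr (- (?N - 1))) * indicator (ball (0::'a) R) x \<partial>lborel)"
      by (intro nn_integral_cmult) measurable
    also have "\<dots> \<le> ennreal C * ennreal K" by (intro mult_left_mono K) auto
    also have "\<dots> < \<infinity>" by (simp add: ennreal_mult_less_top)
    finally show ?thesis .
  qed
  let ?f = "\<lambda>x. norm x powr (- ?N) * (g x \<bullet> x)"
  have Pf: "P c = (\<integral>\<^sup>+x. ennreal (c * ?f x) \<partial>lborel)" for c
    unfolding P_def F_def by (intro nn_integral_cong) (simp add: ennreal_mult''[symmetric] mult_ac)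
  have int: "integrable lborel ?f"
    unfolding real_integrable_def using fin[of 1] fin[of "-1"] by (auto simp: Pf less_top)
  have "integral\<^sup>L lborel ?f = enn2real (P 1) - enn2real (P (-1))"
    using real_lebesgue_integral_def[OF int] by (simp add: Pf)
  also have "\<dots> = - ?N * ?w * \<phi> 0"
  proof -
    obtain p m where pm: "p \<ge> 0" "m \<ge> 0" "P 1 = ennreal p" "P (-1) = ennreal m"
      using fin[of 1] fin[of "-1"] by (metis abs_1 abs_minus_cancel ennreal_cases infinity_ennreal_def less_irrefl order_refl)
    have "p + max 0 (?N * ?w * \<phi> 0) = m + max 0 (- (?N * ?w * \<phi> 0))"
      using PP pm by (cases "?N * ?w * \<phi> 0 \<ge> 0") (auto simp: ennreal_neg max_def simp flip: ennreal_plus)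
    then show ?thesis using pm by (auto simp: max_def split: if_splits)
  qed
  finally show ?thesis using int by (simp add: has_bochner_integral_iff)
qed

end

section \<open>Potential estimates\<close>

text \<open>Convexity: the power function lies above its tangent at m, with the terms rearranged so
  that nothing is subtracted. For \<theta> > 1 this is Young's inequality; \<theta> = 1 has no
  finite conjugate exponent and is separate.\<close>

lemma Young_powr:
  fixes a m \<theta> :: real
  assumes "\<theta> \<ge> 1" "a \<ge> 0" "m \<ge> 0"
  shows "\<theta> * m powr (\<theta> - 1) * a \<le> a powr \<theta> + (\<theta> - 1) * m powr \<theta>"
proof (cases "\<theta> = 1")
  case False
  then have \<theta>: "\<theta> > 1" using assms by simp
  define q where "q = \<theta> / (\<theta> - 1)"
  have q: "q > 1" "1 / \<theta> + 1 / q = 1" using \<theta> by (auto simp: q_def field_simps)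
  have "a * m powr (\<theta> - 1) \<le> a powr \<theta> / \<theta> + (m powr (\<theta> - 1)) powr q / q"
    by (intro Youngs_inequality \<theta> q assms) auto
  also have "(m powr (\<theta> - 1)) powr q = m powr \<theta>"
    using \<theta> by (simp add: powr_powr q_def)
  finally have "\<theta> * (a * m powr (\<theta> - 1)) \<le> \<theta> * (a powr \<theta> / \<theta> + m powr \<theta> / q)"
    using \<theta> by (intro mult_left_mono) auto
  also have "\<dots> = a powr \<theta> + (\<theta> - 1) * m powr \<theta>"
    using \<theta> by (simp add: q_def field_simps)
  finally show ?thesis by (simp add: mult_ac)
qed (use assms in auto)

text \<open>The tangent bound at m is integrated against G^2, whose total mass is at most 1, and m =
  X is the right point of contact. An infinite X offers no such point; there m = 1 already forces Y
  to be infinite.\<close>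

lemma Jensen_powr:
  fixes f G :: "'b \<Rightarrow> real"
  assumes [measurable]: "f \<in> borel_measurable M" "G \<in> borel_measurable M"
    and f: "\<And>y. f y \<ge> 0" and \<theta>: "\<theta> \<ge> 1"
    and G: "(\<integral>\<^sup>+y. ennreal ((G y)\<^sup>2) \<partial>M) \<le> 1"
  defines "X \<equiv> (\<integral>\<^sup>+y. ennreal (f y * (G y)\<^sup>2) \<partial>M)"
  defines "Y \<equiv> (\<integral>\<^sup>+y. ennreal (f y powr \<theta> * (G y)\<^sup>2) \<partial>M)"
  shows "X = \<infinity> \<Longrightarrow> Y = \<infinity>" "X \<noteq> \<infinity> \<Longrightarrow> ennreal (enn2real X powr \<theta>) \<le> Y"
proof -
  have *: "ennreal (\<theta> * m powr (\<theta> - 1)) * X \<le> Y + ennreal ((\<theta> - 1) * m powr \<theta>)" if m: "m \<ge> 0" for m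
  proof -
    have "ennreal (\<theta> * m powr (\<theta> - 1)) * X = (\<integral>\<^sup>+y. ennreal (\<theta> * m powr (\<theta> - 1)) * ennreal (f y * (G y)\<^sup>2) \<partial>M)"
      unfolding X_def by (intro nn_integral_cmult[symmetric]) measurable
    also have "\<dots> \<le> (\<integral>\<^sup>+y. ennreal (f y powr \<theta> * (G y)\<^sup>2) + ennreal ((\<theta> - 1) * m powr \<theta>) * ennreal ((G y)\<^sup>2) \<partial>M)"
    proof (intro nn_integral_mono)
      fix y
      have "\<theta> * m powr (\<theta> - 1) * f y * (G y)\<^sup>2 \<le> (f y powr \<theta> + (\<theta> - 1) * m powr \<theta>) * (G y)\<^sup>2"
        using Young_powr[OF \<theta> f m, of y] by (intro mult_right_mono) auto
      then show "ennreal (\<theta> * m powr (\<theta> - 1)) * ennreal (f y * (G y)\<^sup>2)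
          \<le> ennreal (f y powr \<theta> * (G y)\<^sup>2) + ennreal ((\<theta> - 1) * m powr \<theta>) * ennreal ((G y)\<^sup>2)"
        using \<theta> f[of y]
        by (subst (1 2) ennreal_mult[symmetric]; simp add: ennreal_plus[symmetric] distrib_right mult.assoc del: ennreal_plus)
    qed
    also have "\<dots> = Y + ennreal ((\<theta> - 1) * m powr \<theta>) * (\<integral>\<^sup>+y. ennreal ((G y)\<^sup>2) \<partial>M)"
      unfolding Y_def by (subst nn_integral_add) (auto simp: nn_integral_cmult)
    also have "\<dots> \<le> Y + ennreal ((\<theta> - 1) * m powr \<theta>) * 1"
      by (intro add_left_mono mult_left_mono G) auto
    finally show ?thesis by simp
  qed
  show "Y = \<infinity>" if "X = \<infinity>"
    using *[of 1] that \<theta> by (auto simp: ennreal_mult_top top_unique)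
  show "ennreal (enn2real X powr \<theta>) \<le> Y" if "X \<noteq> \<infinity>"
  proof (cases "Y = \<infinity>")
    case False
    define x where "x = enn2real X"
    have x: "X = ennreal x" "x \<ge> 0" using that by (auto simp: x_def less_top)
    define y where "y = enn2real Y"
    have y: "Y = ennreal y" "y \<ge> 0" using False by (auto simp: y_def less_top)
    have "x powr (\<theta> - 1) * x = x powr \<theta>"
      using x powr_add[of x "\<theta> - 1" 1] by simp
    moreover have "\<theta> * x powr (\<theta> - 1) * x \<le> y + (\<theta> - 1) * x powr \<theta>"
      using *[of x] x y \<theta> by (simp add: ennreal_mult[symmetric] ennreal_plus[symmetric] del: ennreal_plus)
    ultimately have "x powr \<theta> \<le> y" by (simp add: algebra_simps)
    then show ?thesis using x y by (simp add: ennreal_leI)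
  qed simp
qed

text \<open>Cauchy--Schwarz with the splitting \<open>k = k\<^bsup>\<alpha>/2\<^esup> k\<^bsup>1-\<alpha>/2\<^esup>\<close>, then Jensen for the measure \<open>G\<^sup>2 dM\<close>.\<close>

lemma kernel_power_bound:
  fixes k G :: "'b \<Rightarrow> real"
  assumes [measurable]: "k \<in> borel_measurable M" "G \<in> borel_measurable M" "S \<in> sets M"
    and k: "\<And>y. k y \<ge> 0" and G0: "\<And>y. G y \<ge> 0" and S: "\<And>y. y \<notin> S \<Longrightarrow> G y = 0"
    and \<theta>: "\<theta> \<ge> 1" and A: "A > 0" and t: "t \<ge> 0"
    and G: "(\<integral>\<^sup>+y. ennreal ((G y)\<^sup>2) \<partial>M) \<le> 1"
    and kA: "(\<integral>\<^sup>+y. ennreal (k y powr (2 - \<alpha>)) * indicator S y \<partial>M) \<le> ennreal A"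
    and tk: "ennreal t \<le> (\<integral>\<^sup>+y. ennreal (k y * G y) \<partial>M)"
  shows "ennreal (t powr (2 * \<theta>)) \<le> ennreal (A powr \<theta>) * (\<integral>\<^sup>+y. ennreal (k y powr (\<alpha> * \<theta>) * (G y)\<^sup>2) \<partial>M)"
proof -
  define X where "X = (\<integral>\<^sup>+y. ennreal (k y powr \<alpha> * (G y)\<^sup>2) \<partial>M)"
  define Y where "Y = (\<integral>\<^sup>+y. ennreal ((k y powr \<alpha>) powr \<theta> * (G y)\<^sup>2) \<partial>M)"
  have J: "X = \<infinity> \<Longrightarrow> Y = \<infinity>" "X \<noteq> \<infinity> \<Longrightarrow> ennreal (enn2real X powr \<theta>) \<le> Y"
    unfolding X_def Y_def
    using Jensen_powr[of "\<lambda>y. k y powr \<alpha>" M G \<theta>] \<theta> G by simp_all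
  have "(ennreal t)\<^sup>2 \<le> (\<integral>\<^sup>+y. ennreal (k y * G y) \<partial>M)\<^sup>2"
    using tk by (intro power_mono) auto
  \<comment> \<open>G vanishes off S, so the indicator can be attached to the factor without G. In
    the application that factor is only locally square integrable.\<close>
  also have "(\<integral>\<^sup>+y. ennreal (k y * G y) \<partial>M) =
      (\<integral>\<^sup>+y. ennreal (k y powr (\<alpha> / 2) * G y) * (ennreal (k y powr (1 - \<alpha> / 2)) * indicator S y) \<partial>M)"
  proof (intro nn_integral_cong)
    fix y
    have "k y = k y powr (\<alpha> / 2) * k y powr (1 - \<alpha> / 2)"
      using k[of y] by (simp add: powr_add[symmetric])
    then have "k y * G y = (k y powr (\<alpha> / 2) * G y) * k y powr (1 - \<alpha> / 2)"
      by (metis mult.commute mult.left_commute)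
    then show "ennreal (k y * G y) = ennreal (k y powr (\<alpha> / 2) * G y) * (ennreal (k y powr (1 - \<alpha> / 2)) * indicator S y)"
      using S[of y] k[of y] G0[of y] by (auto simp: ennreal_mult[symmetric] indicator_def)
  qed
  also have "\<dots>\<^sup>2 \<le> (\<integral>\<^sup>+y. (ennreal (k y powr (\<alpha> / 2) * G y))\<^sup>2 \<partial>M) *
      (\<integral>\<^sup>+y. (ennreal (k y powr (1 - \<alpha> / 2)) * indicator S y)\<^sup>2 \<partial>M)"
    by (rule Cauchy_Schwarz_nn_integral) measurable
  also have "(\<integral>\<^sup>+y. (ennreal (k y powr (\<alpha> / 2) * G y))\<^sup>2 \<partial>M) = X"
    unfolding X_def
  proof (intro nn_integral_cong)
    fix y
    have "k y powr \<alpha> = (k y powr (\<alpha> / 2))\<^sup>2" by (simp add: power2_eq_square powr_add[symmetric])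
    then show "(ennreal (k y powr (\<alpha> / 2) * G y))\<^sup>2 = ennreal (k y powr \<alpha> * (G y)\<^sup>2)"
      using G0[of y] by (simp add: ennreal_power power_mult_distrib)
  qed
  also have "(\<integral>\<^sup>+y. (ennreal (k y powr (1 - \<alpha> / 2)) * indicator S y)\<^sup>2 \<partial>M) =
      (\<integral>\<^sup>+y. ennreal (k y powr (2 - \<alpha>)) * indicator S y \<partial>M)"
    by (intro nn_integral_cong)
       (auto simp: power2_eq_square ennreal_mult[symmetric] powr_add[symmetric] indicator_def)
  finally have "(ennreal t)\<^sup>2 \<le> X * (\<integral>\<^sup>+y. ennreal (k y powr (2 - \<alpha>)) * indicator S y \<partial>M)" .
  also have "\<dots> \<le> X * ennreal A" by (intro mult_left_mono kA) auto
  finally have XA: "ennreal (t\<^sup>2) \<le> X * ennreal A" using t by (simp add: ennreal_power)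
  have "ennreal (t powr (2 * \<theta>)) \<le> ennreal (A powr \<theta>) * Y"
  proof (cases "X = \<infinity>")
    case True
    then show ?thesis using J(1) A by (simp add: ennreal_mult_top)
  next
    case False
    define x where "x = enn2real X"
    have x: "X = ennreal x" "x \<ge> 0" using False by (auto simp: x_def less_top)
    have "t\<^sup>2 \<le> x * A" using XA x A by (simp add: ennreal_mult[symmetric])
    then have "(t\<^sup>2) powr \<theta> \<le> (x * A) powr \<theta>" using \<theta> by (intro powr_mono2) auto
    moreover have "(t\<^sup>2) powr \<theta> = t powr (2 * \<theta>)"
      using t by (simp add: powr_powr flip: powr_numeral)
    ultimately have "t powr (2 * \<theta>) \<le> A powr \<theta> * x powr \<theta>"
      using x A by (simp add: powr_mult mult.commute)
    then have "ennreal (t powr (2 * \<theta>)) \<le> ennreal (A powr \<theta>) * ennreal (x powr \<theta>)"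
      by (simp add: ennreal_mult[symmetric] ennreal_leI)
    also have "\<dots> \<le> ennreal (A powr \<theta>) * Y"
      using J(2)[OF False] by (intro mult_left_mono) (auto simp: x_def)
    finally show ?thesis .
  qed
  then show ?thesis by (simp add: Y_def powr_powr)
qed

text \<open>Replacing the larger of a and b by the smaller one only increases the product. A kernel
  with two singular points is thus dominated by two kernels with one singular point each.\<close>

lemma powr_neg_mult_le:
  fixes a b s t :: real
  assumes "a \<ge> 0" "b \<ge> 0" "s \<ge> 0" "t \<ge> 0"
  shows "a powr (- s) * b powr (- t) \<le> a powr (- (s + t)) + b powr (- (s + t))"
proof (cases "a = 0 \<or> b = 0")
  case False
  then have ab: "a > 0" "b > 0" using assms by auto
  show ?thesis
  proof (cases "a \<le> b")
    case True
    have "a powr (- s) * b powr (- t) \<le> a powr (- s) * a powr (- t)"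
      using True ab assms by (intro mult_left_mono powr_mono2') auto
    also have "\<dots> = a powr (- (s + t))" by (simp add: powr_add[symmetric])
    finally show ?thesis by (smt (verit) powr_ge_zero)
  next
    case False
    have "a powr (- s) * b powr (- t) \<le> b powr (- s) * b powr (- t)"
      using False ab assms by (intro mult_right_mono powr_mono2') auto
    also have "\<dots> = b powr (- (s + t))" by (simp add: powr_add[symmetric])
    finally show ?thesis by (smt (verit) powr_ge_zero)
  qed
qed auto

lemma powr_sum_le:
  fixes a b c s :: real
  assumes "c \<le> a + b" "a \<ge> 0" "b \<ge> 0" "c \<ge> 0" "s \<ge> 0"
  shows "c powr s \<le> 2 powr s * (a powr s + b powr s)"
proof -
  have "c powr s \<le> (2 * max a b) powr s" using assms by (intro powr_mono2) auto
  also have "\<dots> = 2 powr s * max a b powr s" using assms by (simp add: powr_mult)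
  also have "\<dots> \<le> 2 powr s * (a powr s + b powr s)"
    by (intro mult_left_mono) (auto simp: max_def)
  finally show ?thesis .
qed

text \<open>The left side is multiplied by 1 = |y|^a |y|^(-a), and |y|^a is split by the triangle
  inequality. The |x|^a part cancels |x|^(-a); the |y - x|^a part changes the exponent 1 - N into a
  + 1 - N = -N/2. In use, \<open>\<gamma>\<close> is |\<nabla>\<phi>(y)|.\<close>

lemma ground_kernel_bound:
  fixes x y :: "'a::euclidean_space"
  assumes "x \<noteq> 0" "y \<noteq> 0" and N: "real DIM('a) \<ge> 2" and \<gamma>: "\<gamma> \<ge> 0"
  defines "a \<equiv> (real DIM('a) - 2) / 2"
  shows "norm x powr (- a) * (\<gamma> * norm (y - x) powr (1 - real DIM('a))) \<le>
    2 powr a * (norm (y - x) powr (1 - real DIM('a)) * (norm y powr (- a) * \<gamma>)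
      + norm x powr (- a) * (norm (y - x) powr (- (real DIM('a) / 2)) * (norm y powr (- a) * \<gamma>)))"
proof -
  let ?N = "real DIM('a)"
  have a: "a \<ge> 0" using N by (simp add: a_def)
  define T xi yi zn zh where "T = 2 powr a" and "xi = norm x powr (- a)" and "yi = norm y powr (- a)"
    and "zn = norm (y - x) powr (1 - ?N)" and "zh = norm (y - x) powr (- (?N / 2))"
  have nn: "xi \<ge> 0" "yi \<ge> 0" "zn \<ge> 0" by (auto simp: xi_def yi_def zn_def)
  have le: "norm y powr a \<le> T * (norm x powr a + norm (y - x) powr a)"
    unfolding T_def using a norm_triangle_ineq[of x "y - x"] by (intro powr_sum_le) auto
  have eq: "norm y powr a * yi = 1" "norm x powr a * xi = 1"
    using assms by (auto simp: powr_add[symmetric] xi_def yi_def)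
  have z: "norm (y - x) powr a * zn = zh"
    by (simp add: powr_add[symmetric] a_def field_simps zn_def zh_def)
  have "xi * (\<gamma> * zn) = (norm y powr a * yi) * (xi * (\<gamma> * zn))" using eq by simp
  also have "\<dots> = norm y powr a * (yi * (xi * (\<gamma> * zn)))" by (simp add: mult_ac)
  also have "\<dots> \<le> T * (norm x powr a + norm (y - x) powr a) * (yi * (xi * (\<gamma> * zn)))"
    using nn \<gamma> by (intro mult_right_mono le) auto
  also have "\<dots> = T * ((norm x powr a * xi) * (zn * (yi * \<gamma>)) + xi * ((norm (y - x) powr a * zn) * (yi * \<gamma>)))"
    by (simp add: algebra_simps)
  finally show ?thesis
    unfolding eq z by (simp add: T_def xi_def yi_def zn_def zh_def)
qed

text \<open>By \<open>powr_neg_mult_le\<close> the product is at most a sum of two single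
  singularities of order a + b < N. The ball of radius R lies in the ball of radius 2 R about any of
  its points, so the bound is uniform in y.\<close>

lemma nn_integral_riesz_product:
  fixes a b R :: real
  assumes "a \<ge> 0" "b \<ge> 0" "a + b < real DIM('a::euclidean_space)" "R > 0"
  shows "\<exists>K\<ge>0. \<forall>y\<in>ball 0 R. (\<integral>\<^sup>+x. ennreal (norm (x::'a) powr (- a) * norm (y - x) powr (- b)) * indicator (ball 0 R) x \<partial>lborel) \<le> ennreal K"
proof -
  obtain K where K: "K \<ge> 0" "\<And>z::'a. (\<integral>\<^sup>+x. ennreal (norm (x - z) powr (- (a + b))) * indicator (ball z (2 * R)) x \<partial>lborel) \<le> ennreal K"
    using nn_integral_ball_powr[OF assms(3), of "2 * R"] assms(4) by auto
  show ?thesis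
  proof (intro exI[of _ "2 * K"] conjI ballI)
    fix y :: 'a assume y: "y \<in> ball 0 R"
    have sub: "ball 0 R \<subseteq> ball y (2 * R)"
    proof
      fix x :: 'a assume "x \<in> ball 0 R"
      then show "x \<in> ball y (2 * R)" using y norm_triangle_ineq4[of y x] by (auto simp: dist_norm)
    qed
    have "(\<integral>\<^sup>+x. ennreal (norm (x::'a) powr (- a) * norm (y - x) powr (- b)) * indicator (ball 0 R) x \<partial>lborel)
      \<le> (\<integral>\<^sup>+x. ennreal (norm (x - 0) powr (- (a + b))) * indicator (ball 0 (2 * R)) x +
          ennreal (norm (x - y) powr (- (a + b))) * indicator (ball y (2 * R)) x \<partial>lborel)"
    proof (intro nn_integral_mono)
      fix x :: 'a
      show "ennreal (norm x powr (- a) * norm (y - x) powr (- b)) * indicator (ball 0 R) x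
        \<le> ennreal (norm (x - 0) powr (- (a + b))) * indicator (ball 0 (2 * R)) x +
          ennreal (norm (x - y) powr (- (a + b))) * indicator (ball y (2 * R)) x"
      proof (cases "x \<in> ball 0 R")
        case True
        then have "x \<in> ball 0 (2 * R)" "x \<in> ball y (2 * R)" using sub assms(4) by auto
        then show ?thesis
          using True powr_neg_mult_le[of "norm x" "norm (y - x)" a b] assms
          by (simp add: norm_minus_commute ennreal_plus[symmetric] ennreal_leI del: ennreal_plus)
      qed simp
    qed
    also have "\<dots> = (\<integral>\<^sup>+x. ennreal (norm (x - (0::'a)) powr (- (a + b))) * indicator (ball 0 (2 * R)) x \<partial>lborel) +
         (\<integral>\<^sup>+x. ennreal (norm (x - y) powr (- (a + b))) * indicator (ball y (2 * R)) x \<partial>lborel)"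
      by (intro nn_integral_add) measurable
    also have "\<dots> \<le> ennreal K + ennreal K" by (intro add_mono K)
    finally show "(\<integral>\<^sup>+x. ennreal (norm (x::'a) powr (- a) * norm (y - x) powr (- b)) * indicator (ball 0 R) x \<partial>lborel) \<le> ennreal (2 * K)"
      using K(1) by (simp add: ennreal_plus[symmetric] del: ennreal_plus)
  qed (use K in simp)
qed

text \<open>Tonelli's theorem: the kernel only has to be integrable in x, uniformly in y.
  \<open>H\<close> stands for G^2, the density that Jensen's inequality leaves behind.\<close>

lemma nn_integral_weighted_potential:
  fixes H :: "'a::euclidean_space \<Rightarrow> real" and k :: "'a \<Rightarrow> 'a \<Rightarrow> real"
  assumes [measurable]: "H \<in> borel_measurable borel" "(\<lambda>(x, y). k x y) \<in> borel_measurable (borel \<Otimes>\<^sub>M borel)"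
    and H: "\<And>y. H y \<ge> 0" "\<And>y. y \<notin> ball 0 R \<Longrightarrow> H y = 0" "(\<integral>\<^sup>+y. ennreal (H y) \<partial>lborel) \<le> 1"
    and k0: "\<And>x y. k x y \<ge> 0"
    and k: "\<And>y. y \<in> ball 0 R \<Longrightarrow> (\<integral>\<^sup>+x. ennreal (k x y) * indicator (ball 0 R) x \<partial>lborel) \<le> ennreal K"
  shows "(\<integral>\<^sup>+x. (\<integral>\<^sup>+y. ennreal (k x y * H y) \<partial>lborel) * indicator (ball 0 R) x \<partial>lborel) \<le> ennreal K"
proof -
  have "(\<integral>\<^sup>+x. (\<integral>\<^sup>+y. ennreal (k x y * H y) \<partial>lborel) * indicator (ball 0 R) x \<partial>lborel) =
     (\<integral>\<^sup>+x. (\<integral>\<^sup>+y. ennreal (k x y * H y) * indicator (ball 0 R) x \<partial>lborel) \<partial>lborel)"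
    by (intro nn_integral_cong nn_integral_multc[symmetric]) measurable
  also have "\<dots> = (\<integral>\<^sup>+y. (\<integral>\<^sup>+x. ennreal (k x y * H y) * indicator (ball 0 R) x \<partial>lborel) \<partial>lborel)"
    by (rule lborel_pair.Fubini') measurable
  also have "\<dots> \<le> (\<integral>\<^sup>+y. ennreal K * ennreal (H y) \<partial>lborel)"
  proof (intro nn_integral_mono)
    fix y :: 'a
    show "(\<integral>\<^sup>+x. ennreal (k x y * H y) * indicator (ball 0 R) x \<partial>lborel) \<le> ennreal K * ennreal (H y)"
    proof (cases "y \<in> ball 0 R")
      case True
      have "(\<integral>\<^sup>+x. ennreal (k x y * H y) * indicator (ball 0 R) x \<partial>lborel) =
        (\<integral>\<^sup>+x. (ennreal (k x y) * indicator (ball 0 R) x) * ennreal (H y) \<partial>lborel)"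
        using k0 H by (intro nn_integral_cong) (simp add: ennreal_mult mult_ac)
      also have "\<dots> = (\<integral>\<^sup>+x. ennreal (k x y) * indicator (ball 0 R) x \<partial>lborel) * ennreal (H y)"
        by (intro nn_integral_multc) measurable
      also have "\<dots> \<le> ennreal K * ennreal (H y)" by (intro mult_right_mono k True) auto
      finally show ?thesis .
    qed (use H in simp)
  qed
  also have "\<dots> = ennreal K * (\<integral>\<^sup>+y. ennreal (H y) \<partial>lborel)"
    by (intro nn_integral_cmult) measurable
  also have "\<dots> \<le> ennreal K * 1" by (intro mult_left_mono H) auto
  finally show ?thesis by simp
qed

text \<open>\<open>u = |x|\<^bsup>-a\<^esup> \<phi>\<close> is dominated by the Riesz potential of \<open>G = |y|\<^bsup>-a\<^esup> |\<nabla>\<phi>|\<close> with kernel \<open>|x - y|\<^bsup>1-N\<^esup>\<close> and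
  \<open>|x|\<^bsup>-a\<^esup>\<close> times the one with kernel \<open>|x - y|\<^bsup>-N/2\<^esup>\<close>. In the powers of the kernels, \<open>\<alpha>\<^sub>1\<close> and \<open>\<alpha>\<^sub>2\<close> are chosen so
  that all exponents are subcritical, which is possible exactly for \<open>\<theta> < N / (N - 2)\<close>.\<close>

lemma ground_power_bound:
  fixes R \<theta> :: real
  assumes N: "DIM('a::euclidean_space) \<ge> 3" and R: "R > 0" and \<theta>: "\<theta> \<ge> 1" "\<theta> * (real DIM('a) - 2) < real DIM('a)"
  shows "\<exists>C>0. \<forall>\<phi> (g::'a \<Rightarrow> 'a). C1_supported \<phi> g R \<longrightarrow>
     (\<integral>\<^sup>+y. ennreal (norm y powr (- (real DIM('a) - 2)) * (norm (g y))\<^sup>2) \<partial>lborel) \<le> 1 \<longrightarrow>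
     (\<integral>\<^sup>+x. ennreal (\<bar>norm x powr (- ((real DIM('a) - 2) / 2)) * \<phi> x\<bar> powr (2 * \<theta>)) \<partial>lborel) \<le> ennreal C"
proof -
  let ?N = "real DIM('a)"
  define a where "a = (?N - 2) / 2"
  have N3: "?N \<ge> 3" using N by simp
  have a: "a > 0" using N3 by (simp add: a_def)
  \<comment> \<open>For the kernel |x - y|^(1-N), the power 2 - \<open>\<alpha>\<^sub>1\<close> is
    locally integrable iff \<open>\<alpha>\<^sub>1\<close> > (N - 2)/(N - 1), and the power
    \<open>\<alpha>\<^sub>1 * \<theta>\<close> iff \<open>\<alpha>\<^sub>1\<close> < N/(\<theta> (N
    - 1)). The midpoint is taken; the interval is nonempty because \<theta> < N/(N - 2).\<close>
  define \<alpha>\<^sub>1 where "\<alpha>\<^sub>1 = ((?N - 2) / (?N - 1) + ?N / (\<theta> * (?N - 1))) / 2"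
  \<comment> \<open>For the kernel |x - y|^(-N/2), whose square is critical, the first condition is
    just \<open>\<alpha>\<^sub>2 > 0\<close>. Next to |x|^(-2 a \<theta>) there is room for
    exponents below N - 2 a \<theta>, and this choice uses half of it.\<close>
  define \<alpha>\<^sub>2 where "\<alpha>\<^sub>2 = (?N - a * (2 * \<theta>)) / (?N * \<theta>)"
  have tN: "?N - 2 < ?N / \<theta>" using \<theta> by (simp add: field_simps)
  have less: "(?N - 2) / (?N - 1) < ?N / (\<theta> * (?N - 1))"
    using divide_strict_right_mono[OF tN, of "?N - 1"] N3 by simp
  have \<alpha>1: "(?N - 2) / (?N - 1) < \<alpha>\<^sub>1" "\<alpha>\<^sub>1 < ?N / (\<theta> * (?N - 1))" "\<alpha>\<^sub>1 > 0"
  proof -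
    have "P < (P + Q) / 2" "(P + Q) / 2 < Q" "(P + Q) / 2 > 0" if "P < Q" "P > 0" for P Q :: real
      using that by auto
    from this[OF less] show "(?N - 2) / (?N - 1) < \<alpha>\<^sub>1" "\<alpha>\<^sub>1 < ?N / (\<theta> * (?N - 1))" "\<alpha>\<^sub>1 > 0"
      using N3 by (simp_all add: \<alpha>\<^sub>1_def)
  qed
  have e11: "(?N - 1) * (2 - \<alpha>\<^sub>1) < ?N"
  proof -
    have "?N - 2 < \<alpha>\<^sub>1 * (?N - 1)"
      using \<alpha>1(1) N3 by (subst (asm) pos_divide_less_eq) auto
    then show ?thesis by (simp add: algebra_simps)
  qed
  have "\<alpha>\<^sub>1 * (\<theta> * (?N - 1)) < ?N"
    using \<alpha>1(2) \<theta> N3 by (subst (asm) pos_less_divide_eq) auto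
  then have e12: "0 + (?N - 1) * (\<alpha>\<^sub>1 * \<theta>) < ?N" by (simp add: mult_ac)
  have ap: "a * (2 * \<theta>) < ?N" using \<theta> by (simp add: a_def mult.commute)
  have \<alpha>2: "\<alpha>\<^sub>2 > 0" using ap N3 \<theta> by (simp add: \<alpha>\<^sub>2_def)
  have e21: "?N / 2 * (2 - \<alpha>\<^sub>2) < ?N" using \<alpha>2 N3 by (simp add: algebra_simps)
  have "?N / 2 * (\<alpha>\<^sub>2 * \<theta>) = (?N - a * (2 * \<theta>)) / 2" using \<theta> N3 by (simp add: \<alpha>\<^sub>2_def)
  then have e22: "a * (2 * \<theta>) + ?N / 2 * (\<alpha>\<^sub>2 * \<theta>) < ?N" using ap by (simp add: field_simps)
  obtain A\<^sub>1 where A1: "\<And>z::'a. (\<integral>\<^sup>+x. ennreal (norm (x - z) powr (- ((?N - 1) * (2 - \<alpha>\<^sub>1)))) * indicator (ball z (2 * R)) x \<partial>lborel) \<le> ennreal A\<^sub>1"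
      "A\<^sub>1 \<ge> 0"
    using nn_integral_ball_powr[OF e11, of "2 * R"] R by auto
  obtain A\<^sub>2 where A2: "\<And>z::'a. (\<integral>\<^sup>+x. ennreal (norm (x - z) powr (- (?N / 2 * (2 - \<alpha>\<^sub>2)))) * indicator (ball z (2 * R)) x \<partial>lborel) \<le> ennreal A\<^sub>2"
      "A\<^sub>2 \<ge> 0"
    using nn_integral_ball_powr[OF e21, of "2 * R"] R by auto
  obtain K\<^sub>1 where K1: "K\<^sub>1 \<ge> 0" "\<And>y::'a. y \<in> ball 0 R \<Longrightarrow> (\<integral>\<^sup>+x. ennreal (norm (x::'a) powr (- 0) * norm (y - x) powr (- ((?N - 1) * (\<alpha>\<^sub>1 * \<theta>)))) * indicator (ball 0 R) x \<partial>lborel) \<le> ennreal K\<^sub>1"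
    using nn_integral_riesz_product[OF _ _ e12 R] \<alpha>1(3) \<theta> N3 by auto
  obtain K\<^sub>2 where K2: "K\<^sub>2 \<ge> 0" "\<And>y::'a. y \<in> ball 0 R \<Longrightarrow> (\<integral>\<^sup>+x. ennreal (norm (x::'a) powr (- (a * (2 * \<theta>))) * norm (y - x) powr (- (?N / 2 * (\<alpha>\<^sub>2 * \<theta>)))) * indicator (ball 0 R) x \<partial>lborel) \<le> ennreal K\<^sub>2"
    using nn_integral_riesz_product[OF _ _ e22 R] \<alpha>2 \<theta> N3 a by auto
  define c0 where "c0 = ?N * measure lborel (ball (0::'a) 1)"
  have c0: "c0 > 0"
    using N3 content_ball_pos[of 1 "0::'a"] by (simp add: c0_def)
  \<comment> \<open>The 2 pays for keeping only one of the two potentials, 2^a for the splitting of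
    |y|^a.\<close>
  define c where "c = c0 / (2 * 2 powr a)"
  have c: "c > 0" using c0 by (simp add: c_def)
  \<comment> \<open>The constants are increased by 1 because \<open>kernel_power_bound\<close> asks
    for a positive one.\<close>
  define B where "B = (A\<^sub>1 + 1) powr \<theta> * K\<^sub>1 + (A\<^sub>2 + 1) powr \<theta> * K\<^sub>2"
  have B: "B \<ge> 0" using A1 A2 K1 K2 by (simp add: B_def)
  show ?thesis
  proof (intro exI[of _ "(1 / c) powr (2 * \<theta>) * B + 1"] conjI allI impI)
    show "(1 / c) powr (2 * \<theta>) * B + 1 > 0" using B by (simp add: add_nonneg_pos)
    fix \<phi> :: "'a \<Rightarrow> real" and g :: "'a \<Rightarrow> 'a"
    assume "C1_supported \<phi> g R"
      and W: "(\<integral>\<^sup>+y. ennreal (norm y powr (- (?N - 2)) * (norm (g y))\<^sup>2) \<partial>lborel) \<le> 1"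
    then interpret C1_supported \<phi> g R by simp
    define G where "G y = norm y powr (- a) * norm (g y)" for y
    have [measurable]: "G \<in> borel_measurable borel" unfolding G_def by measurable
    have G2: "(G y)\<^sup>2 = norm y powr (- (?N - 2)) * (norm (g y))\<^sup>2" for y
      by (simp add: G_def power_mult_distrib power2_eq_square powr_add[symmetric] a_def)
    have G: "(\<integral>\<^sup>+y. ennreal ((G y)\<^sup>2) \<partial>lborel) \<le> 1" using W by (simp add: G2)
    have G0: "G y \<ge> 0" for y by (simp add: G_def)
    have Gout: "y \<notin> ball 0 R \<Longrightarrow> G y = 0" for y using outside(2)[of y] by (simp add: G_def)
    define u where "u x = \<bar>norm x powr (- a) * \<phi> x\<bar>" for x
    have [measurable]: "u \<in> borel_measurable borel" unfolding u_def by measurable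
    have u0: "u x \<ge> 0" for x by (simp add: u_def)
    define I1 where "I1 x = (\<integral>\<^sup>+y. ennreal (norm (y - x) powr (1 - ?N) * G y) \<partial>lborel)" for x
    define I2 where "I2 x = (\<integral>\<^sup>+y. ennreal (norm (y - x) powr (- (?N / 2)) * G y) \<partial>lborel)" for x
    have cu: "ennreal (c0 * u x) \<le> ennreal (2 powr a) * (I1 x + ennreal (norm x powr (- a)) * I2 x)" if x: "x \<noteq> 0" for x
    proof -
      have "ennreal (c0 * u x) = ennreal (norm x powr (- a)) * ennreal (c0 * \<bar>\<phi> x\<bar>)"
        using c0 by (simp add: u_def ennreal_mult[symmetric] abs_mult mult_ac)
      also have "\<dots> \<le> ennreal (norm x powr (- a)) * (\<integral>\<^sup>+y. ennreal (norm (g y) * norm (y - x) powr (1 - ?N)) \<partial>lborel)"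
        using point_bound[of x] by (intro mult_left_mono) (auto simp: c0_def)
      also have "\<dots> = (\<integral>\<^sup>+y. ennreal (norm x powr (- a)) * ennreal (norm (g y) * norm (y - x) powr (1 - ?N)) \<partial>lborel)"
        by (intro nn_integral_cmult[symmetric]) measurable
      also have "\<dots> \<le> (\<integral>\<^sup>+y. ennreal (2 powr a) * (ennreal (norm (y - x) powr (1 - ?N) * G y) +
          ennreal (norm x powr (- a)) * ennreal (norm (y - x) powr (- (?N / 2)) * G y)) \<partial>lborel)"
      proof (intro nn_integral_mono_AE, use AE_lborel_singleton[of "0::'a"] in eventually_elim)
        fix y :: 'a assume y: "y \<noteq> 0"
        have "norm x powr (- a) * (norm (g y) * norm (y - x) powr (1 - ?N)) \<le>
          2 powr a * (norm (y - x) powr (1 - ?N) * G y + norm x powr (- a) * (norm (y - x) powr (- (?N / 2)) * G y))"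
          using ground_kernel_bound[of x y "norm (g y)"] x y N3 by (simp add: a_def G_def)
        then show "ennreal (norm x powr (- a)) * ennreal (norm (g y) * norm (y - x) powr (1 - ?N)) \<le>
           ennreal (2 powr a) * (ennreal (norm (y - x) powr (1 - ?N) * G y) +
          ennreal (norm x powr (- a)) * ennreal (norm (y - x) powr (- (?N / 2)) * G y))"
          using G0[of y] by (simp add: ennreal_mult[symmetric] ennreal_plus[symmetric] ennreal_leI del: ennreal_plus)
      qed
      also have "\<dots> = ennreal (2 powr a) * (I1 x + ennreal (norm x powr (- a)) * I2 x)"
        unfolding I1_def I2_def
        by (subst nn_integral_cmult, measurable, subst nn_integral_add, measurable, subst nn_integral_cmult, measurable)
      finally show ?thesis .
    qed
    \<comment> \<open>The factor \<open>norm x powr (- 0)\<close> is 1 off the origin; it brings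
      \<open>J1\<close> into the form of \<open>nn_integral_riesz_product\<close> with first
      exponent 0.\<close>
    define J1 where "J1 x = (\<integral>\<^sup>+y. ennreal (norm x powr (- 0) * norm (y - x) powr (- ((?N - 1) * (\<alpha>\<^sub>1 * \<theta>))) * (G y)\<^sup>2) \<partial>lborel)" for x
    define J2 where "J2 x = (\<integral>\<^sup>+y. ennreal (norm x powr (- (a * (2 * \<theta>))) * norm (y - x) powr (- (?N / 2 * (\<alpha>\<^sub>2 * \<theta>))) * (G y)\<^sup>2) \<partial>lborel)" for x
    have ball_sub: "ball 0 R \<subseteq> ball x (2 * R)" if "x \<in> ball 0 R" for x :: 'a
    proof
      fix z :: 'a assume "z \<in> ball 0 R"
      then show "z \<in> ball x (2 * R)" using that norm_triangle_ineq4[of x z] by (auto simp: dist_norm)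
    qed
    have pw: "ennreal ((c * u x) powr (2 * \<theta>)) \<le> ennreal ((A\<^sub>1 + 1) powr \<theta>) * J1 x + ennreal ((A\<^sub>2 + 1) powr \<theta>) * J2 x"
      if x: "x \<noteq> 0" "x \<in> ball 0 R" for x
    proof -
      define t where "t = c * u x"
      have t: "t \<ge> 0" using c u0 by (simp add: t_def)
      have kA: "(\<integral>\<^sup>+y. ennreal ((norm (y - x) powr e) powr (2 - \<alpha>)) * indicator (ball 0 R) y \<partial>lborel) \<le> ennreal (A + 1)"
        if "(\<integral>\<^sup>+y. ennreal (norm (y - x) powr (- (f * (2 - \<alpha>)))) * indicator (ball x (2 * R)) y \<partial>lborel) \<le> ennreal A" "e = - f"
        for A e f \<alpha>
      proof -
        have "(\<integral>\<^sup>+y. ennreal ((norm (y - x) powr e) powr (2 - \<alpha>)) * indicator (ball 0 R) y \<partial>lborel) \<le>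
          (\<integral>\<^sup>+y. ennreal (norm (y - x) powr (- (f * (2 - \<alpha>)))) * indicator (ball x (2 * R)) y \<partial>lborel)"
          using ball_sub[OF x(2)] that(2) by (intro nn_integral_mono) (auto simp: indicator_def powr_powr)
        also have "\<dots> \<le> ennreal (A + 1)" using that(1) by (rule order_trans) (simp add: ennreal_leI)
        finally show ?thesis .
      qed
      have "ennreal (2 powr a) * ennreal (2 * t) = ennreal (c0 * u x)"
      proof -
        have "2 powr a * (2 * t) = c0 * u x" by (simp add: t_def c_def)
        then show ?thesis using t by (subst ennreal_mult[symmetric]) auto
      qed
      also have "\<dots> \<le> ennreal (2 powr a) * (I1 x + ennreal (norm x powr (- a)) * I2 x)" by (rule cu[OF x(1)])
      finally have t2: "ennreal (2 * t) \<le> I1 x + ennreal (norm x powr (- a)) * I2 x"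
        by (simp add: ennreal_mult_le_mult_iff)
      \<comment> \<open>One of the two summands carries at least half of the sum. Which one may
        depend on x, so the final bound adds \<open>J1\<close> and \<open>J2\<close>.\<close>
      have "ennreal t \<le> I1 x \<or> ennreal t \<le> ennreal (norm x powr (- a)) * I2 x"
      proof (rule ccontr)
        assume "\<not> ?thesis"
        then have "I1 x + ennreal (norm x powr (- a)) * I2 x < ennreal t + ennreal t"
          by (intro add_strict_mono) auto
        with t2 t show False by (simp add: ennreal_plus[symmetric] del: ennreal_plus)
      qed
      then show ?thesis
      proof
        assume "ennreal t \<le> I1 x"
        then have "ennreal (t powr (2 * \<theta>)) \<le> ennreal ((A\<^sub>1 + 1) powr \<theta>) *
            (\<integral>\<^sup>+y. ennreal ((norm (y - x) powr (1 - ?N)) powr (\<alpha>\<^sub>1 * \<theta>) * (G y)\<^sup>2) \<partial>lborel)"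
          unfolding I1_def using A1(2) kA[OF A1(1)[of x], of "1 - ?N"] G
          by (intro kernel_power_bound[where S="ball 0 R"]) (auto simp: t G0 Gout \<theta>)
        also have "(\<integral>\<^sup>+y. ennreal ((norm (y - x) powr (1 - ?N)) powr (\<alpha>\<^sub>1 * \<theta>) * (G y)\<^sup>2) \<partial>lborel) = J1 x"
          unfolding J1_def using x by (intro nn_integral_cong) (simp add: powr_powr algebra_simps)
        finally show ?thesis unfolding t_def by (rule order_trans) simp
      next
        assume le: "ennreal t \<le> ennreal (norm x powr (- a)) * I2 x"
        have nx: "norm x powr a * norm x powr (- a) = 1" using x by (simp add: powr_add[symmetric])
        \<comment> \<open>|x|^(-a) does not depend on y, so the kernel bound is applied to t |x|^a.
          The power |x|^(-2 a \<theta>) is restored afterwards and becomes part of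
          \<open>J2\<close>.\<close>
        have "ennreal (t * norm x powr a) = ennreal (norm x powr a) * ennreal t"
          using t by (simp add: ennreal_mult[symmetric] mult_ac)
        also have "\<dots> \<le> ennreal (norm x powr a) * (ennreal (norm x powr (- a)) * I2 x)"
          by (intro mult_left_mono le) auto
        also have "\<dots> = ennreal (norm x powr a * norm x powr (- a)) * I2 x"
          by (subst ennreal_mult) (auto simp: mult.assoc)
        finally have "ennreal (t * norm x powr a) \<le> I2 x" by (simp add: nx)
        then have *: "ennreal ((t * norm x powr a) powr (2 * \<theta>)) \<le> ennreal ((A\<^sub>2 + 1) powr \<theta>) *
            (\<integral>\<^sup>+y. ennreal ((norm (y - x) powr (- (?N / 2))) powr (\<alpha>\<^sub>2 * \<theta>) * (G y)\<^sup>2) \<partial>lborel)" (is "_ \<le> _ * ?I")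
          unfolding I2_def using A2(2) kA[OF A2(1)[of x], of "- (?N / 2)"] G t
          by (intro kernel_power_bound[where S="ball 0 R"]) (auto simp: G0 Gout \<theta>)
        have "t powr (2 * \<theta>) = norm x powr (- (a * (2 * \<theta>))) * (t * norm x powr a) powr (2 * \<theta>)"
          using x t by (simp add: powr_mult powr_powr powr_add[symmetric] powr_minus field_simps)
        then have "ennreal (t powr (2 * \<theta>)) = ennreal (norm x powr (- (a * (2 * \<theta>)))) * ennreal ((t * norm x powr a) powr (2 * \<theta>))"
          by (simp add: ennreal_mult)
        also have "\<dots> \<le> ennreal (norm x powr (- (a * (2 * \<theta>)))) * (ennreal ((A\<^sub>2 + 1) powr \<theta>) * ?I)"
          by (intro mult_left_mono *) auto
        also have "\<dots> = ennreal ((A\<^sub>2 + 1) powr \<theta>) * (ennreal (norm x powr (- (a * (2 * \<theta>)))) * ?I)"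
          by (simp add: mult_ac)
        also have "ennreal (norm x powr (- (a * (2 * \<theta>)))) * ?I =
          (\<integral>\<^sup>+y. ennreal (norm x powr (- (a * (2 * \<theta>)))) * ennreal ((norm (y - x) powr (- (?N / 2))) powr (\<alpha>\<^sub>2 * \<theta>) * (G y)\<^sup>2) \<partial>lborel)"
          by (intro nn_integral_cmult[symmetric]) measurable
        also have "\<dots> = J2 x"
          unfolding J2_def by (intro nn_integral_cong) (simp add: powr_powr ennreal_mult[symmetric] mult.assoc)
        finally show ?thesis unfolding t_def by (rule order_trans) simp
      qed
    qed
    have J1: "(\<integral>\<^sup>+x. J1 x * indicator (ball 0 R) x \<partial>lborel) \<le> ennreal K\<^sub>1"
      unfolding J1_def using G K1 by (intro nn_integral_weighted_potential) (auto simp: Gout)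
    have J2: "(\<integral>\<^sup>+x. J2 x * indicator (ball 0 R) x \<partial>lborel) \<le> ennreal K\<^sub>2"
      unfolding J2_def using G K2 by (intro nn_integral_weighted_potential) (auto simp: Gout)
    have [measurable]: "J1 \<in> borel_measurable borel" "J2 \<in> borel_measurable borel"
      unfolding J1_def J2_def by measurable
    have "(\<integral>\<^sup>+x. ennreal ((c * u x) powr (2 * \<theta>)) \<partial>lborel) \<le>
      (\<integral>\<^sup>+x. ennreal ((A\<^sub>1 + 1) powr \<theta>) * (J1 x * indicator (ball 0 R) x) + ennreal ((A\<^sub>2 + 1) powr \<theta>) * (J2 x * indicator (ball 0 R) x) \<partial>lborel)"
    proof (intro nn_integral_mono_AE, use AE_lborel_singleton[of "0::'a"] in eventually_elim)
      fix x :: 'a assume x: "x \<noteq> 0"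
      show "ennreal ((c * u x) powr (2 * \<theta>)) \<le> ennreal ((A\<^sub>1 + 1) powr \<theta>) * (J1 x * indicator (ball 0 R) x) + ennreal ((A\<^sub>2 + 1) powr \<theta>) * (J2 x * indicator (ball 0 R) x)"
        using pw[OF x] outside(1)[of x] by (cases "x \<in> ball 0 R") (auto simp: u_def)
    qed
    also have "\<dots> = ennreal ((A\<^sub>1 + 1) powr \<theta>) * (\<integral>\<^sup>+x. J1 x * indicator (ball 0 R) x \<partial>lborel) +
        ennreal ((A\<^sub>2 + 1) powr \<theta>) * (\<integral>\<^sup>+x. J2 x * indicator (ball 0 R) x \<partial>lborel)"
      by (subst nn_integral_add) (auto simp: nn_integral_cmult)
    also have "\<dots> \<le> ennreal ((A\<^sub>1 + 1) powr \<theta>) * ennreal K\<^sub>1 + ennreal ((A\<^sub>2 + 1) powr \<theta>) * ennreal K\<^sub>2"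
      by (intro add_mono mult_left_mono J1 J2) auto
    also have "\<dots> = ennreal B"
      using K1 K2 by (simp add: B_def ennreal_mult[symmetric] ennreal_plus[symmetric] del: ennreal_plus)
    finally have fB: "(\<integral>\<^sup>+x. ennreal ((c * u x) powr (2 * \<theta>)) \<partial>lborel) \<le> ennreal B" .
    have "(\<integral>\<^sup>+x. ennreal (u x powr (2 * \<theta>)) \<partial>lborel) =
       (\<integral>\<^sup>+x. ennreal ((1 / c) powr (2 * \<theta>)) * ennreal ((c * u x) powr (2 * \<theta>)) \<partial>lborel)"
      using c u0 by (intro nn_integral_cong) (simp add: ennreal_mult[symmetric] powr_mult[symmetric])
    also have "\<dots> = ennreal ((1 / c) powr (2 * \<theta>)) * (\<integral>\<^sup>+x. ennreal ((c * u x) powr (2 * \<theta>)) \<partial>lborel)"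
      by (intro nn_integral_cmult) measurable
    also have "\<dots> \<le> ennreal ((1 / c) powr (2 * \<theta>)) * ennreal B" by (intro mult_left_mono fB) auto
    also have "\<dots> \<le> ennreal ((1 / c) powr (2 * \<theta>) * B + 1)"
      using B by (simp add: ennreal_mult[symmetric] ennreal_leI)
    finally show "(\<integral>\<^sup>+x. ennreal (\<bar>norm x powr (- ((?N - 2) / 2)) * \<phi> x\<bar> powr (2 * \<theta>)) \<partial>lborel) \<le> ennreal ((1 / c) powr (2 * \<theta>) * B + 1)"
      by (simp add: u_def a_def)
  qed
qed

section \<open>Rellich compactness in \<open>L\<^sup>1\<close>\<close>

lemma measurable_in_cball [measurable]:
  fixes f :: "'b \<Rightarrow> 'a::euclidean_space"
  assumes "f \<in> borel_measurable M"
  shows "Measurable.pred M (\<lambda>x. f x \<in> cball c r)"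
proof -
  have "Measurable.pred M (\<lambda>x. dist c (f x) \<le> r)"
    using assms by measurable
  then show ?thesis by simp
qed

section \<open>Averages over small balls\<close>

context C1_supported
begin

text \<open>A Poincare inequality: a translation by 2 R moves the ball off itself, so at each x of
  the ball the shifted value vanishes and the increment is \<phi>(x) up to sign.\<close>

lemma L1_bound:
  "(\<integral>\<^sup>+x. ennreal \<bar>\<phi> x\<bar> \<partial>lborel) \<le> ennreal (2 * R) * (\<integral>\<^sup>+x. ennreal (norm (g x)) \<partial>lborel)"
proof -
  obtain b :: 'a where b: "b \<in> Basis" using nonempty_Basis by blast
  define h where "h = (2 * R) *\<^sub>R b"
  have nh: "norm h = 2 * R" using b R by (simp add: h_def)
  have "(\<integral>\<^sup>+x. ennreal \<bar>\<phi> x\<bar> \<partial>lborel) \<le> (\<integral>\<^sup>+x. ennreal \<bar>\<phi> (x + h) - \<phi> x\<bar> \<partial>lborel)"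
  proof (intro nn_integral_mono)
    fix x
    show "ennreal \<bar>\<phi> x\<bar> \<le> ennreal \<bar>\<phi> (x + h) - \<phi> x\<bar>"
    proof (cases "norm x \<ge> R")
      case False
      then have "norm (x + h) \<ge> R" using norm_diff_ineq[of h x] nh by (simp add: add.commute)
      then show ?thesis using outside(1) by simp
    qed (simp add: outside)
  qed
  also have "\<dots> \<le> ennreal (norm h) * (\<integral>\<^sup>+x. ennreal (norm (g x)) \<partial>lborel)"
    by (rule translation_bound)
  finally show ?thesis by (simp add: nh)
qed

text \<open>A convolution with the normalised indicator of a ball. This much smoothing gives
  Lipschitz bounds, hence the equicontinuity that Arzela-Ascoli asks for.\<close>

definition ball_mean :: "real \<Rightarrow> 'a \<Rightarrow> real" where
  "ball_mean d x = (LINT z|lborel. indicator (ball 0 d) z * \<phi> (x + z)) / measure lborel (ball (0::'a) d)"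

lemma ball_mean_integrable: "integrable lborel (\<lambda>z. indicator (ball 0 d) z * \<phi> (x + z))"
proof -
  obtain C where C: "C > 0" "\<And>x. \<bar>\<phi> x\<bar> \<le> C" using fun_bounded by blast
  have "integrable lborel (\<lambda>z::'a. C * indicator (ball 0 d) z)"
    using emeasure_lborel_ball_finite[of "0::'a" d] by (intro integrable_mult_right integrable_real_indicator) auto
  then show ?thesis
    by (rule Bochner_Integration.integrable_bound) (use C in \<open>auto simp: indicator_def less_imp_le\<close>)
qed

lemma ball_mean_measurable [measurable]: "ball_mean d \<in> borel_measurable borel"
  unfolding ball_mean_def by measurable

lemma ball_mean_diff_le:
  assumes "d > 0"
  shows "ennreal \<bar>c - ball_mean d x\<bar> \<le>
    (\<integral>\<^sup>+z. ennreal \<bar>\<phi> (x + z) - c\<bar> * indicator (ball 0 d) z \<partial>lborel) / ennreal (measure lborel (ball (0::'a) d))"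
proof -
  let ?m = "measure lborel (ball (0::'a) d)"
  have m: "?m > 0" using assms content_ball_pos[of d "0::'a"] by simp
  have ii: "integrable lborel (\<lambda>z::'a. c * indicator (ball 0 d) z)"
    using emeasure_lborel_ball_finite[of "0::'a" d] by (intro integrable_mult_right integrable_real_indicator) auto
  have i: "integrable lborel (\<lambda>z. indicator (ball 0 d) z * \<phi> (x + z) - c * indicator (ball 0 d) z)"
    by (intro Bochner_Integration.integrable_diff ball_mean_integrable ii)
  have "(LINT z|lborel. indicator (ball 0 d) z * \<phi> (x + z) - c * indicator (ball 0 d) z) = (ball_mean d x - c) * ?m"
    using m by (subst Bochner_Integration.integral_diff[OF ball_mean_integrable ii])
      (simp add: ball_mean_def algebra_simps)
  then have "ennreal (\<bar>c - ball_mean d x\<bar> * ?m) = ennreal \<bar>LINT z|lborel. indicator (ball 0 d) z * \<phi> (x + z) - c * indicator (ball 0 d) z\<bar>"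
    using m by (simp add: abs_mult)
  also have "\<dots> \<le> (\<integral>\<^sup>+z. ennreal (norm (indicator (ball 0 d) z * \<phi> (x + z) - c * indicator (ball 0 d) z)) \<partial>lborel)"
    using integral_norm_bound_ennreal[OF i] by simp
  also have "\<dots> = (\<integral>\<^sup>+z. ennreal \<bar>\<phi> (x + z) - c\<bar> * indicator (ball 0 d) z \<partial>lborel)"
    by (intro nn_integral_cong) (auto simp: indicator_def)
  finally have le: "ennreal \<bar>c - ball_mean d x\<bar> * ennreal ?m \<le> (\<integral>\<^sup>+z. ennreal \<bar>\<phi> (x + z) - c\<bar> * indicator (ball 0 d) z \<partial>lborel)"
    by (simp add: ennreal_mult)
  have "ennreal \<bar>c - ball_mean d x\<bar> = ennreal \<bar>c - ball_mean d x\<bar> * ennreal ?m / ennreal ?m"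
    using m by (simp add: ennreal_mult_divide_eq)
  also have "\<dots> \<le> (\<integral>\<^sup>+z. ennreal \<bar>\<phi> (x + z) - c\<bar> * indicator (ball 0 d) z \<partial>lborel) / ennreal ?m"
    by (intro divide_right_mono_ennreal le)
  finally show ?thesis .
qed

text \<open>The error is at most an average of translation increments over |z| < d, each of L^1 norm
  at most d times that of the gradient.\<close>

lemma ball_mean_approx:
  assumes "d > 0"
  shows "(\<integral>\<^sup>+x. ennreal \<bar>\<phi> x - ball_mean d x\<bar> \<partial>lborel) \<le> ennreal d * (\<integral>\<^sup>+x. ennreal (norm (g x)) \<partial>lborel)"
proof -
  let ?m = "measure lborel (ball (0::'a) d)" and ?\<Gamma> = "\<integral>\<^sup>+x. ennreal (norm (g x)) \<partial>lborel"
  have m: "?m > 0" using assms content_ball_pos[of d "0::'a"] by simp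
  have "(\<integral>\<^sup>+x. ennreal \<bar>\<phi> x - ball_mean d x\<bar> \<partial>lborel) \<le>
    (\<integral>\<^sup>+x. (\<integral>\<^sup>+z. ennreal \<bar>\<phi> (x + z) - \<phi> x\<bar> * indicator (ball 0 d) z \<partial>lborel) / ennreal ?m \<partial>lborel)"
    by (intro nn_integral_mono ball_mean_diff_le assms)
  also have "\<dots> = (\<integral>\<^sup>+x. (\<integral>\<^sup>+z. ennreal \<bar>\<phi> (x + z) - \<phi> x\<bar> * indicator (ball 0 d) z \<partial>lborel) \<partial>lborel) / ennreal ?m"
    by (intro nn_integral_divide) measurable
  also have "(\<integral>\<^sup>+x. (\<integral>\<^sup>+z. ennreal \<bar>\<phi> (x + z) - \<phi> x\<bar> * indicator (ball 0 d) z \<partial>lborel) \<partial>lborel) =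
      (\<integral>\<^sup>+z. (\<integral>\<^sup>+x. ennreal \<bar>\<phi> (x + z) - \<phi> x\<bar> * indicator (ball 0 d) z \<partial>lborel) \<partial>lborel)"
    by (rule lborel_pair.Fubini') measurable
  also have "\<dots> \<le> (\<integral>\<^sup>+z. (ennreal d * ?\<Gamma>) * indicator (ball (0::'a) d) z \<partial>lborel)"
  proof (intro nn_integral_mono)
    fix z :: 'a
    show "(\<integral>\<^sup>+x. ennreal \<bar>\<phi> (x + z) - \<phi> x\<bar> * indicator (ball 0 d) z \<partial>lborel) \<le> (ennreal d * ?\<Gamma>) * indicator (ball 0 d) z"
    proof (cases "z \<in> ball 0 d")
      case True
      have "(\<integral>\<^sup>+x. ennreal \<bar>\<phi> (x + z) - \<phi> x\<bar> \<partial>lborel) \<le> ennreal (norm z) * ?\<Gamma>" by (rule translation_bound)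
      also have "\<dots> \<le> ennreal d * ?\<Gamma>" using True by (intro mult_right_mono ennreal_leI) auto
      finally show ?thesis using True by simp
    qed simp
  qed
  also have "\<dots> = ennreal d * ?\<Gamma> * ennreal ?m"
    by (subst nn_integral_cmult_indicator) (auto simp: emeasure_lborel_ball)
  finally have "(\<integral>\<^sup>+x. ennreal \<bar>\<phi> x - ball_mean d x\<bar> \<partial>lborel) \<le> ennreal d * ?\<Gamma> * ennreal ?m / ennreal ?m"
    by (simp add: divide_right_mono_ennreal)
  then show ?thesis using m by (simp add: ennreal_mult_divide_eq)
qed

text \<open>Means at x and y are means of translates that differ by x - y, so
  \<open>translation_bound\<close> applies. The constant blows up as d tends to 0, which is harmless
  because d is fixed before compactness is used.\<close>

lemma ball_mean_lipschitz:
  assumes d: "d > 0" and \<Gamma>: "(\<integral>\<^sup>+x. ennreal (norm (g x)) \<partial>lborel) \<le> ennreal \<Gamma>" "\<Gamma> \<ge> 0"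
  shows "\<bar>ball_mean d x - ball_mean d y\<bar> \<le> norm (x - y) * \<Gamma> / measure lborel (ball (0::'a) d)"
proof -
  let ?m = "measure lborel (ball (0::'a) d)"
  have m: "?m > 0" using d content_ball_pos[of d "0::'a"] by simp
  have i: "integrable lborel (\<lambda>z. indicator (ball 0 d) z * \<phi> (x + z) - indicator (ball 0 d) z * \<phi> (y + z))"
    by (intro Bochner_Integration.integrable_diff ball_mean_integrable)
  have "(LINT z|lborel. indicator (ball 0 d) z * \<phi> (x + z) - indicator (ball 0 d) z * \<phi> (y + z)) = (ball_mean d x - ball_mean d y) * ?m"
    using m by (subst Bochner_Integration.integral_diff[OF ball_mean_integrable ball_mean_integrable])
      (simp add: ball_mean_def algebra_simps)
  then have "ennreal (\<bar>ball_mean d x - ball_mean d y\<bar> * ?m) =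
      ennreal \<bar>LINT z|lborel. indicator (ball 0 d) z * \<phi> (x + z) - indicator (ball 0 d) z * \<phi> (y + z)\<bar>"
    using m by (simp add: abs_mult)
  also have "\<dots> \<le> (\<integral>\<^sup>+z. ennreal (norm (indicator (ball 0 d) z * \<phi> (x + z) - indicator (ball 0 d) z * \<phi> (y + z))) \<partial>lborel)"
    using integral_norm_bound_ennreal[OF i] by simp
  also have "\<dots> \<le> (\<integral>\<^sup>+z. ennreal \<bar>\<phi> ((y + z) + (x - y)) - \<phi> (y + z)\<bar> \<partial>lborel)"
    by (intro nn_integral_mono) (auto simp: indicator_def add.commute)
  also have "\<dots> = (\<integral>\<^sup>+z. ennreal \<bar>\<phi> (z + (x - y)) - \<phi> z\<bar> \<partial>lborel)"
    by (rule nn_integral_lborel_translate[of "\<lambda>z. ennreal \<bar>\<phi> (z + (x - y)) - \<phi> z\<bar>" y]) measurable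
  also have "\<dots> \<le> ennreal (norm (x - y)) * (\<integral>\<^sup>+x. ennreal (norm (g x)) \<partial>lborel)" by (rule translation_bound)
  also have "\<dots> \<le> ennreal (norm (x - y)) * ennreal \<Gamma>" by (intro mult_left_mono \<Gamma>) auto
  finally have "\<bar>ball_mean d x - ball_mean d y\<bar> * ?m \<le> norm (x - y) * \<Gamma>"
    using \<Gamma>(2) by (simp add: ennreal_mult[symmetric])
  then show ?thesis using m by (simp add: pos_le_divide_eq)
qed

lemma ball_mean_bounded:
  assumes d: "d > 0" and \<Gamma>: "(\<integral>\<^sup>+x. ennreal (norm (g x)) \<partial>lborel) \<le> ennreal \<Gamma>" "\<Gamma> \<ge> 0"
  shows "\<bar>ball_mean d x\<bar> \<le> 2 * R * \<Gamma> / measure lborel (ball (0::'a) d)"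
proof -
  let ?m = "measure lborel (ball (0::'a) d)"
  have m: "?m > 0" using d content_ball_pos[of d "0::'a"] by simp
  have "ennreal (\<bar>ball_mean d x\<bar> * ?m) = ennreal \<bar>LINT z|lborel. indicator (ball 0 d) z * \<phi> (x + z)\<bar>"
    using m by (simp add: ball_mean_def)
  also have "\<dots> \<le> (\<integral>\<^sup>+z. ennreal (norm (indicator (ball 0 d) z * \<phi> (x + z))) \<partial>lborel)"
    using integral_norm_bound_ennreal[OF ball_mean_integrable[of d x]] by simp
  also have "\<dots> \<le> (\<integral>\<^sup>+z. ennreal \<bar>\<phi> (x + z)\<bar> \<partial>lborel)"
    by (intro nn_integral_mono) (auto simp: indicator_def)
  also have "\<dots> = (\<integral>\<^sup>+z. ennreal \<bar>\<phi> z\<bar> \<partial>lborel)"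
    by (rule nn_integral_lborel_translate[of "\<lambda>z. ennreal \<bar>\<phi> z\<bar>" x]) measurable
  also have "\<dots> \<le> ennreal (2 * R) * (\<integral>\<^sup>+x. ennreal (norm (g x)) \<partial>lborel)" by (rule L1_bound)
  also have "\<dots> \<le> ennreal (2 * R) * ennreal \<Gamma>" by (intro mult_left_mono \<Gamma>) auto
  finally have "\<bar>ball_mean d x\<bar> * ?m \<le> 2 * R * \<Gamma>"
    using \<Gamma>(2) R by (simp add: ennreal_mult[symmetric])
  then show ?thesis using m by (simp add: pos_le_divide_eq)
qed

end

text \<open>For fixed d the means are equibounded and equicontinuous, so Arzela-Ascoli makes a
  subsequence of them uniformly close on the ball, while the functions are L^1-close to their means.
  The subsequence depends on d and hence on \<open>e\<close>, so only one tolerance is reached at a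
  time.\<close>

lemma L1_almost_Cauchy_subseq:
  fixes \<phi> :: "nat \<Rightarrow> 'a::euclidean_space \<Rightarrow> real"
  assumes sup: "\<And>n. C1_supported (\<phi> n) (g n) R"
    and \<Gamma>: "\<And>n. (\<integral>\<^sup>+x. ennreal (norm (g n x)) \<partial>lborel) \<le> ennreal \<Gamma>" "\<Gamma> \<ge> 0" and e: "e > 0"
  shows "\<exists>r::nat \<Rightarrow> nat. strict_mono r \<and>
    (\<exists>M. \<forall>m\<ge>M. \<forall>n\<ge>M. (\<integral>\<^sup>+x. ennreal \<bar>\<phi> (r m) x - \<phi> (r n) x\<bar> \<partial>lborel) \<le> ennreal e)"
proof -
  interpret C: C1_supported "\<phi> n" "g n" R for n by (rule sup)
  note [measurable] = C.measurable_fun C.ball_mean_measurable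
  have R: "R > 0" by (rule C.R)
  \<comment> \<open>Two approximation errors of size d \<Gamma> take up half of \<open>e\<close>;
    below, \<open>\<eta>\<close> leaves the other half to the uniform error on the ball. Adding 1
    excludes a zero denominator.\<close>
  define d where "d = e / (4 * (\<Gamma> + 1))"
  have d: "d > 0" using e \<Gamma>(2) by (simp add: d_def)
  have d\<Gamma>: "d * \<Gamma> \<le> e / 4" using e \<Gamma>(2) by (simp add: d_def field_simps)
  let ?m = "measure lborel (ball (0::'a) d)"
  have m: "?m > 0" using d content_ball_pos[of d "0::'a"] by simp
  let ?F = "\<lambda>n. C.ball_mean n d"
  define V where "V = measure lborel (cball (0::'a) R)"
  have V: "V \<ge> 0" by (simp add: V_def)
  define \<eta> where "\<eta> = e / (4 * (V + 1))"
  have \<eta>: "\<eta> > 0" using e V by (simp add: \<eta>_def)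
  have \<eta>V: "2 * \<eta> * V \<le> e / 2" using e V by (simp add: \<eta>_def field_simps)
  have equi: "\<exists>\<delta>>0. \<forall>n y. y \<in> cball 0 R \<and> norm (x - y) < \<delta> \<longrightarrow> norm (?F n x - ?F n y) < \<epsilon>" if \<epsilon>: "\<epsilon> > 0" for x and \<epsilon> :: real
  proof (intro exI[of _ "\<epsilon> * ?m / (\<Gamma> + 1)"] conjI allI impI)
    show "\<epsilon> * ?m / (\<Gamma> + 1) > 0" using \<epsilon> m \<Gamma>(2) by (simp add: add_nonneg_pos)
    fix n y assume y: "y \<in> cball 0 R \<and> norm (x - y) < \<epsilon> * ?m / (\<Gamma> + 1)"
    then have "norm (x - y) * (\<Gamma> + 1) < \<epsilon> * ?m" using \<Gamma>(2) by (simp add: pos_less_divide_eq)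
    then have "norm (x - y) * \<Gamma> < \<epsilon> * ?m"
      by (smt (verit) mult_left_mono norm_ge_zero)
    then have "norm (x - y) * \<Gamma> / ?m < \<epsilon>" using m by (simp add: pos_divide_less_eq)
    then show "norm (?F n x - ?F n y) < \<epsilon>"
      using C.ball_mean_lipschitz[OF d \<Gamma>(1) \<Gamma>(2), of n x y] by simp
  qed
  obtain G k where k: "strict_mono (k :: nat \<Rightarrow> nat)"
    "\<And>e. 0 < e \<Longrightarrow> \<exists>N. \<forall>n x. n \<ge> N \<and> x \<in> cball 0 R \<longrightarrow> norm (?F (k n) x - G x) < e"
    using Arzela_Ascoli[of "cball 0 R" ?F "2 * R * \<Gamma> / ?m"] equi C.ball_mean_bounded[OF d \<Gamma>(1) \<Gamma>(2)]
    by (metis compact_cball real_norm_def)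
  obtain M where M: "\<And>n x. n \<ge> M \<Longrightarrow> x \<in> cball 0 R \<Longrightarrow> norm (?F (k n) x - G x) < \<eta>"
    using k(2)[OF \<eta>] by blast
  show ?thesis
  proof (intro exI[of _ k] conjI exI[of _ M] allI impI k(1))
    fix m n assume mn: "M \<le> m" "M \<le> n"
    have "(\<integral>\<^sup>+x. ennreal \<bar>\<phi> (k m) x - \<phi> (k n) x\<bar> \<partial>lborel) \<le>
      (\<integral>\<^sup>+x. ennreal \<bar>\<phi> (k m) x - ?F (k m) x\<bar> + (ennreal \<bar>\<phi> (k n) x - ?F (k n) x\<bar> + ennreal (2 * \<eta>) * indicator (cball 0 R) x) \<partial>lborel)"
    proof (intro nn_integral_mono)
      fix x :: 'a
      show "ennreal \<bar>\<phi> (k m) x - \<phi> (k n) x\<bar> \<le> ennreal \<bar>\<phi> (k m) x - ?F (k m) x\<bar> +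
         (ennreal \<bar>\<phi> (k n) x - ?F (k n) x\<bar> + ennreal (2 * \<eta>) * indicator (cball 0 R) x)"
      proof (cases "x \<in> cball 0 R")
        case True
        have "\<bar>\<phi> (k m) x - \<phi> (k n) x\<bar> \<le> \<bar>\<phi> (k m) x - ?F (k m) x\<bar> + (\<bar>\<phi> (k n) x - ?F (k n) x\<bar> + 2 * \<eta>)"
          using M[OF mn(1) True] M[OF mn(2) True] by simp
        then show ?thesis using True \<eta> by (simp add: ennreal_plus[symmetric] ennreal_leI del: ennreal_plus)
      qed (simp add: C.outside)
    qed
    also have "\<dots> = (\<integral>\<^sup>+x. ennreal \<bar>\<phi> (k m) x - ?F (k m) x\<bar> \<partial>lborel) +
       (\<integral>\<^sup>+x. ennreal \<bar>\<phi> (k n) x - ?F (k n) x\<bar> + ennreal (2 * \<eta>) * indicator (cball (0::'a) R) x \<partial>lborel)"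
      by (rule nn_integral_add) measurable
    also have "(\<integral>\<^sup>+x. ennreal \<bar>\<phi> (k n) x - ?F (k n) x\<bar> + ennreal (2 * \<eta>) * indicator (cball (0::'a) R) x \<partial>lborel) =
       (\<integral>\<^sup>+x. ennreal \<bar>\<phi> (k n) x - ?F (k n) x\<bar> \<partial>lborel) + (\<integral>\<^sup>+x. ennreal (2 * \<eta>) * indicator (cball (0::'a) R) x \<partial>lborel)"
      by (rule nn_integral_add) measurable
    also have "(\<integral>\<^sup>+x. ennreal \<bar>\<phi> (k m) x - ?F (k m) x\<bar> \<partial>lborel) + ((\<integral>\<^sup>+x. ennreal \<bar>\<phi> (k n) x - ?F (k n) x\<bar> \<partial>lborel) +
      (\<integral>\<^sup>+x. ennreal (2 * \<eta>) * indicator (cball (0::'a) R) x \<partial>lborel)) \<le> ennreal d * ennreal \<Gamma> + (ennreal d * ennreal \<Gamma> + ennreal (2 * \<eta>) * ennreal V)"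
    proof -
      have "(\<integral>\<^sup>+x. ennreal \<bar>\<phi> n x - ?F n x\<bar> \<partial>lborel) \<le> ennreal d * ennreal \<Gamma>" for n
        by (rule order_trans[OF C.ball_mean_approx[OF d]]) (intro mult_left_mono \<Gamma>, simp)
      moreover have "(\<integral>\<^sup>+x. ennreal (2 * \<eta>) * indicator (cball (0::'a) R) x \<partial>lborel) = ennreal (2 * \<eta>) * ennreal V"
        using emeasure_lborel_cball_finite[of "0::'a" R]
        by (subst nn_integral_cmult_indicator) (auto simp: V_def emeasure_eq_ennreal_measure)
      ultimately show ?thesis by (intro add_mono) simp_all
    qed
    also have "\<dots> = ennreal (d * \<Gamma> + (d * \<Gamma> + 2 * \<eta> * V))"
      using d \<Gamma>(2) \<eta> V by (simp add: ennreal_mult[symmetric] ennreal_plus[symmetric] del: ennreal_plus)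
    also have "\<dots> \<le> ennreal e" using d\<Gamma> \<eta>V by (intro ennreal_leI) linarith
    finally show "(\<integral>\<^sup>+x. ennreal \<bar>\<phi> (k m) x - \<phi> (k n) x\<bar> \<partial>lborel) \<le> ennreal e" .
  qed
qed

text \<open>Being eventually within 1/(k + 1) is inherited by subsequences, so a diagonal sequence
  has this property for every k.\<close>

theorem Rellich_L1:
  fixes \<phi> :: "nat \<Rightarrow> 'a::euclidean_space \<Rightarrow> real"
  assumes sup: "\<And>n. C1_supported (\<phi> n) (g n) R"
    and \<Gamma>: "\<And>n. (\<integral>\<^sup>+x. ennreal (norm (g n x)) \<partial>lborel) \<le> ennreal \<Gamma>" "\<Gamma> \<ge> 0"
  shows "\<exists>r::nat \<Rightarrow> nat. strict_mono r \<and>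
    (\<forall>e>0. \<exists>M. \<forall>m\<ge>M. \<forall>n\<ge>M. (\<integral>\<^sup>+x. ennreal \<bar>\<phi> (r m) x - \<phi> (r n) x\<bar> \<partial>lborel) \<le> ennreal e)"
proof -
  define P where "P k r \<longleftrightarrow> (\<exists>M. \<forall>m\<ge>M. \<forall>n\<ge>M.
    (\<integral>\<^sup>+x. ennreal \<bar>\<phi> (r m) x - \<phi> (r n) x\<bar> \<partial>lborel) \<le> ennreal (inverse (real (Suc k))))" for k :: nat and r :: "nat \<Rightarrow> nat"
  interpret subseqs P
  proof
    fix k :: nat and s :: "nat \<Rightarrow> nat"
    show "\<exists>r'. strict_mono r' \<and> P k (s \<circ> r')"
      using L1_almost_Cauchy_subseq[of "\<phi> \<circ> s" "g \<circ> s" R \<Gamma> "inverse (real (Suc k))"] sup \<Gamma>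
      unfolding P_def by (auto simp: o_def)
  qed
  have P: "P k (diagseq \<circ> (+) (Suc k))" for k
  proof (rule diagseq_holds)
    fix r s :: "nat \<Rightarrow> nat" and n
    assume r: "strict_mono r" and s: "P n s"
    obtain M where "\<And>i j. M \<le> i \<Longrightarrow> M \<le> j \<Longrightarrow> (\<integral>\<^sup>+x. ennreal \<bar>\<phi> (s i) x - \<phi> (s j) x\<bar> \<partial>lborel) \<le> ennreal (inverse (real (Suc n)))"
      using s unfolding P_def by blast
    then show "P n (s \<circ> r)"
      unfolding P_def o_def by (meson order_trans seq_suble[OF r])
  qed
  show ?thesis
  proof (intro exI[of _ diagseq] conjI allI impI subseq_diagseq)
    fix e :: real assume e: "e > 0"
    obtain k where k: "inverse (real (Suc k)) < e" using reals_Archimedean[OF e] by auto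
    obtain M where M: "\<And>i j. M \<le> i \<Longrightarrow> M \<le> j \<Longrightarrow>
        (\<integral>\<^sup>+x. ennreal \<bar>\<phi> (diagseq (Suc k + i)) x - \<phi> (diagseq (Suc k + j)) x\<bar> \<partial>lborel) \<le> ennreal (inverse (real (Suc k)))"
      using P[of k] unfolding P_def o_def by blast
    show "\<exists>M. \<forall>m\<ge>M. \<forall>n\<ge>M. (\<integral>\<^sup>+x. ennreal \<bar>\<phi> (diagseq m) x - \<phi> (diagseq n) x\<bar> \<partial>lborel) \<le> ennreal e"
    \<comment> \<open>Property number k is known for the diagonal sequence from index
      \<open>Suc k\<close> on, hence the shift.\<close>
    proof (intro exI[of _ "Suc k + M"] allI impI)
      fix m n assume "Suc k + M \<le> m" "Suc k + M \<le> n"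
      then have "(\<integral>\<^sup>+x. ennreal \<bar>\<phi> (diagseq m) x - \<phi> (diagseq n) x\<bar> \<partial>lborel) \<le> ennreal (inverse (real (Suc k)))"
        using M[of "m - Suc k" "n - Suc k"] by simp
      also have "\<dots> \<le> ennreal e" using k by (intro ennreal_leI) simp
      finally show "(\<integral>\<^sup>+x. ennreal \<bar>\<phi> (diagseq m) x - \<phi> (diagseq n) x\<bar> \<partial>lborel) \<le> ennreal e" .
    qed
  qed
qed

section \<open>Test functions and the weighted energy\<close>

lemma frechet_derivative_lincomb:
  fixes f g :: "'a::euclidean_space \<Rightarrow> real"
  assumes "f differentiable (at x)" "g differentiable (at x)"
  shows "((\<lambda>x. a * f x + b * g x) has_derivative
      (\<lambda>h. a * frechet_derivative f (at x) h + b * frechet_derivative g (at x) h)) (at x)"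
proof -
  have "(f has_derivative frechet_derivative f (at x)) (at x)" "(g has_derivative frechet_derivative g (at x)) (at x)"
    using assms by (simp_all add: frechet_derivative_works)
  then show ?thesis by (auto intro!: derivative_eq_intros)
qed

lemma C_k_lincomb:
  fixes f g :: "'a::euclidean_space \<Rightarrow> real"
  assumes "C_k k f" "C_k k g"
  shows "C_k k (\<lambda>x. a * f x + b * g x)"
  using assms
proof (induction k arbitrary: f g)
  case 0
  then show ?case by (auto intro!: continuous_intros)
next
  case (Suc k)
  have d: "f differentiable (at x)" "g differentiable (at x)" for x using Suc.prems by auto
  have "frechet_derivative (\<lambda>x. a * f x + b * g x) (at x) =
      (\<lambda>h. a * frechet_derivative f (at x) h + b * frechet_derivative g (at x) h)" for x
    using frechet_derivative_at[OF frechet_derivative_lincomb[OF d, of a b x]] by simp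
  moreover have "(\<lambda>x. a * f x + b * g x) differentiable (at x)" for x
    using frechet_derivative_lincomb[OF d] by (rule differentiableI)
  moreover have "C_k k (\<lambda>x. a * frechet_derivative f (at x) h + b * frechet_derivative g (at x) h)" for h
    using Suc.prems by (intro Suc.IH) simp_all
  ultimately show ?case by (simp only: C_k.simps simp_thms)
qed

lemma test_functions_lincomb:
  assumes f: "f \<in> test_functions \<Omega>" and g: "g \<in> test_functions \<Omega>"
  shows "(\<lambda>x. a * f x + b * g x) \<in> test_functions \<Omega>"
proof -
  let ?h = "\<lambda>x. a * f x + b * g x"
  have "{x. ?h x \<noteq> 0} \<subseteq> {x. f x \<noteq> 0} \<union> {x. g x \<noteq> 0}" by auto
  then have sub: "closure {x. ?h x \<noteq> 0} \<subseteq> closure {x. f x \<noteq> 0} \<union> closure {x. g x \<noteq> 0}"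
    unfolding closure_Un[symmetric] by (rule closure_mono)
  have K: "compact (closure {x. f x \<noteq> 0} \<union> closure {x. g x \<noteq> 0})"
    using f g by (intro compact_Un) (auto simp: test_functions_def)
  have "compact (closure {x. ?h x \<noteq> 0})"
    using compact_Int_closed[OF K closed_closure[of "{x. ?h x \<noteq> 0}"]] by (simp only: inf.absorb2[OF sub])
  moreover have "closure {x. ?h x \<noteq> 0} \<subseteq> \<Omega>" using sub f g by (auto simp: test_functions_def)
  ultimately show ?thesis
    using C_k_lincomb[of _ f g a b] f g unfolding test_functions_def by blast
qed

lemma test_functions_diff:
  assumes "f \<in> test_functions \<Omega>" "g \<in> test_functions \<Omega>"
  shows "(\<lambda>x. f x - g x) \<in> test_functions \<Omega>"
  using test_functions_lincomb[OF assms, of 1 "-1"] by simp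

lemma has_derivative_grad:
  fixes f :: "'a::euclidean_space \<Rightarrow> real"
  assumes "f differentiable (at x)"
  shows "(f has_derivative (\<lambda>h. grad f x \<bullet> h)) (at x)"
proof -
  have d: "(f has_derivative frechet_derivative f (at x)) (at x)"
    using assms by (simp add: frechet_derivative_works)
  then interpret linear "frechet_derivative f (at x)" by (rule has_derivative_linear)
  have "frechet_derivative f (at x) h = grad f x \<bullet> h" for h
  proof -
    have "frechet_derivative f (at x) h = frechet_derivative f (at x) (\<Sum>b\<in>Basis. (h \<bullet> b) *\<^sub>R b)"
      by (simp add: euclidean_representation)
    also have "\<dots> = grad f x \<bullet> h"
      by (simp add: sum scale grad_def inner_sum_left inner_sum_right inner_commute mult.commute)
    finally show ?thesis .
  qed
  then have "frechet_derivative f (at x) = (\<lambda>h. grad f x \<bullet> h)" by auto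
  with d show ?thesis by simp
qed

lemma grad_eqI:
  fixes f :: "'a::euclidean_space \<Rightarrow> real"
  assumes "(f has_derivative (\<lambda>h. v \<bullet> h)) (at x)"
  shows "grad f x = v"
  using frechet_derivative_at[OF assms] euclidean_representation[of v]
  by (simp add: grad_def)

lemma grad_lincomb:
  fixes f g :: "'a::euclidean_space \<Rightarrow> real"
  assumes "f differentiable (at x)" "g differentiable (at x)"
  shows "grad (\<lambda>x. a * f x + b * g x) x = a *\<^sub>R grad f x + b *\<^sub>R grad g x"
  by (rule grad_eqI)
     (use has_derivative_grad[OF assms(1)] has_derivative_grad[OF assms(2)]
      in \<open>auto intro!: derivative_eq_intros simp: inner_add_left\<close>)

lemma test_functions_differentiable:
  assumes "f \<in> test_functions \<Omega>"
  shows "f differentiable (at x)"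
proof -
  have "C_k (Suc 0) f" using assms unfolding test_functions_def by blast
  then show ?thesis by simp
qed

text \<open>The complement of the closed support is open and the function is zero on it, so the
  derivative vanishes there too. Integrals over \<Omega> can thus be taken over the whole
  space.\<close>

lemma test_functions_outside:
  assumes f: "f \<in> test_functions \<Omega>" and x: "x \<notin> \<Omega>"
  shows "f x = 0" "grad f x = 0"
proof -
  define S where "S = closure {x. f x \<noteq> 0}"
  have S: "closed S" "x \<in> - S" using f x by (auto simp: test_functions_def S_def)
  have z: "f y = 0" if "y \<in> - S" for y
    using that closure_subset[of "{x. f x \<noteq> 0}"] unfolding S_def by blast
  show "f x = 0" by (rule z[OF S(2)])
  have "(f has_derivative (\<lambda>h. 0)) (at x)"
    by (rule has_derivative_transform_within_open[OF has_derivative_const open_Compl[OF S(1)] S(2)])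
       (rule z[symmetric])
  then show "grad f x = 0" by (intro grad_eqI) simp
qed

lemma C1_supported_test_function:
  assumes f: "f \<in> test_functions \<Omega>" and \<Omega>: "\<Omega> \<subseteq> ball 0 R" and R: "R > 0"
  shows "C1_supported f (grad f) R"
proof
  show "(f has_derivative (\<lambda>h. grad f x \<bullet> h)) (at x)" for x
    by (intro has_derivative_grad test_functions_differentiable[OF f])
  have "C_k (Suc 0) f" using f unfolding test_functions_def by blast
  then have "continuous_on UNIV (\<lambda>x. frechet_derivative f (at x) h)" for h by simp
  then show "continuous_on UNIV (grad f)"
    unfolding grad_def by (intro continuous_intros) auto
  show "f x = 0" if "norm x \<ge> R" for x
    by (rule test_functions_outside[OF f]) (use that \<Omega> in auto)
  show "grad f x = 0" if "norm x \<ge> R" for x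
    by (rule test_functions_outside[OF f]) (use that \<Omega> in auto)
qed (rule R)

text \<open>The gradient is bounded with bounded support, and the weight has order N - 2 < N. It
  ensures that the integral in \<open>W_norm0\<close> is the true energy and not the default value
  0.\<close>

lemma (in C1_supported) integrable_energy:
  assumes N: "DIM('a) \<ge> 3"
  shows "integrable lborel (\<lambda>x. norm x powr (- (real DIM('a) - 2)) * (norm (g x))\<^sup>2)"
proof -
  obtain C where C: "C > 0" "\<And>x. norm (g x) \<le> C" using grad_bounded by blast
  obtain K where K: "\<And>z::'a. (\<integral>\<^sup>+x. ennreal (norm (x - z) powr (- (real DIM('a) - 2))) * indicator (ball z R) x \<partial>lborel) \<le> ennreal K"
    using nn_integral_ball_powr[where 'a='a, of "real DIM('a) - 2" R] R by auto
  have "(\<integral>\<^sup>+x. ennreal (norm (norm x powr (- (real DIM('a) - 2)) * (norm (g x))\<^sup>2)) \<partial>lborel) \<le>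
    (\<integral>\<^sup>+x. ennreal (C\<^sup>2) * (ennreal (norm (x - (0::'a)) powr (- (real DIM('a) - 2))) * indicator (ball 0 R) x) \<partial>lborel)"
  proof (intro nn_integral_mono)
    fix x :: 'a
    show "ennreal (norm (norm x powr (- (real DIM('a) - 2)) * (norm (g x))\<^sup>2)) \<le>
      ennreal (C\<^sup>2) * (ennreal (norm (x - 0) powr (- (real DIM('a) - 2))) * indicator (ball 0 R) x)"
    proof (cases "norm x < R")
      case True
      have "norm (norm x powr (- (real DIM('a) - 2)) * (norm (g x))\<^sup>2) \<le> C\<^sup>2 * norm x powr (- (real DIM('a) - 2))"
        using C by (simp add: abs_mult mult.commute[of "C\<^sup>2"] mult_left_mono power_mono)
      then show ?thesis using True by (simp add: ennreal_mult[symmetric] ennreal_leI)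
    qed (simp add: outside)
  qed
  also have "\<dots> = ennreal (C\<^sup>2) * (\<integral>\<^sup>+x. ennreal (norm (x - (0::'a)) powr (- (real DIM('a) - 2))) * indicator (ball 0 R) x \<partial>lborel)"
    by (intro nn_integral_cmult) measurable
  also have "\<dots> \<le> ennreal (C\<^sup>2) * ennreal K" by (intro mult_left_mono K) auto
  also have "\<dots> < \<infinity>" by (simp add: ennreal_mult_less_top)
  finally show ?thesis by (intro integrableI_bounded) auto
qed

section \<open>The weighted energy as a seminorm on test functions\<close>

lemma W_norm0_nonneg: "W_norm0 \<Omega> f \<ge> 0"
  by (auto simp: W_norm0_def set_lebesgue_integral_def intro!: Bochner_Integration.integral_nonneg)

lemma W_norm0_sq:
  fixes f :: "'a::euclidean_space \<Rightarrow> real"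
  assumes N: "DIM('a) \<ge> 3" and f: "f \<in> test_functions \<Omega>" and \<Omega>: "bounded \<Omega>"
  shows "(W_norm0 \<Omega> f)\<^sup>2 = (LINT x|lborel. norm x powr (- (real DIM('a) - 2)) * (norm (grad f x))\<^sup>2)"
    and "ennreal ((W_norm0 \<Omega> f)\<^sup>2) = (\<integral>\<^sup>+x. ennreal (norm x powr (- (real DIM('a) - 2)) * (norm (grad f x))\<^sup>2) \<partial>lborel)"
proof -
  obtain R where R: "R > 0" "\<Omega> \<subseteq> ball 0 R" using \<Omega> bounded_subset_ballD[of \<Omega> 0] by auto
  interpret C1_supported f "grad f" R by (rule C1_supported_test_function[OF f R(2,1)])
  let ?e = "\<lambda>x. norm x powr (- (real DIM('a) - 2)) * (norm (grad f x))\<^sup>2"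
  have "(LINT x:\<Omega>|lebesgue. ?e x) = (LINT x|lebesgue. ?e x)"
    unfolding set_lebesgue_integral_def
    by (intro Bochner_Integration.integral_cong) (auto simp: indicator_def test_functions_outside[OF f])
  also have "\<dots> = (LINT x|lborel. ?e x)" by (intro integral_completion) measurable
  finally have "W_norm0 \<Omega> f = sqrt (LINT x|lborel. ?e x)" by (simp add: W_norm0_def)
  moreover have "(LINT x|lborel. ?e x) \<ge> 0" by (intro Bochner_Integration.integral_nonneg) auto
  ultimately show 1: "(W_norm0 \<Omega> f)\<^sup>2 = (LINT x|lborel. ?e x)" by simp
  show "ennreal ((W_norm0 \<Omega> f)\<^sup>2) = (\<integral>\<^sup>+x. ennreal (?e x) \<partial>lborel)"
    unfolding 1 by (intro nn_integral_eq_integral[symmetric] integrable_energy N) auto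
qed

text \<open>For positive x and y the right side at t = y/x equals (x + y)^2. Both numbers are first
  enlarged by e/2, so that this ratio is defined and positive.\<close>

lemma sum_le_if_weighted_squares:
  fixes x y z :: real
  assumes le: "\<And>t. t > 0 \<Longrightarrow> z\<^sup>2 \<le> (1 + t) * x\<^sup>2 + (1 + 1 / t) * y\<^sup>2" and nn: "x \<ge> 0" "y \<ge> 0"
  shows "z \<le> x + y"
proof (rule field_le_epsilon)
  fix e :: real assume e: "e > 0"
  define X Y where "X = x + e / 2" and "Y = y + e / 2"
  have XY: "X > 0" "Y > 0" "x \<le> X" "y \<le> Y" using e nn by (auto simp: X_def Y_def)
  have "z\<^sup>2 \<le> (1 + Y / X) * x\<^sup>2 + (1 + 1 / (Y / X)) * y\<^sup>2" using XY by (intro le) auto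
  also have "\<dots> \<le> (1 + Y / X) * X\<^sup>2 + (1 + 1 / (Y / X)) * Y\<^sup>2"
    using XY nn by (intro add_mono mult_left_mono power_mono) auto
  also have "\<dots> = (X + Y)\<^sup>2" using XY by (simp add: field_simps power2_eq_square)
  finally have "z \<le> X + Y" using XY by (meson power2_le_imp_le add_nonneg_nonneg less_imp_le)
  then show "z \<le> x + y + e" by (simp add: X_def Y_def)
qed

text \<open>The pointwise bound |A + B|^2 <= (1 + t) |A|^2 + (1 + 1/t) |B|^2 is integrated, and
  \<open>t\<close> is optimised afterwards. The sign \<open>s\<close> covers sums and differences at
  once.\<close>

lemma W_norm0_lincomb_le:
  fixes f h :: "'a::euclidean_space \<Rightarrow> real"
  assumes N: "DIM('a) \<ge> 3" and f: "f \<in> test_functions \<Omega>" and h: "h \<in> test_functions \<Omega>" and \<Omega>: "bounded \<Omega>"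
    and s: "\<bar>s\<bar> = 1"
  shows "W_norm0 \<Omega> (\<lambda>x. f x + s * h x) \<le> W_norm0 \<Omega> f + W_norm0 \<Omega> h"
proof (rule sum_le_if_weighted_squares)
  fix t :: real assume t: "t > 0"
  obtain R where R: "R > 0" "\<Omega> \<subseteq> ball 0 R" using \<Omega> bounded_subset_ballD[of \<Omega> 0] by auto
  have fh: "(\<lambda>x. f x + s * h x) \<in> test_functions \<Omega>" using test_functions_lincomb[OF f h, of 1 s] by simp
  note int = C1_supported.integrable_energy[OF C1_supported_test_function[OF _ R(2,1)] N]
  let ?w = "\<lambda>x::'a. norm x powr (- (real DIM('a) - 2))"
  have "(W_norm0 \<Omega> (\<lambda>x. f x + s * h x))\<^sup>2 = (LINT x|lborel. ?w x * (norm (grad (\<lambda>x. f x + s * h x) x))\<^sup>2)"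
    by (rule W_norm0_sq[OF N fh \<Omega>])
  also have "\<dots> \<le> (LINT x|lborel. (1 + t) * (?w x * (norm (grad f x))\<^sup>2) + (1 + 1 / t) * (?w x * (norm (grad h x))\<^sup>2))"
  proof (intro integral_mono int fh Bochner_Integration.integrable_add integrable_mult_right f h)
    fix x
    have g: "grad (\<lambda>x. f x + s * h x) x = grad f x + s *\<^sub>R grad h x"
      using grad_lincomb[of f x h 1 s] test_functions_differentiable f h by auto
    let ?a = "norm (grad f x)" and ?b = "norm (grad h x)"
    have "norm (grad f x + s *\<^sub>R grad h x) \<le> ?a + ?b" using norm_triangle_ineq[of "grad f x" "s *\<^sub>R grad h x"] s by simp
    then have "(norm (grad f x + s *\<^sub>R grad h x))\<^sup>2 \<le> (?a + ?b)\<^sup>2" by (intro power_mono) auto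
    also have "\<dots> \<le> (1 + t) * ?a\<^sup>2 + (1 + 1 / t) * ?b\<^sup>2"
    proof -
      have "0 \<le> (t * ?a - ?b)\<^sup>2 / t" using t by simp
      also have "\<dots> = (1 + t) * ?a\<^sup>2 + (1 + 1 / t) * ?b\<^sup>2 - (?a + ?b)\<^sup>2"
        using t by (simp add: power2_eq_square field_simps)
      finally show ?thesis by simp
    qed
    finally have "?w x * (norm (grad f x + s *\<^sub>R grad h x))\<^sup>2 \<le> ?w x * ((1 + t) * ?a\<^sup>2 + (1 + 1 / t) * ?b\<^sup>2)"
      by (intro mult_left_mono) auto
    then show "?w x * (norm (grad (\<lambda>x. f x + s * h x) x))\<^sup>2 \<le> (1 + t) * (?w x * ?a\<^sup>2) + (1 + 1 / t) * (?w x * ?b\<^sup>2)"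
      by (simp only: g distrib_left) (simp add: mult_ac)
  qed
  also have "\<dots> = (1 + t) * (W_norm0 \<Omega> f)\<^sup>2 + (1 + 1 / t) * (W_norm0 \<Omega> h)\<^sup>2"
    using int[OF f] int[OF h] by (simp add: W_norm0_sq[OF N _ \<Omega>] f h)
  finally show "(W_norm0 \<Omega> (\<lambda>x. f x + s * h x))\<^sup>2 \<le> (1 + t) * (W_norm0 \<Omega> f)\<^sup>2 + (1 + 1 / t) * (W_norm0 \<Omega> h)\<^sup>2" .
qed (auto intro: W_norm0_nonneg)

lemma W_norm0_scale:
  assumes "c \<ge> 0" and f: "f \<in> test_functions \<Omega>"
  shows "W_norm0 \<Omega> (\<lambda>x. c * f x) = c * W_norm0 \<Omega> f"
proof -
  have "grad (\<lambda>x. c * f x) x = c *\<^sub>R grad f x" for x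
    using grad_lincomb[of f x f c 0] test_functions_differentiable[OF f] by simp
  then have "W_norm0 \<Omega> (\<lambda>x. c * f x) = sqrt (LINT x:\<Omega>|lebesgue. c\<^sup>2 * (norm x powr (- (real DIM('a) - 2)) * (norm (grad f x))\<^sup>2))"
    by (simp add: W_norm0_def power_mult_distrib mult_ac)
  also have "\<dots> = c * W_norm0 \<Omega> f" using assms(1) by (simp add: W_norm0_def real_sqrt_mult)
  finally show ?thesis .
qed

section \<open>The ground state transform\<close>

text \<open>The cone over the sphere is the punctured ball, so the area is N/\<rho> times the volume
  of the ball. Being finite and positive, it makes the quotient in \<open>sphere_mean\<close> a
  genuine mean.\<close>

lemma emeasure_sphere_measure_sphere:
  assumes "\<rho> > 0"
  shows "\<exists>m>0. emeasure (sphere_measure \<rho> :: 'a::euclidean_space measure) (sphere 0 \<rho>) = ennreal m"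
proof -
  let ?B = "ball (0::'a) \<rho> - {0}"
  let ?f = "\<lambda>x::'a. (\<rho> / norm x) *\<^sub>R x"
  have f: "?f \<in> borel_measurable (restrict_space lborel ?B)"
    by (intro measurable_restrict_space1) measurable
  have "emeasure (sphere_measure \<rho>) (sphere (0::'a) \<rho>) =
      ennreal (real DIM('a) / \<rho>) * emeasure (restrict_space lborel ?B) (?f -` sphere 0 \<rho> \<inter> space (restrict_space lborel ?B))"
    unfolding sphere_measure_def using f by (simp add: emeasure_distr)
  also have "?f -` sphere 0 \<rho> \<inter> space (restrict_space lborel ?B) = ?B"
    using assms by (auto simp: space_restrict_space)
  also have "emeasure (restrict_space lborel ?B) ?B = emeasure lborel ?B"
    by (intro emeasure_restrict_space) auto
  also have "emeasure lborel ?B = emeasure lborel (ball (0::'a) \<rho>)"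
    by (intro emeasure_Diff_null_set) auto
  also have "\<dots> = ennreal (measure lborel (ball (0::'a) \<rho>))" by (rule emeasure_lborel_ball)
  also have "ennreal (real DIM('a) / \<rho>) * \<dots> = ennreal (real DIM('a) / \<rho> * measure lborel (ball (0::'a) \<rho>))"
    using assms by (subst ennreal_mult[symmetric]) auto
  finally show ?thesis
    using assms content_ball_pos[of \<rho> "0::'a"] DIM_positive[where 'a='a] by (intro exI conjI) auto
qed

text \<open>On the sphere the weight is the constant \<rho>^(-a), which the prefactor cancels; the
  mean of \<phi> over small spheres tends to \<phi>(0) by continuity.\<close>

lemma sphere_mean_limit:
  fixes \<phi> :: "'a::euclidean_space \<Rightarrow> real"
  assumes \<phi>: "continuous_on UNIV \<phi>"
  shows "((\<lambda>\<rho>. \<rho> powr a * sphere_mean (\<lambda>x. norm x powr (- a) * \<phi> x) \<rho>) \<longlongrightarrow> \<phi> 0) (at_right 0)"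
proof (rule tendstoI)
  fix e :: real assume e: "e > 0"
  have "\<exists>d>0. \<forall>x. dist x 0 < d \<longrightarrow> dist (\<phi> x) (\<phi> 0) < e / 2"
    using \<phi>[unfolded continuous_on_iff, rule_format, of 0 "e / 2"] e by auto
  then obtain d where d: "d > 0" "\<And>x. norm x < d \<Longrightarrow> \<bar>\<phi> x - \<phi> 0\<bar> < e / 2"
    by (auto simp: dist_norm)
  have "dist (\<rho> powr a * sphere_mean (\<lambda>x. norm x powr (- a) * \<phi> x) \<rho>) (\<phi> 0) < e" if \<rho>: "0 < \<rho>" "\<rho> < d" for \<rho>
  proof -
    define M :: "'a measure" where "M = sphere_measure \<rho>"
    let ?S = "sphere (0::'a) \<rho>"
    have sM: "sets M = sets borel" by (simp add: M_def sphere_measure_def)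
    obtain m where m: "m > 0" "emeasure M ?S = ennreal m"
      using emeasure_sphere_measure_sphere[OF \<rho>(1), where 'a='a] by (auto simp: M_def)
    have mm: "measure M ?S = m" using m by (simp add: measure_def)
    have S: "?S \<in> sets M" by (simp add: sM)
    have b\<phi>: "\<phi> \<in> borel_measurable M"
      using borel_measurable_continuous_onI[OF \<phi>] measurable_cong_sets[OF sM refl] by blast
    have i: "integrable M (\<lambda>x. indicator ?S x *\<^sub>R (\<phi> x - \<phi> 0))"
      using S b\<phi> m \<rho> d(2)
      by (intro integrableI_bounded_set_indicator[where B="e / 2"]) (auto intro!: AE_I2 less_imp_le)
    have ic: "integrable M (\<lambda>x. indicator ?S x *\<^sub>R c)" for c :: real
      using S m by (intro integrable_scaleR_left integrable_real_indicator) auto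
    have "\<bar>LINT x|M. indicator ?S x *\<^sub>R (\<phi> x - \<phi> 0)\<bar> \<le> (LINT x|M. norm (indicator ?S x *\<^sub>R (\<phi> x - \<phi> 0)))"
      using integral_norm_bound[of M "\<lambda>x. indicator ?S x *\<^sub>R (\<phi> x - \<phi> 0)"] by simp
    also have "\<dots> \<le> (LINT x|M. indicator ?S x *\<^sub>R (e / 2))"
      using d(2) \<rho> by (intro integral_mono integrable_norm i ic) (auto simp: indicator_def intro!: less_imp_le)
    also have "\<dots> = e / 2 * m" using S by (simp add: mm)
    finally have le: "\<bar>LINT x|M. indicator ?S x *\<^sub>R (\<phi> x - \<phi> 0)\<bar> \<le> e / 2 * m" .
    have "(LINT x:?S|M. norm x powr (- a) * \<phi> x) =
        (LINT x|M. \<rho> powr (- a) * (indicator ?S x *\<^sub>R (\<phi> x - \<phi> 0) + indicator ?S x *\<^sub>R \<phi> 0))"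
      unfolding set_lebesgue_integral_def
      by (intro Bochner_Integration.integral_cong) (auto simp: indicator_def)
    also have "\<dots> = \<rho> powr (- a) * (LINT x|M. indicator ?S x *\<^sub>R (\<phi> x - \<phi> 0) + indicator ?S x *\<^sub>R \<phi> 0)"
      by simp
    also have "(LINT x|M. indicator ?S x *\<^sub>R (\<phi> x - \<phi> 0) + indicator ?S x *\<^sub>R \<phi> 0) =
       (LINT x|M. indicator ?S x *\<^sub>R (\<phi> x - \<phi> 0)) + (LINT x|M. indicator ?S x *\<^sub>R \<phi> 0)"
      by (rule Bochner_Integration.integral_add[OF i ic])
    also have "(LINT x|M. indicator ?S x *\<^sub>R \<phi> 0) = \<phi> 0 * m" using S by (simp add: mm)
    finally have "\<rho> powr a * sphere_mean (\<lambda>x. norm x powr (- a) * \<phi> x) \<rho> - \<phi> 0 =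
        (\<rho> powr a * \<rho> powr (- a)) * ((LINT x|M. indicator ?S x *\<^sub>R (\<phi> x - \<phi> 0)) + \<phi> 0 * m) / m - \<phi> 0"
      by (simp add: sphere_mean_def M_def[symmetric] mm)
    also have "\<rho> powr a * \<rho> powr (- a) = 1" using \<rho> by (simp add: powr_add[symmetric])
    also have "1 * ((LINT x|M. indicator ?S x *\<^sub>R (\<phi> x - \<phi> 0)) + \<phi> 0 * m) / m - \<phi> 0 =
        (LINT x|M. indicator ?S x *\<^sub>R (\<phi> x - \<phi> 0)) / m"
      using m by (simp add: field_simps)
    finally have "\<bar>\<rho> powr a * sphere_mean (\<lambda>x. norm x powr (- a) * \<phi> x) \<rho> - \<phi> 0\<bar> \<le> e / 2"
      using le m by (simp add: pos_divide_le_eq)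
    then show ?thesis using e by (simp add: dist_real_def)
  qed
  then show "\<forall>\<^sub>F \<rho> in at_right 0. dist (\<rho> powr a * sphere_mean (\<lambda>x. norm x powr (- a) * \<phi> x) \<rho>) (\<phi> 0) < e"
    unfolding eventually_at_right_field using d(1) by blast
qed

text \<open>The constant N(N - 2)/2 times \<omega>, the volume of the unit ball, equals a N
  \<omega>, exactly the coefficient that the cross term of the energy produces.\<close>

lemma L_functional_ground_mult:
  fixes \<phi> :: "'a::euclidean_space \<Rightarrow> real"
  assumes "continuous_on UNIV \<phi>" "DIM('a) \<ge> 3"
  shows "(L_functional (ground_mult \<phi>))\<^sup>2 =
    real DIM('a) * (real DIM('a) - 2) / 2 * measure lborel (ball (0::'a) 1) * (\<phi> 0)\<^sup>2"
proof -
  let ?a = "(real DIM('a) - 2) / 2"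
  have g: "ground_mult \<phi> = (\<lambda>x. norm x powr (- ?a) * \<phi> x)"
    by (simp add: ground_mult_def fun_eq_iff minus_divide_left)
  have "Lim (at_right 0) (\<lambda>\<rho>. \<rho> powr ?a * sphere_mean (ground_mult \<phi>) \<rho>) = \<phi> 0"
    unfolding g by (intro tendsto_Lim sphere_mean_limit assms) simp
  then show ?thesis using assms(2) by (simp add: L_functional_def power_mult_distrib)
qed

lemma grad_ground_mult:
  fixes f :: "'a::euclidean_space \<Rightarrow> real"
  assumes f: "f differentiable (at x)" and x: "x \<noteq> 0"
  defines "a \<equiv> (real DIM('a) - 2) / 2"
  shows "grad (ground_mult f) x = norm x powr (- a) *\<^sub>R grad f x - (a * norm x powr (- a - 2) * f x) *\<^sub>R x"
proof (rule grad_eqI)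
  have g: "ground_mult f = (\<lambda>x. norm x powr (- a) * f x)"
    by (simp add: ground_mult_def fun_eq_iff a_def minus_divide_left)
  have n: "norm x powr (- a - 2) = norm x powr (- a) / (norm x)\<^sup>2"
    using x by (simp add: powr_diff)
  have "((\<lambda>x. norm x powr (- a)) has_derivative
      (\<lambda>h. (norm x powr (- a)) * (0 * ln (norm x) + (h \<bullet> sgn x) * (- a) / norm x))) (at x)"
    using x by (intro has_derivative_powr has_derivative_const) (auto simp: has_derivative_norm inner_commute intro: has_derivative_norm[THEN has_derivative_eq_rhs])
  then have "(ground_mult f has_derivative (\<lambda>h. norm x powr (- a) * (grad f x \<bullet> h) +
      (norm x powr (- a)) * (0 * ln (norm x) + (h \<bullet> sgn x) * (- a) / norm x) * f x)) (at x)"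
    unfolding g by (rule has_derivative_mult[OF _ has_derivative_grad[OF f]])
  then show "(ground_mult f has_derivative
      (\<lambda>h. (norm x powr (- a) *\<^sub>R grad f x - (a * norm x powr (- a - 2) * f x) *\<^sub>R x) \<bullet> h)) (at x)"
    by (rule has_derivative_eq_rhs)
       (use x in \<open>auto simp: fun_eq_iff n sgn_div_norm inner_diff_left inner_diff_right inner_commute power2_eq_square field_simps\<close>)
qed

lemma ground_mult_energy:
  fixes f :: "'a::euclidean_space \<Rightarrow> real"
  assumes f: "f differentiable (at x)" and x: "x \<noteq> 0"
  defines "a \<equiv> (real DIM('a) - 2) / 2"
  shows "(norm (grad (ground_mult f) x))\<^sup>2 =
      norm x powr (- (real DIM('a) - 2)) * (norm (grad f x))\<^sup>2
      - a * (norm x powr (- real DIM('a)) * ((2 * f x) *\<^sub>R grad f x \<bullet> x))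
      + a\<^sup>2 * (norm x powr (- real DIM('a)) * (f x)\<^sup>2)"
    and "(ground_mult f x)\<^sup>2 / (norm x)\<^sup>2 = norm x powr (- real DIM('a)) * (f x)\<^sup>2"
proof -
  define P Q where "P = norm x powr (- a)" and "Q = norm x powr (- a - 2)"
  have PP: "P * P = norm x powr (- (real DIM('a) - 2))" by (simp add: P_def powr_add[symmetric] a_def)
  have PQ: "P * Q = norm x powr (- real DIM('a))" by (simp add: P_def Q_def powr_add[symmetric] a_def)
  have r2: "(norm x)\<^sup>2 = norm x powr 2" using x by simp
  have QP: "Q * (norm x)\<^sup>2 = P" unfolding r2 P_def Q_def powr_add[symmetric] by simp
  have QQ: "Q * Q * (norm x)\<^sup>2 = norm x powr (- real DIM('a))"
    using PQ QP by (simp add: mult_ac)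
  have "(norm (grad (ground_mult f) x))\<^sup>2 = (P *\<^sub>R grad f x - (a * Q * f x) *\<^sub>R x) \<bullet> (P *\<^sub>R grad f x - (a * Q * f x) *\<^sub>R x)"
    using grad_ground_mult[OF f x] by (simp add: power2_norm_eq_inner a_def P_def Q_def)
  also have "\<dots> = (P * P) * (grad f x \<bullet> grad f x) - a * ((P * Q) * (2 * f x * (grad f x \<bullet> x))) + a\<^sup>2 * ((Q * Q * (x \<bullet> x)) * (f x)\<^sup>2)"
    by (simp add: inner_diff_left inner_diff_right inner_commute power2_eq_square algebra_simps)
  finally show "(norm (grad (ground_mult f) x))\<^sup>2 =
      norm x powr (- (real DIM('a) - 2)) * (norm (grad f x))\<^sup>2
      - a * (norm x powr (- real DIM('a)) * ((2 * f x) *\<^sub>R grad f x \<bullet> x))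
      + a\<^sup>2 * (norm x powr (- real DIM('a)) * (f x)\<^sup>2)"
    unfolding PP PQ QQ[unfolded power2_norm_eq_inner] by (simp add: power2_norm_eq_inner)
  have "(ground_mult f x)\<^sup>2 / (norm x)\<^sup>2 = P * P / (norm x)\<^sup>2 * (f x)\<^sup>2"
    by (simp add: ground_mult_def P_def a_def minus_divide_left power2_eq_square)
  moreover have "P * P / (norm x)\<^sup>2 = norm x powr (- real DIM('a))"
    using x unfolding PQ[symmetric] QP[symmetric] by simp
  ultimately show "(ground_mult f x)\<^sup>2 / (norm x)\<^sup>2 = norm x powr (- real DIM('a)) * (f x)\<^sup>2"
    by simp
qed

text \<open>It makes \<open>radial_derivative_integral\<close> available for \<phi>^2, whose
  gradient appears in the cross term.\<close>

lemma (in C1_supported) C1_supported_square: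
  "C1_supported (\<lambda>x. (\<phi> x)\<^sup>2) (\<lambda>x. (2 * \<phi> x) *\<^sub>R g x) R"
proof
  fix x
  show "((\<lambda>x. (\<phi> x)\<^sup>2) has_derivative (\<lambda>h. (2 * \<phi> x) *\<^sub>R g x \<bullet> h)) (at x)"
    using deriv[of x] by (auto intro!: derivative_eq_intros simp: algebra_simps)
qed (use R outside in \<open>auto intro!: continuous_intros cont cont_fun\<close>)

text \<open>Expanding \<open>|\<nabla>(|x|\<^bsup>-a\<^esup> \<phi>)|\<^sup>2\<close> leaves, besides the weighted energy of \<open>\<phi>\<close> and the Hardy term, the cross term
  \<open>- a |x|\<^bsup>-N\<^esup> x \<bullet> \<nabla>(\<phi>\<^sup>2)\<close>. Its integral is \<open>a N \<omega>\<^sub>N \<phi>(0)\<^sup>2\<close>, which is what \<open>L\<^sup>2\<close> removes.\<close>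

lemma H_norm0_ground_mult:
  fixes f :: "'a::euclidean_space \<Rightarrow> real"
  assumes N: "DIM('a) \<ge> 3" and f: "f \<in> test_functions \<Omega>" and \<Omega>: "bounded \<Omega>" "open \<Omega>"
  shows "H_norm0 \<Omega> (ground_mult f) = W_norm0 \<Omega> f"
proof -
  let ?N = "real DIM('a)" and ?w = "measure lborel (ball (0::'a) 1)"
  define a where "a = (?N - 2) / 2"
  obtain R where bR: "R > 0" "\<Omega> \<subseteq> ball 0 R" using \<Omega> bounded_subset_ballD[of \<Omega> 0] by auto
  interpret C1_supported f "grad f" R by (rule C1_supported_test_function[OF f bR(2,1)])
  interpret sq: C1_supported "\<lambda>x. (f x)\<^sup>2" "\<lambda>x. (2 * f x) *\<^sub>R grad f x" R by (rule C1_supported_square)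
  \<comment> \<open>Near the origin \<open>E\<close> is of order |x|^(-N), not integrable when f(0)
    is nonzero, while \<open>D1\<close> and \<open>D2\<close> are at most of order |x|^(2-N) and
    |x|^(1-N). For every cut-off \<epsilon> the Hardy term cancels \<open>E\<close> exactly, and
    dominated convergence acts on \<open>D\<close> alone.\<close>
  define E where "E x = norm x powr (- ?N) * (f x)\<^sup>2" for x
  define D1 where "D1 x = norm x powr (- (?N - 2)) * (norm (grad f x))\<^sup>2" for x
  define D2 where "D2 x = norm x powr (- ?N) * ((2 * f x) *\<^sub>R grad f x \<bullet> x)" for x
  define D where "D x = D1 x - a * D2 x" for x
  have D1: "integrable lborel D1" "integral\<^sup>L lborel D1 = (W_norm0 \<Omega> f)\<^sup>2"
    unfolding D1_def using integrable_energy[OF N] W_norm0_sq(1)[OF N f \<Omega>(1)] by auto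
  have D2: "integrable lborel D2" "integral\<^sup>L lborel D2 = - ?N * ?w * (f 0)\<^sup>2"
    unfolding D2_def using sq.radial_derivative_integral by (auto simp: has_bochner_integral_iff)
  have D: "integrable lborel D" "integral\<^sup>L lborel D = (W_norm0 \<Omega> f)\<^sup>2 + a * ?N * ?w * (f 0)\<^sup>2"
    unfolding D_def using D1 D2 by auto
  have [measurable]: "D \<in> borel_measurable borel" using D(1) by simp
  have [measurable]: "E \<in> borel_measurable borel" unfolding E_def by measurable
  have [measurable]: "\<Omega> \<in> sets borel" using \<Omega> by simp
  have Dout: "D x = 0" if "x \<notin> \<Omega>" for x
    using test_functions_outside[OF f that] by (simp add: D_def D1_def D2_def)
  have diff: "(LINT x:\<Omega> - ball 0 \<epsilon>|lebesgue. (norm (grad (ground_mult f) x))\<^sup>2)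
       - ((?N - 2) / 2)\<^sup>2 * (LINT x:\<Omega> - ball 0 \<epsilon>|lebesgue. (ground_mult f x)\<^sup>2 / (norm x)\<^sup>2)
      = (LINT x|lborel. indicator (- ball 0 \<epsilon>) x * D x)" if \<epsilon>: "\<epsilon> > 0" for \<epsilon>
  proof -
    let ?I = "indicator (\<Omega> - ball 0 \<epsilon>) :: 'a \<Rightarrow> real"
    have nz: "x \<noteq> 0" if "x \<notin> ball 0 \<epsilon>" for x :: 'a using that \<epsilon> by auto
    note en = ground_mult_energy[OF test_functions_differentiable[OF f] nz]
    have "(LINT x:\<Omega> - ball 0 \<epsilon>|lebesgue. (norm (grad (ground_mult f) x))\<^sup>2) = (LINT x|lebesgue. ?I x * D x + a\<^sup>2 * (?I x * E x))"
      unfolding set_lebesgue_integral_def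
      by (intro Bochner_Integration.integral_cong)
         (auto simp: indicator_def en D_def D1_def D2_def E_def a_def)
    also have "\<dots> = (LINT x|lborel. ?I x * D x + a\<^sup>2 * (?I x * E x))"
      by (intro integral_completion) measurable
    finally have 1: "(LINT x:\<Omega> - ball 0 \<epsilon>|lebesgue. (norm (grad (ground_mult f) x))\<^sup>2) = (LINT x|lborel. ?I x * D x + a\<^sup>2 * (?I x * E x))" .
    have "(LINT x:\<Omega> - ball 0 \<epsilon>|lebesgue. (ground_mult f x)\<^sup>2 / (norm x)\<^sup>2) = (LINT x|lebesgue. ?I x * E x)"
      unfolding set_lebesgue_integral_def
      by (intro Bochner_Integration.integral_cong) (auto simp: indicator_def en E_def)
    also have "\<dots> = (LINT x|lborel. ?I x * E x)"
      by (intro integral_completion) measurable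
    finally have 2: "(LINT x:\<Omega> - ball 0 \<epsilon>|lebesgue. (ground_mult f x)\<^sup>2 / (norm x)\<^sup>2) = (LINT x|lborel. ?I x * E x)" .
    have iD: "integrable lborel (\<lambda>x. ?I x * D x)"
      by (rule Bochner_Integration.integrable_bound[OF D(1)]) (auto simp: indicator_def)
    obtain C where C: "C > 0" "\<And>x. \<bar>f x\<bar> \<le> C" using fun_bounded by blast
    have "integrable lborel (\<lambda>x::'a. (\<epsilon> powr (- ?N) * C\<^sup>2) * indicator (ball 0 R) x)"
      using emeasure_lborel_ball_finite[of "0::'a" R] by (intro integrable_mult_right integrable_real_indicator) auto
    then have iE: "integrable lborel (\<lambda>x. ?I x * E x)"
    proof (rule Bochner_Integration.integrable_bound, measurable, intro AE_I2)
      fix x :: 'a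
      show "norm (?I x * E x) \<le> norm ((\<epsilon> powr (- ?N) * C\<^sup>2) * indicator (ball 0 R) x)"
      proof (cases "x \<in> \<Omega> - ball 0 \<epsilon>")
        case True
        have "norm x powr (- ?N) \<le> \<epsilon> powr (- ?N)" using True \<epsilon> by (intro powr_mono2') auto
        moreover have "(f x)\<^sup>2 \<le> C\<^sup>2" using C by (metis abs_le_square_iff abs_of_pos)
        ultimately have "E x \<le> \<epsilon> powr (- ?N) * C\<^sup>2" unfolding E_def by (intro mult_mono) auto
        moreover have "x \<in> ball 0 R" using True bR(2) by blast
        moreover have "E x \<ge> 0" by (simp add: E_def)
        ultimately show ?thesis using True by (simp add: indicator_def)
      qed simp
    qed
    have "(LINT x|lborel. ?I x * D x + a\<^sup>2 * (?I x * E x)) = (LINT x|lborel. ?I x * D x) + a\<^sup>2 * (LINT x|lborel. ?I x * E x)"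
      using iD iE by simp
    moreover have "(LINT x|lborel. ?I x * D x) = (LINT x|lborel. indicator (- ball 0 \<epsilon>) x * D x)"
      by (intro Bochner_Integration.integral_cong) (auto simp: indicator_def Dout)
    ultimately show ?thesis unfolding 1 2 by (simp add: a_def)
  qed
  have "((\<lambda>\<epsilon>. LINT x|lborel. indicator (- ball 0 \<epsilon>) x * D x) \<longlongrightarrow> integral\<^sup>L lborel D) (at_right 0)"
  proof (rule tendsto_at_right_sequentially[where b=1])
    fix S :: "nat \<Rightarrow> real" assume S: "S \<longlonglongrightarrow> 0"
    show "(\<lambda>n. LINT x|lborel. indicator (- ball 0 (S n)) x * D x) \<longlonglongrightarrow> integral\<^sup>L lborel D"
    proof (rule integral_dominated_convergence[where w="\<lambda>x. norm (D x)"])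
      show "AE x in lborel. (\<lambda>n. indicator (- ball 0 (S n)) x * D x) \<longlonglongrightarrow> D x"
        using AE_lborel_singleton[of "0::'a"]
      proof eventually_elim
        fix x :: 'a assume "x \<noteq> 0"
        then have "\<forall>\<^sub>F n in sequentially. S n < norm x"
          using S by (intro order_tendstoD) auto
        then have "\<forall>\<^sub>F n in sequentially. indicator (- ball 0 (S n)) x * D x = D x"
          by eventually_elim auto
        then show "(\<lambda>n. indicator (- ball 0 (S n)) x * D x) \<longlonglongrightarrow> D x" by (rule tendsto_eventually)
      qed
    qed (use D in \<open>auto simp: indicator_def\<close>)
  qed simp
  moreover have "\<forall>\<^sub>F \<epsilon> in at_right 0. (LINT x:\<Omega> - ball 0 \<epsilon>|lebesgue. (norm (grad (ground_mult f) x))\<^sup>2)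
       - ((?N - 2) / 2)\<^sup>2 * (LINT x:\<Omega> - ball 0 \<epsilon>|lebesgue. (ground_mult f x)\<^sup>2 / (norm x)\<^sup>2)
      = (LINT x|lborel. indicator (- ball 0 \<epsilon>) x * D x)"
    using eventually_at_right_less[of "0::real"] by eventually_elim (rule diff)
  ultimately have "((\<lambda>\<epsilon>. (LINT x:\<Omega> - ball 0 \<epsilon>|lebesgue. (norm (grad (ground_mult f) x))\<^sup>2)
       - ((?N - 2) / 2)\<^sup>2 * (LINT x:\<Omega> - ball 0 \<epsilon>|lebesgue. (ground_mult f x)\<^sup>2 / (norm x)\<^sup>2)) \<longlongrightarrow> integral\<^sup>L lborel D) (at_right 0)"
    by (simp add: tendsto_cong)
  then have "H_norm0 \<Omega> (ground_mult f) = sqrt (integral\<^sup>L lborel D - (L_functional (ground_mult f))\<^sup>2)"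
    unfolding H_norm0_def by (subst tendsto_Lim) auto
  also have "\<dots> = sqrt ((W_norm0 \<Omega> f)\<^sup>2)"
    by (simp add: D(2) L_functional_ground_mult[OF cont_fun N] a_def)
  finally show ?thesis by (simp add: W_norm0_nonneg)
qed

section \<open>Integrals of powers\<close>

text \<open>The q-th power of the L^q norm on \<Omega>, with values in [0, \<infinity>] so that
  bounds need no prior integrability. It uses \<open>lebesgue\<close> because elements of the
  completions are only Lebesgue measurable.\<close>

definition mass :: "'a::euclidean_space set \<Rightarrow> real \<Rightarrow> ('a \<Rightarrow> real) \<Rightarrow> ennreal" where
  "mass \<Omega> q f = (\<integral>\<^sup>+x. ennreal (\<bar>f x\<bar> powr q) * indicator \<Omega> x \<partial>lebesgue)"

lemma mass_eq:
  "mass \<Omega> q f = (\<integral>\<^sup>+x. ennreal (\<bar>indicator \<Omega> x *\<^sub>R f x\<bar> powr q) \<partial>lebesgue)"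
  unfolding mass_def by (intro nn_integral_cong) (auto simp: indicator_def)

lemma mass_integrand_measurable:
  assumes "set_borel_measurable lebesgue \<Omega> f"
  shows "(\<lambda>x. ennreal (\<bar>f x\<bar> powr q) * indicator \<Omega> x) \<in> borel_measurable lebesgue"
proof -
  have "(\<lambda>x. ennreal (\<bar>indicator \<Omega> x *\<^sub>R f x\<bar> powr q)) \<in> borel_measurable lebesgue"
    using assms unfolding set_borel_measurable_def by measurable
  also have "(\<lambda>x. ennreal (\<bar>indicator \<Omega> x *\<^sub>R f x\<bar> powr q)) = (\<lambda>x. ennreal (\<bar>f x\<bar> powr q) * indicator \<Omega> x)"
    by (auto simp: fun_eq_iff indicator_def)
  finally show ?thesis .
qed

lemma mass_mono:
  assumes "q \<ge> 0" "AE x in lebesgue. x \<in> \<Omega> \<longrightarrow> \<bar>f x\<bar> \<le> \<bar>g x\<bar>"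
  shows "mass \<Omega> q f \<le> mass \<Omega> q g"
  unfolding mass_def
  by (intro nn_integral_mono_AE, use assms(2) in eventually_elim)
     (use assms(1) in \<open>auto simp: indicator_def intro!: ennreal_leI powr_mono2\<close>)

lemma mass_cong:
  assumes "q \<ge> 0" "AE x in lebesgue. x \<in> \<Omega> \<longrightarrow> f x = g x"
  shows "mass \<Omega> q f = mass \<Omega> q g"
  using assms by (intro antisym mass_mono) (auto elim!: eventually_mono)

lemma set_borel_measurable_diff:
  fixes f g :: "'a::euclidean_space \<Rightarrow> real"
  assumes "set_borel_measurable lebesgue \<Omega> f" "set_borel_measurable lebesgue \<Omega> g"
  shows "set_borel_measurable lebesgue \<Omega> (\<lambda>x. f x - g x)"
  using borel_measurable_diff[OF assms[unfolded set_borel_measurable_def]]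
  by (simp add: set_borel_measurable_def algebra_simps)

lemma mass_diff_le:
  assumes f: "set_borel_measurable lebesgue \<Omega> f" and g: "set_borel_measurable lebesgue \<Omega> g" and q: "q \<ge> 0"
  shows "mass \<Omega> q (\<lambda>x. f x - g x) \<le> ennreal (2 powr q) * (mass \<Omega> q f + mass \<Omega> q g)"
proof -
  have "mass \<Omega> q (\<lambda>x. f x - g x) \<le> (\<integral>\<^sup>+x. ennreal (2 powr q) * (ennreal (\<bar>f x\<bar> powr q) * indicator \<Omega> x +
      ennreal (\<bar>g x\<bar> powr q) * indicator \<Omega> x) \<partial>lebesgue)"
    unfolding mass_def
  proof (intro nn_integral_mono)
    fix x
    have "\<bar>f x - g x\<bar> powr q \<le> 2 powr q * (\<bar>f x\<bar> powr q + \<bar>g x\<bar> powr q)"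
      using q by (intro powr_sum_le) auto
    then show "ennreal (\<bar>f x - g x\<bar> powr q) * indicator \<Omega> x \<le> ennreal (2 powr q) * (ennreal (\<bar>f x\<bar> powr q) * indicator \<Omega> x +
      ennreal (\<bar>g x\<bar> powr q) * indicator \<Omega> x)"
      by (simp add: indicator_def ennreal_mult[symmetric] ennreal_plus[symmetric] ennreal_leI del: ennreal_plus)
  qed
  also have "\<dots> = ennreal (2 powr q) * (\<integral>\<^sup>+x. ennreal (\<bar>f x\<bar> powr q) * indicator \<Omega> x + ennreal (\<bar>g x\<bar> powr q) * indicator \<Omega> x \<partial>lebesgue)"
    by (intro nn_integral_cmult borel_measurable_add mass_integrand_measurable f g)
  also have "(\<integral>\<^sup>+x. ennreal (\<bar>f x\<bar> powr q) * indicator \<Omega> x + ennreal (\<bar>g x\<bar> powr q) * indicator \<Omega> x \<partial>lebesgue)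
     = mass \<Omega> q f + mass \<Omega> q g"
    unfolding mass_def by (intro nn_integral_add mass_integrand_measurable f g)
  finally show ?thesis .
qed

text \<open>Carries a bound to an a.e. limit; \<open>M\<close> allows the bound to hold only for a
  tail, as with Cauchy sequences.\<close>

lemma mass_Fatou:
  fixes h :: "nat \<Rightarrow> 'a::euclidean_space \<Rightarrow> real"
  assumes h: "\<And>i. set_borel_measurable lebesgue \<Omega> (h i)" and q: "q > 0"
    and lim: "AE x in lebesgue. x \<in> \<Omega> \<longrightarrow> (\<lambda>i. h i x) \<longlonglongrightarrow> f x"
    and le: "\<And>i. i \<ge> M \<Longrightarrow> mass \<Omega> q (h i) \<le> C"
  shows "mass \<Omega> q f \<le> C"
proof -
  have "mass \<Omega> q f \<le> (\<integral>\<^sup>+x. liminf (\<lambda>i. ennreal (\<bar>h (i + M) x\<bar> powr q) * indicator \<Omega> x) \<partial>lebesgue)"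
    unfolding mass_def
  proof (intro nn_integral_mono_AE, use lim in eventually_elim)
    fix x assume x: "x \<in> \<Omega> \<longrightarrow> (\<lambda>i. h i x) \<longlonglongrightarrow> f x"
    show "ennreal (\<bar>f x\<bar> powr q) * indicator \<Omega> x \<le> liminf (\<lambda>i. ennreal (\<bar>h (i + M) x\<bar> powr q) * indicator \<Omega> x)"
    proof (cases "x \<in> \<Omega>")
      case True
      then have "(\<lambda>i. h (i + M) x) \<longlonglongrightarrow> f x" using x LIMSEQ_ignore_initial_segment by blast
      then have "(\<lambda>i. ennreal (\<bar>h (i + M) x\<bar> powr q)) \<longlonglongrightarrow> ennreal (\<bar>f x\<bar> powr q)"
        using q by (intro tendsto_ennrealI tendsto_powr' tendsto_rabs tendsto_const) auto
      then have "liminf (\<lambda>i. ennreal (\<bar>h (i + M) x\<bar> powr q)) = ennreal (\<bar>f x\<bar> powr q)"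
        by (intro lim_imp_Liminf) auto
      then show ?thesis using True by simp
    qed simp
  qed
  also have "\<dots> \<le> liminf (\<lambda>i. mass \<Omega> q (h (i + M)))"
    unfolding mass_def by (intro nn_integral_liminf mass_integrand_measurable h)
  also have "\<dots> \<le> C"
    using le by (intro Liminf_le) (auto intro!: always_eventually)
  finally show ?thesis .
qed

lemma tendsto_ennreal_zeroI:
  fixes f :: "'b \<Rightarrow> ennreal"
  assumes "\<And>e. e > 0 \<Longrightarrow> \<forall>\<^sub>F n in F. f n \<le> ennreal e"
  shows "(f \<longlongrightarrow> 0) F"
proof (rule order_tendstoI)
  fix a :: ennreal assume "0 < a"
  then obtain e where e: "0 < e" "ennreal e < a"
    by (metis dense ennreal_cases ennreal_less_zero_iff infinity_ennreal_def linorder_not_less neq_top_trans order_less_imp_le top_greatest)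
  show "\<forall>\<^sub>F n in F. f n < a"
    using assms[OF e(1)] by eventually_elim (use e in \<open>auto intro: le_less_trans\<close>)
qed simp

lemma tendsto_ennreal_zeroD:
  fixes f :: "'b \<Rightarrow> ennreal"
  assumes "(f \<longlongrightarrow> 0) F" "e > 0"
  shows "\<forall>\<^sub>F n in F. f n \<le> ennreal e"
  using order_tendstoD(2)[OF assms(1), of "ennreal e"] assms(2) by (auto elim!: eventually_mono)

text \<open>If t^(p-q) >= 1/\<delta>, the last term alone suffices; otherwise t^(q-1) is at most the
  stated constant. This additive form of interpolation needs only a limit of L^1 norms and a bound
  on p-th powers.\<close>

lemma powr_interpolation:
  fixes t :: real
  assumes "1 \<le> q" "q < p" "\<delta> > 0" "t \<ge> 0"
  shows "t powr q \<le> (1 / \<delta>) powr ((q - 1) / (p - q)) * t powr 1 + \<delta> * t powr p"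
proof (cases "t = 0")
  case False
  then have t: "t > 0" using assms by simp
  show ?thesis
  proof (cases "1 / \<delta> \<le> t powr (p - q)")
    case True
    then have "1 \<le> \<delta> * t powr (p - q)" using assms by (simp add: field_simps)
    then have "1 * t powr q \<le> \<delta> * t powr (p - q) * t powr q" by (intro mult_right_mono) auto
    also have "\<dots> = \<delta> * t powr p" by (simp add: powr_add[symmetric] mult.assoc)
    finally show ?thesis by (simp add: add_increasing)
  next
    case False
    then have "(t powr (p - q)) powr ((q - 1) / (p - q)) \<le> (1 / \<delta>) powr ((q - 1) / (p - q))"
      using assms by (intro powr_mono2) auto
    then have "t powr (q - 1) \<le> (1 / \<delta>) powr ((q - 1) / (p - q))"
      using assms by (simp add: powr_powr)
    then have "t powr (q - 1) * t powr 1 \<le> (1 / \<delta>) powr ((q - 1) / (p - q)) * t powr 1"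
      by (intro mult_right_mono) auto
    moreover have "t powr (q - 1) * t powr 1 = t powr q" by (simp only: powr_add[symmetric]) simp
    moreover have "\<delta> * t powr p \<ge> 0" using assms by simp
    ultimately show ?thesis by linarith
  qed
qed (use assms in simp)

lemma mass_interpolation:
  fixes h :: "nat \<Rightarrow> 'a::euclidean_space \<Rightarrow> real"
  assumes h: "\<And>n. set_borel_measurable lebesgue \<Omega> (h n)" and L1: "(\<lambda>n. mass \<Omega> 1 (h n)) \<longlonglongrightarrow> 0"
    and q: "1 \<le> q" "q < p" and C: "\<And>n. mass \<Omega> p (h n) \<le> ennreal C"
  shows "(\<lambda>n. mass \<Omega> q (h n)) \<longlonglongrightarrow> 0"
proof (rule tendsto_ennreal_zeroI)
  fix e :: real assume e: "e > 0"
  \<comment> \<open>This keeps the bounded p-th power term below e/2 for all n; the L^1 term is then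
    small for large n.\<close>
  define \<delta> where "\<delta> = e / (2 * (\<bar>C\<bar> + 1))"
  have \<delta>: "\<delta> > 0" using e by (simp add: \<delta>_def)
  have \<delta>C: "\<delta> * \<bar>C\<bar> \<le> e / 2" using e by (simp add: \<delta>_def field_simps)
  define K where "K = (1 / \<delta>) powr ((q - 1) / (p - q))"
  have K: "K > 0" using \<delta> by (simp add: K_def)
  have le: "mass \<Omega> q (h n) \<le> ennreal K * mass \<Omega> 1 (h n) + ennreal \<delta> * mass \<Omega> p (h n)" for n
  proof -
    have "mass \<Omega> q (h n) \<le> (\<integral>\<^sup>+x. ennreal K * (ennreal (\<bar>h n x\<bar> powr 1) * indicator \<Omega> x) +
        ennreal \<delta> * (ennreal (\<bar>h n x\<bar> powr p) * indicator \<Omega> x) \<partial>lebesgue)"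
      unfolding mass_def
    proof (intro nn_integral_mono)
      fix x
      have "\<bar>h n x\<bar> powr q \<le> K * \<bar>h n x\<bar> powr 1 + \<delta> * \<bar>h n x\<bar> powr p"
        unfolding K_def by (intro powr_interpolation q \<delta>) simp
      then show "ennreal (\<bar>h n x\<bar> powr q) * indicator \<Omega> x \<le> ennreal K * (ennreal (\<bar>h n x\<bar> powr 1) * indicator \<Omega> x) +
        ennreal \<delta> * (ennreal (\<bar>h n x\<bar> powr p) * indicator \<Omega> x)"
        using K \<delta> by (simp add: indicator_def ennreal_mult[symmetric] ennreal_plus[symmetric] ennreal_leI del: ennreal_plus)
    qed
    also have "\<dots> = (\<integral>\<^sup>+x. ennreal K * (ennreal (\<bar>h n x\<bar> powr 1) * indicator \<Omega> x) \<partial>lebesgue) +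
        (\<integral>\<^sup>+x. ennreal \<delta> * (ennreal (\<bar>h n x\<bar> powr p) * indicator \<Omega> x) \<partial>lebesgue)"
      by (intro nn_integral_add borel_measurable_times_ennreal borel_measurable_const mass_integrand_measurable h)
    also have "\<dots> = ennreal K * mass \<Omega> 1 (h n) + ennreal \<delta> * mass \<Omega> p (h n)"
      unfolding mass_def by (intro arg_cong2[where f="(+)"] nn_integral_cmult mass_integrand_measurable h)
    finally show ?thesis .
  qed
  have "\<forall>\<^sub>F n in sequentially. mass \<Omega> 1 (h n) \<le> ennreal (e / (2 * K))"
    using e K by (intro tendsto_ennreal_zeroD L1) simp
  then show "\<forall>\<^sub>F n in sequentially. mass \<Omega> q (h n) \<le> ennreal e"
  proof eventually_elim
    fix n assume n: "mass \<Omega> 1 (h n) \<le> ennreal (e / (2 * K))"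
    have "mass \<Omega> q (h n) \<le> ennreal K * ennreal (e / (2 * K)) + ennreal \<delta> * ennreal \<bar>C\<bar>"
      by (intro order_trans[OF le] add_mono mult_left_mono n order_trans[OF C]) (auto intro: ennreal_leI)
    also have "\<dots> = ennreal (K * (e / (2 * K)) + \<delta> * \<bar>C\<bar>)"
      using K \<delta> e by (simp add: ennreal_mult[symmetric] ennreal_plus[symmetric] del: ennreal_plus)
    also have "\<dots> \<le> ennreal e" using K \<delta>C by (intro ennreal_leI) simp
    finally show "mass \<Omega> q (h n) \<le> ennreal e" .
  qed
qed

text \<open>The functions cut off to \<Omega> form a Cauchy sequence in L^1, so a subsequence is
  Cauchy at almost every point, and \<open>F\<close> is its pointwise limit.\<close>

lemma mass_Cauchy_AE_subseq:
  fixes h :: "nat \<Rightarrow> 'a::euclidean_space \<Rightarrow> real"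
  assumes h: "\<And>n. set_borel_measurable lebesgue \<Omega> (h n)" and fin: "\<And>n. mass \<Omega> 1 (h n) < \<infinity>"
    and C: "\<And>e. e > 0 \<Longrightarrow> \<exists>M. \<forall>m\<ge>M. \<forall>n\<ge>M. mass \<Omega> 1 (\<lambda>x. h m x - h n x) \<le> ennreal e"
  obtains r F where "strict_mono (r :: nat \<Rightarrow> nat)" "F \<in> borel_measurable lebesgue"
    "AE x in lebesgue. x \<in> \<Omega> \<longrightarrow> (\<lambda>i. h (r i) x) \<longlonglongrightarrow> F x"
proof -
  let ?u = "\<lambda>n x. indicator \<Omega> x *\<^sub>R h n x"
  have int: "integrable lebesgue (?u n)" for n
    using fin[of n] h[of n] unfolding mass_eq
    by (intro integrableI_bounded) (auto simp: set_borel_measurable_def powr_one)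
  have C': "\<exists>N. \<forall>i\<ge>N. \<forall>j\<ge>N. (LINT x|lebesgue. norm (?u i x - ?u j x)) < e" if e: "e > 0" for e
  proof -
    obtain M where M: "\<And>m n. m \<ge> M \<Longrightarrow> n \<ge> M \<Longrightarrow> mass \<Omega> 1 (\<lambda>x. h m x - h n x) \<le> ennreal (e / 2)"
      using C[of "e / 2"] e by auto
    show ?thesis
    proof (intro exI[of _ M] allI impI)
      fix i j assume ij: "M \<le> i" "M \<le> j"
      have "ennreal (LINT x|lebesgue. norm (?u i x - ?u j x)) = (\<integral>\<^sup>+x. ennreal (norm (?u i x - ?u j x)) \<partial>lebesgue)"
        by (intro nn_integral_eq_integral[symmetric] integrable_norm Bochner_Integration.integrable_diff int) auto
      also have "\<dots> = mass \<Omega> 1 (\<lambda>x. h i x - h j x)"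
        unfolding mass_eq by (intro nn_integral_cong) (auto simp: indicator_def)
      also have "\<dots> \<le> ennreal (e / 2)" by (intro M ij)
      finally have "(LINT x|lebesgue. norm (?u i x - ?u j x)) \<le> e / 2" using e by simp
      then show "(LINT x|lebesgue. norm (?u i x - ?u j x)) < e" using e by simp
    qed
  qed
  obtain r where r: "strict_mono r" "AE x in lebesgue. Cauchy (\<lambda>i. ?u (r i) x)"
    by (rule cauchy_L1_AE_cauchy_subseq[OF int C'])
  define F where "F x = lim (\<lambda>i. ?u (r i) x)" for x
  have "F \<in> borel_measurable lebesgue"
    unfolding F_def using borel_measurable_integrable[OF int] by (intro borel_measurable_lim_metric)
  moreover have "AE x in lebesgue. x \<in> \<Omega> \<longrightarrow> (\<lambda>i. h (r i) x) \<longlonglongrightarrow> F x"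
    using r(2)
  proof eventually_elim
    fix x assume "Cauchy (\<lambda>i. ?u (r i) x)"
    then have "(\<lambda>i. ?u (r i) x) \<longlonglongrightarrow> F x"
      unfolding F_def by (simp add: Cauchy_convergent convergent_LIMSEQ_iff[symmetric])
    then show "x \<in> \<Omega> \<longrightarrow> (\<lambda>i. h (r i) x) \<longlonglongrightarrow> F x" by auto
  qed
  ultimately show ?thesis using r(1) that by blast
qed

text \<open>The interface between \<open>mass\<close> and the weighted norms: pointwise domination
  on \<Omega> by a function of known mass gives membership and a norm bound. It serves both weights
  of the imbeddings, with \<open>h\<close> the transform of \<open>f\<close>, and the weight
  1.\<close>

lemma weighted_Lq_bound:
  fixes f h w :: "'a::euclidean_space \<Rightarrow> real"
  assumes f: "set_borel_measurable lebesgue \<Omega> f" and [measurable]: "w \<in> borel_measurable borel"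
    and w: "\<And>x. w x \<ge> 0" and D: "D \<ge> 0" and le: "\<And>x. x \<in> \<Omega> \<Longrightarrow> w x * \<bar>f x\<bar> powr q \<le> D * \<bar>h x\<bar> powr q"
    and h: "set_borel_measurable lebesgue \<Omega> h" and m: "mass \<Omega> q h \<le> ennreal m" "m \<ge> 0" and q: "q > 0"
  shows "f \<in> Lq_finite w \<Omega> q" and "0 \<le> Lq_norm w \<Omega> q f" and "Lq_norm w \<Omega> q f \<le> (D * m) powr (1 / q)"
proof -
  have [measurable]: "w \<in> borel_measurable lebesgue" by (intro measurable_completion) simp
  let ?g = "\<lambda>x. indicator \<Omega> x *\<^sub>R (w x * \<bar>f x\<bar> powr q)"
  have "(\<lambda>x. w x * \<bar>indicator \<Omega> x *\<^sub>R f x\<bar> powr q) \<in> borel_measurable lebesgue"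
    using f unfolding set_borel_measurable_def by measurable
  also have "(\<lambda>x. w x * \<bar>indicator \<Omega> x *\<^sub>R f x\<bar> powr q) = ?g"
    by (auto simp: fun_eq_iff indicator_def)
  finally have g: "?g \<in> borel_measurable lebesgue" .
  have "(\<integral>\<^sup>+x. ennreal (norm (?g x)) \<partial>lebesgue) \<le> (\<integral>\<^sup>+x. ennreal D * (ennreal (\<bar>h x\<bar> powr q) * indicator \<Omega> x) \<partial>lebesgue)"
    using le w D by (intro nn_integral_mono) (auto simp: indicator_def abs_mult ennreal_mult[symmetric] intro!: ennreal_leI)
  also have "\<dots> = ennreal D * mass \<Omega> q h"
    unfolding mass_def by (intro nn_integral_cmult mass_integrand_measurable h)
  also have "\<dots> \<le> ennreal D * ennreal m" by (intro mult_left_mono m) auto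
  finally have b: "(\<integral>\<^sup>+x. ennreal (norm (?g x)) \<partial>lebesgue) \<le> ennreal (D * m)"
    using D m by (simp add: ennreal_mult)
  have i: "integrable lebesgue ?g"
    using b by (intro integrableI_bounded g) (auto intro: le_less_trans)
  then show "f \<in> Lq_finite w \<Omega> q" using f by (simp add: Lq_finite_def set_integrable_def)
  have "ennreal (LINT x|lebesgue. ?g x) = (\<integral>\<^sup>+x. ennreal (?g x) \<partial>lebesgue)"
    using w by (intro nn_integral_eq_integral[symmetric] i) (auto simp: indicator_def)
  also have "\<dots> \<le> (\<integral>\<^sup>+x. ennreal (norm (?g x)) \<partial>lebesgue)"
    by (intro nn_integral_mono ennreal_leI) auto
  also note b
  finally have "(LINT x|lebesgue. ?g x) \<le> D * m" using D m by simp
  moreover have "(LINT x|lebesgue. ?g x) \<ge> 0"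
    using w by (intro Bochner_Integration.integral_nonneg) (auto simp: indicator_def)
  ultimately show "Lq_norm w \<Omega> q f \<le> (D * m) powr (1 / q)" "0 \<le> Lq_norm w \<Omega> q f"
    using q unfolding Lq_norm_def set_lebesgue_integral_def by (auto intro!: powr_mono2)
qed

lemma weighted_Lq_tendsto:
  fixes f h :: "nat \<Rightarrow> 'a::euclidean_space \<Rightarrow> real"
  assumes f: "\<And>n. set_borel_measurable lebesgue \<Omega> (f n)" and w: "w \<in> borel_measurable borel" "\<And>x. w x \<ge> 0"
    and D: "D \<ge> 0" and le: "\<And>n x. x \<in> \<Omega> \<Longrightarrow> w x * \<bar>f n x\<bar> powr q \<le> D * \<bar>h n x\<bar> powr q"
    and h: "\<And>n. set_borel_measurable lebesgue \<Omega> (h n)" and lim: "(\<lambda>n. mass \<Omega> q (h n)) \<longlonglongrightarrow> 0" and q: "q > 0"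
  shows "(\<lambda>n. Lq_norm w \<Omega> q (f n)) \<longlonglongrightarrow> 0"
proof (rule tendsto_sandwich)
  have ev: "\<forall>\<^sub>F n in sequentially. mass \<Omega> q (h n) < \<infinity>"
    using order_tendstoD(2)[OF lim, of \<infinity>] by simp
  have fin: "mass \<Omega> q (h n) \<le> ennreal (enn2real (mass \<Omega> q (h n)))" if "mass \<Omega> q (h n) < \<infinity>" for n
    using that by simp
  show "\<forall>\<^sub>F n in sequentially. 0 \<le> Lq_norm w \<Omega> q (f n)"
    by (auto simp: Lq_norm_def)
  show "\<forall>\<^sub>F n in sequentially. Lq_norm w \<Omega> q (f n) \<le> (D * enn2real (mass \<Omega> q (h n))) powr (1 / q)"
    using ev
  proof eventually_elim
    fix n assume "mass \<Omega> q (h n) < \<infinity>"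
    then show "Lq_norm w \<Omega> q (f n) \<le> (D * enn2real (mass \<Omega> q (h n))) powr (1 / q)"
      by (intro weighted_Lq_bound(3)[OF f w D le h fin _ q]) auto
  qed
  have "(\<lambda>n. enn2real (mass \<Omega> q (h n))) \<longlonglongrightarrow> 0"
    using lim by (intro tendsto_enn2real) auto
  then have "(\<lambda>n. D * enn2real (mass \<Omega> q (h n))) \<longlonglongrightarrow> D * 0" by (intro tendsto_mult tendsto_const)
  then have "(\<lambda>n. (D * enn2real (mass \<Omega> q (h n))) powr (1 / q)) \<longlonglongrightarrow> (D * 0) powr (1 / q)"
    using D q by (intro tendsto_powr' tendsto_const) auto
  then show "(\<lambda>n. (D * enn2real (mass \<Omega> q (h n))) powr (1 / q)) \<longlonglongrightarrow> 0" by simp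
qed auto

section \<open>The completions and their imbeddings\<close>

locale weighted_domain =
  fixes \<Omega> :: "'a::euclidean_space set"
  assumes dim: "DIM('a) \<ge> 3" and open_dom: "open \<Omega>" and bounded_dom: "bounded \<Omega>"
begin

abbreviation "T \<equiv> test_functions \<Omega>"
abbreviation "W \<equiv> W_norm0 \<Omega>"

definition subcritical :: "real \<Rightarrow> bool" where
  [simp]: "subcritical q \<longleftrightarrow> 1 \<le> q \<and> q < 2 * real DIM('a) / (real DIM('a) - 2)"

definition a :: real where "a = (real DIM('a) - 2) / 2"

lemma a_pos: "a > 0"
  using dim by (simp add: a_def)

lemma ground_mult_eq: "ground_mult f x = norm (x::'a) powr (- a) * f x"
  by (simp add: ground_mult_def a_def minus_divide_left)

lemma ground_mult_diff: "ground_mult (\<lambda>x. f x - g x) (x::'a) = ground_mult f x - ground_mult g x"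
  by (simp add: ground_mult_eq right_diff_distrib)

text \<open>One radius for all test functions, so that constants depending on it are
  uniform.\<close>

definition rad :: real where "rad = (SOME R. R > 0 \<and> \<Omega> \<subseteq> ball 0 R)"

lemma rad: "rad > 0" "\<Omega> \<subseteq> ball 0 rad"
proof -
  have "\<exists>R>0. \<Omega> \<subseteq> ball 0 R" using bounded_subset_ballD[OF bounded_dom, of 0] by auto
  then have "rad > 0 \<and> \<Omega> \<subseteq> ball 0 rad" unfolding rad_def by (rule someI_ex)
  then show "rad > 0" "\<Omega> \<subseteq> ball 0 rad" by auto
qed

lemma C1: "f \<in> T \<Longrightarrow> C1_supported f (grad f) rad"
  by (rule C1_supported_test_function[OF _ rad(2,1)])

lemma sets_dom [measurable]: "\<Omega> \<in> sets borel" "\<Omega> \<in> sets lebesgue"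
  using open_dom by auto

lemma test_borel: "f \<in> T \<Longrightarrow> f \<in> borel_measurable borel"
  using C1_supported.measurable_fun[OF C1] by simp

lemma set_measurable_borel:
  fixes f :: "'a \<Rightarrow> real"
  assumes "f \<in> borel_measurable lebesgue"
  shows "set_borel_measurable lebesgue \<Omega> f"
  using assms unfolding set_borel_measurable_def by measurable

lemma ground_mult_measurable:
  assumes "set_borel_measurable lebesgue \<Omega> f"
  shows "set_borel_measurable lebesgue \<Omega> (ground_mult f)"
proof -
  have [measurable]: "(\<lambda>x::'a. norm x powr (- a)) \<in> borel_measurable lebesgue"
    by (intro measurable_completion) measurable
  have "(\<lambda>x. norm x powr (- a) * (indicator \<Omega> x *\<^sub>R f x)) \<in> borel_measurable lebesgue"
    using assms unfolding set_borel_measurable_def by measurable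
  then show ?thesis
    by (simp add: set_borel_measurable_def ground_mult_eq mult_ac)
qed

lemma test_measurable:
  assumes "f \<in> T"
  shows "set_borel_measurable lebesgue \<Omega> f" "set_borel_measurable lebesgue \<Omega> (ground_mult f)"
proof -
  show 1: "set_borel_measurable lebesgue \<Omega> f"
    using test_borel[OF assms] by (intro set_measurable_borel measurable_completion) simp
  show "set_borel_measurable lebesgue \<Omega> (ground_mult f)" by (rule ground_mult_measurable[OF 1])
qed

lemma emeasure_dom_finite: "emeasure lebesgue \<Omega> < \<infinity>"
  using emeasure_bounded_finite[OF bounded_dom] by simp

section \<open>Uniform bounds for test functions\<close>

lemma mass_unit_ball:
  assumes q: "subcritical q"
  shows "\<exists>C>0. \<forall>f\<in>T. W f \<le> 1 \<longrightarrow> mass \<Omega> q (ground_mult f) \<le> ennreal C"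
proof -
  let ?N = "real DIM('a)"
  have N: "?N \<ge> 3" using dim by simp
  \<comment> \<open>\<open>ground_power_bound\<close> covers exponents 2 \<theta> >= 2. Smaller q
    are reached by t^q <= 1 + t^(2 \<theta>), since \<Omega> has finite measure.\<close>
  define \<theta> where "\<theta> = max 1 (q / 2)"
  have \<theta>: "\<theta> \<ge> 1" "q \<le> 2 * \<theta>" by (auto simp: \<theta>_def)
  have "q * (?N - 2) < 2 * ?N" using q N by (simp add: pos_less_divide_eq)
  then have \<theta>N: "\<theta> * (?N - 2) < ?N" using N by (simp add: \<theta>_def max_def)
  obtain C where C: "C > 0" "\<And>\<phi> (g::'a \<Rightarrow> 'a). C1_supported \<phi> g rad \<Longrightarrow>
     (\<integral>\<^sup>+y. ennreal (norm y powr (- (?N - 2)) * (norm (g y))\<^sup>2) \<partial>lborel) \<le> 1 \<Longrightarrow>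
     (\<integral>\<^sup>+x. ennreal (\<bar>norm x powr (- ((?N - 2) / 2)) * \<phi> x\<bar> powr (2 * \<theta>)) \<partial>lborel) \<le> ennreal C"
    using ground_power_bound[OF dim rad(1) \<theta>(1) \<theta>N] by blast
  define V where "V = measure lebesgue \<Omega>"
  have V: "emeasure lebesgue \<Omega> = ennreal V" "V \<ge> 0"
    using emeasure_dom_finite by (auto simp: V_def emeasure_eq_ennreal_measure)
  have "mass \<Omega> q (ground_mult f) \<le> ennreal (V + C)" if f: "f \<in> T" and W: "W f \<le> 1" for f
  proof -
    have "(W f)\<^sup>2 \<le> 1" using W W_norm0_nonneg[of \<Omega> f] by (simp add: power_le_one)
    then have "(\<integral>\<^sup>+y. ennreal (norm y powr (- (?N - 2)) * (norm (grad f y))\<^sup>2) \<partial>lborel) \<le> 1"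
      unfolding W_norm0_sq(2)[OF dim f bounded_dom, symmetric] by (simp add: ennreal_le_1)
    from C(2)[OF C1[OF f] this]
    have p: "(\<integral>\<^sup>+x. ennreal (\<bar>ground_mult f x\<bar> powr (2 * \<theta>)) \<partial>lebesgue) \<le> ennreal C"
      by (simp add: nn_integral_completion ground_mult_eq a_def)
    have m: "(\<lambda>x. ennreal (\<bar>ground_mult f x\<bar> powr (2 * \<theta>))) \<in> borel_measurable lebesgue"
      using test_borel[OF f] by (intro measurable_completion) (simp add: ground_mult_eq)
    have "mass \<Omega> q (ground_mult f) \<le> (\<integral>\<^sup>+x. indicator \<Omega> x + ennreal (\<bar>ground_mult f x\<bar> powr (2 * \<theta>)) \<partial>lebesgue)"
      unfolding mass_def
    proof (intro nn_integral_mono)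
      fix x
      let ?t = "\<bar>ground_mult f x\<bar>"
      have "?t powr q \<le> 1 + ?t powr (2 * \<theta>)"
      proof (cases "?t \<le> 1")
        case True
        then have "?t powr q \<le> 1 powr q" using q by (intro powr_mono2) auto
        then show ?thesis by (simp add: add_increasing2)
      next
        case False
        then have "?t powr q \<le> ?t powr (2 * \<theta>)" using \<theta> by (intro powr_mono) auto
        then show ?thesis by simp
      qed
      from ennreal_leI[OF this] have "ennreal (?t powr q) \<le> 1 + ennreal (?t powr (2 * \<theta>))"
        by simp
      then show "ennreal (?t powr q) * indicator \<Omega> x \<le> indicator \<Omega> x + ennreal (?t powr (2 * \<theta>))"
        by (auto simp: indicator_def)
    qed
    also have "\<dots> = emeasure lebesgue \<Omega> + (\<integral>\<^sup>+x. ennreal (\<bar>ground_mult f x\<bar> powr (2 * \<theta>)) \<partial>lebesgue)"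
      by (subst nn_integral_add) (auto simp: m)
    also have "\<dots> \<le> ennreal V + ennreal C" by (intro add_mono p) (simp add: V)
    finally show ?thesis using V C by (simp add: ennreal_plus[symmetric] del: ennreal_plus)
  qed
  then show ?thesis using C V by (intro exI[of _ "V + C"]) auto
qed

definition Cq :: "real \<Rightarrow> real" where
  "Cq q = (SOME C. C > 0 \<and> (\<forall>f\<in>T. W f \<le> 1 \<longrightarrow> mass \<Omega> q (ground_mult f) \<le> ennreal C))"

lemma Cq: "subcritical q \<Longrightarrow> Cq q > 0"
  "subcritical q \<Longrightarrow> f \<in> T \<Longrightarrow> W f \<le> 1 \<Longrightarrow> mass \<Omega> q (ground_mult f) \<le> ennreal (Cq q)"
  using someI_ex[OF mass_unit_ball[of q, unfolded Bex_def]] unfolding Cq_def by blast+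

text \<open>Homogeneity reduces the claim to the unit ball of the energy norm. Scaling is by any
  positive r >= \<open>W f\<close>, so that \<open>W f = 0\<close> causes no division by
  zero.\<close>

lemma mass_test:
  assumes q: "subcritical q" and f: "f \<in> T" and r: "W f \<le> r" "r > 0"
  shows "mass \<Omega> q (ground_mult f) \<le> ennreal (Cq q * r powr q)"
proof -
  let ?g = "\<lambda>x. (1 / r) * f x"
  have g: "?g \<in> T" using test_functions_lincomb[OF f f, of "1 / r" 0] by simp
  have "W ?g = (1 / r) * W f" using r by (intro W_norm0_scale f) simp
  then have "W ?g \<le> 1" using r by simp
  then have le: "mass \<Omega> q (ground_mult ?g) \<le> ennreal (Cq q)" by (rule Cq(2)[OF q g])
  have "mass \<Omega> q (ground_mult f) = (\<integral>\<^sup>+x. ennreal (r powr q) * (ennreal (\<bar>ground_mult ?g x\<bar> powr q) * indicator \<Omega> x) \<partial>lebesgue)"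
    unfolding mass_def
  proof (intro nn_integral_cong)
    fix x
    have "\<bar>ground_mult f x\<bar> = r * \<bar>ground_mult ?g x\<bar>" using r by (simp add: ground_mult_eq abs_mult)
    then have "\<bar>ground_mult f x\<bar> powr q = r powr q * \<bar>ground_mult ?g x\<bar> powr q" using r by (simp add: powr_mult)
    then show "ennreal (\<bar>ground_mult f x\<bar> powr q) * indicator \<Omega> x = ennreal (r powr q) * (ennreal (\<bar>ground_mult ?g x\<bar> powr q) * indicator \<Omega> x)"
      by (simp only: ennreal_mult powr_ge_zero mult.assoc)
  qed
  also have "\<dots> = ennreal (r powr q) * mass \<Omega> q (ground_mult ?g)"
    unfolding mass_def by (intro nn_integral_cmult mass_integrand_measurable test_measurable g)
  also have "\<dots> \<le> ennreal (r powr q) * ennreal (Cq q)" by (intro mult_left_mono le) auto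
  also have "\<dots> = ennreal (Cq q * r powr q)" using Cq(1)[OF q] by (simp add: ennreal_mult mult.commute)
  finally show ?thesis .
qed

lemma subcritical_1: "subcritical 1"
  using dim by (simp add: field_simps)

lemma subcritical_2: "subcritical 2"
  using dim by (simp add: field_simps)

lemma subcritical_larger:
  assumes "subcritical q"
  shows "\<exists>p. subcritical p \<and> q < p"
proof -
  obtain p where "q < p" "p < 2 * real DIM('a) / (real DIM('a) - 2)"
    using dense[of q "2 * real DIM('a) / (real DIM('a) - 2)"] assms by auto
  with assms show ?thesis by (intro exI[of _ p]) auto
qed

section \<open>From test functions to the completion\<close>

lemma represents_Cauchy:
  assumes "represents T W \<Omega> s v" "e > 0"
  obtains M where "\<And>m n. m \<ge> M \<Longrightarrow> n \<ge> M \<Longrightarrow> W (\<lambda>x. s m x - s n x) < e"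
  using assms unfolding represents_def Cauchy_wrt_def by blast

text \<open>Two limits have to be matched. The energy controls the transforms in L^1, so a
  subsequence of them converges a.e. to some F. On each set of a compact exhaustion of \<Omega>, the
  L^1 convergence of \<open>s\<close> to \<open>v\<close> gives a.e. convergence of a further
  subsequence, which identifies F with \<open>ground_mult v\<close>.\<close>

lemma represents_AE:
  assumes s: "represents T W \<Omega> s v"
  shows "set_borel_measurable lebesgue \<Omega> v"
    and "\<exists>r::nat \<Rightarrow> nat. strict_mono r \<and> (AE x in lebesgue. x \<in> \<Omega> \<longrightarrow> (\<lambda>i. ground_mult (s (r i)) x) \<longlonglongrightarrow> ground_mult v x)"
proof -
  have sT: "s k \<in> T" for k using s by (simp add: represents_def)
  have loc: "set_integrable lebesgue K (\<lambda>x. s k x - v x)" "(\<lambda>k. LINT x:K|lebesgue. \<bar>s k x - v x\<bar>) \<longlonglongrightarrow> 0"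
    if "compact K" "K \<subseteq> \<Omega>" for K k
    using s that by (auto simp: represents_def tendsto_L1_loc_def)
  obtain K where K: "\<And>n. compact (K n)" "\<And>n. K n \<subseteq> \<Omega>" "\<And>n. K n \<subseteq> interior (K (Suc n))" "\<Union>(range K) = \<Omega>"
    using open_Union_compact_subsets[OF open_dom] by metis
  have Kinc: "incseq K" using K(3) interior_subset by (intro incseq_SucI) blast
  have sb: "s k \<in> borel_measurable lebesgue" for k
    using test_borel[OF sT, of k] by (intro measurable_completion) simp
  show vm: "set_borel_measurable lebesgue \<Omega> v"
    unfolding set_borel_measurable_def
  proof (rule borel_measurable_LIMSEQ_metric)
    fix n
    have Kn: "K n \<in> sets lebesgue" using K(1) by (simp add: compact_imp_closed)
    \<comment> \<open>Representation gives measurability of \<open>s 0 - v\<close> on compact sets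
      only; \<open>v\<close> is recovered there as \<open>s 0\<close> minus this difference.\<close>
    have "(\<lambda>x. indicator (K n) x *\<^sub>R (s 0 x - v x)) \<in> borel_measurable lebesgue"
      using loc(1)[OF K(1,2)] unfolding set_integrable_def by (rule borel_measurable_integrable)
    then have "(\<lambda>x. indicator (K n) x *\<^sub>R s 0 x - indicator (K n) x *\<^sub>R (s 0 x - v x)) \<in> borel_measurable lebesgue"
      using sb[of 0] Kn by measurable
    then show "(\<lambda>x. indicator (K n) x *\<^sub>R v x) \<in> borel_measurable lebesgue"
      by (simp add: algebra_simps)
  next
    fix x
    show "(\<lambda>n. indicator (K n) x *\<^sub>R v x) \<longlonglongrightarrow> indicator \<Omega> x *\<^sub>R v x"
    proof (cases "x \<in> \<Omega>")
      case True
      then obtain m where m: "x \<in> K m" using K(4) by blast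
      have "\<forall>\<^sub>F n in sequentially. indicator (K n) x *\<^sub>R v x = indicator \<Omega> x *\<^sub>R v x"
        using eventually_ge_at_top[of m]
      proof eventually_elim
        fix n assume "m \<le> n"
        then have "x \<in> K n" using m Kinc by (auto simp: incseq_def)
        then show "indicator (K n) x *\<^sub>R v x = indicator \<Omega> x *\<^sub>R v x" using True by simp
      qed
      then show ?thesis by (rule tendsto_eventually)
    next
      case False
      then have "x \<notin> K n" for n using K(2) by blast
      then show ?thesis using False by simp
    qed
  qed
  have Cau: "\<exists>M. \<forall>m\<ge>M. \<forall>n\<ge>M. mass \<Omega> 1 (\<lambda>x. ground_mult (s m) x - ground_mult (s n) x) \<le> ennreal e" if e: "e > 0" for e
  proof -
    define \<eta> where "\<eta> = e / Cq 1"
    have \<eta>: "\<eta> > 0" using e Cq(1)[OF subcritical_1] by (simp add: \<eta>_def)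
    obtain M where M: "\<And>m n. m \<ge> M \<Longrightarrow> n \<ge> M \<Longrightarrow> W (\<lambda>x. s m x - s n x) < \<eta>"
      using represents_Cauchy[OF s \<eta>] by blast
    have "mass \<Omega> 1 (\<lambda>x. ground_mult (s m) x - ground_mult (s n) x) \<le> ennreal e" if "m \<ge> M" "n \<ge> M" for m n
    proof -
      have "mass \<Omega> 1 (ground_mult (\<lambda>x. s m x - s n x)) \<le> ennreal (Cq 1 * \<eta> powr 1)"
        using M[OF that] \<eta> by (intro mass_test subcritical_1 test_functions_diff sT) auto
      then show ?thesis using e \<eta> Cq(1)[OF subcritical_1] by (simp add: ground_mult_diff[abs_def] \<eta>_def)
    qed
    then show ?thesis by blast
  qed
  have fin: "mass \<Omega> 1 (ground_mult (s n)) < \<infinity>" for n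
    using mass_test[OF subcritical_1 sT[of n], of "W (s n) + 1"] W_norm0_nonneg[of \<Omega> "s n"]
    by (auto intro: le_less_trans simp: add_nonneg_pos)
  obtain r F where r: "strict_mono (r :: nat \<Rightarrow> nat)" and "F \<in> borel_measurable lebesgue"
    and F: "AE x in lebesgue. x \<in> \<Omega> \<longrightarrow> (\<lambda>i. ground_mult (s (r i)) x) \<longlonglongrightarrow> F x"
    by (rule mass_Cauchy_AE_subseq[of \<Omega> "\<lambda>n. ground_mult (s n)", OF test_measurable(2)[OF sT] fin Cau])
  have vF: "AE x in lebesgue. x \<in> K n \<longrightarrow> F x = ground_mult v x" for n
  proof -
    let ?u = "\<lambda>k x. indicator (K n) x *\<^sub>R (s (r k) x - v x)"
    have "(\<lambda>k. LINT x|lebesgue. norm (?u k x)) \<longlonglongrightarrow> 0"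
      using LIMSEQ_subseq_LIMSEQ[OF loc(2)[OF K(1,2)[of n]] r]
      by (simp add: set_lebesgue_integral_def o_def abs_mult)
    then obtain r' where r': "strict_mono (r' :: nat \<Rightarrow> nat)" "AE x in lebesgue. (\<lambda>k. ?u (r' k) x) \<longlonglongrightarrow> 0"
      using tendsto_L1_AE_subseq[of lebesgue ?u] loc(1)[OF K(1,2)[of n]] unfolding set_integrable_def by blast
    show ?thesis
      using r'(2) F
    proof eventually_elim
      fix x assume u: "(\<lambda>k. ?u (r' k) x) \<longlonglongrightarrow> 0" and Fx: "x \<in> \<Omega> \<longrightarrow> (\<lambda>i. ground_mult (s (r i)) x) \<longlonglongrightarrow> F x"
      show "x \<in> K n \<longrightarrow> F x = ground_mult v x"
      proof
        assume x: "x \<in> K n"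
        then have "(\<lambda>k. s (r (r' k)) x - v x) \<longlonglongrightarrow> 0" using u by simp
        then have "(\<lambda>k. s (r (r' k)) x) \<longlonglongrightarrow> v x" by (simp add: LIM_zero_iff)
        then have "(\<lambda>k. ground_mult (s (r (r' k))) x) \<longlonglongrightarrow> ground_mult v x"
          unfolding ground_mult_eq by (intro tendsto_intros)
        moreover have "(\<lambda>k. ground_mult (s (r (r' k))) x) \<longlonglongrightarrow> F x"
          using Fx x K(2) LIMSEQ_subseq_LIMSEQ[OF _ r'(1), of "\<lambda>i. ground_mult (s (r i)) x"] by (auto simp: o_def)
        ultimately show "F x = ground_mult v x" by (rule LIMSEQ_unique[rotated])
      qed
    qed
  qed
  have "AE x in lebesgue. \<forall>n. x \<in> K n \<longrightarrow> F x = ground_mult v x"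
    by (intro iffD2[OF AE_all_countable] allI vF)
  then have "AE x in lebesgue. x \<in> \<Omega> \<longrightarrow> (\<lambda>i. ground_mult (s (r i)) x) \<longlonglongrightarrow> ground_mult v x"
    using F
  proof eventually_elim
    fix x assume 1: "\<forall>n. x \<in> K n \<longrightarrow> F x = ground_mult v x" and 2: "x \<in> \<Omega> \<longrightarrow> (\<lambda>i. ground_mult (s (r i)) x) \<longlonglongrightarrow> F x"
    have "F x = ground_mult v x" if "x \<in> \<Omega>" using that K(4) 1 by blast
    then show "x \<in> \<Omega> \<longrightarrow> (\<lambda>i. ground_mult (s (r i)) x) \<longlonglongrightarrow> ground_mult v x" using 2 by simp
  qed
  then show "\<exists>r::nat \<Rightarrow> nat. strict_mono r \<and> (AE x in lebesgue. x \<in> \<Omega> \<longrightarrow> (\<lambda>i. ground_mult (s (r i)) x) \<longlonglongrightarrow> ground_mult v x)"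
    using r by blast
qed

lemma represents_tendsto:
  assumes s: "represents T W \<Omega> s v" and q: "subcritical q"
  shows "(\<lambda>k. mass \<Omega> q (\<lambda>x. ground_mult (s k) x - ground_mult v x)) \<longlonglongrightarrow> 0"
proof (rule tendsto_ennreal_zeroI)
  fix e :: real assume e: "e > 0"
  have sT: "s k \<in> T" for k using s by (simp add: represents_def)
  obtain r where r: "strict_mono (r :: nat \<Rightarrow> nat)" "AE x in lebesgue. x \<in> \<Omega> \<longrightarrow> (\<lambda>i. ground_mult (s (r i)) x) \<longlonglongrightarrow> ground_mult v x"
    using represents_AE(2)[OF s] by blast
  \<comment> \<open>Chosen so that the bound of \<open>mass_test\<close> at radius \<eta> is exactly
    \<open>e\<close>.\<close>
  define \<eta> where "\<eta> = (e / Cq q) powr (1 / q)"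
  have \<eta>: "\<eta> > 0" "Cq q * \<eta> powr q = e" using e Cq(1)[OF q] q by (auto simp: \<eta>_def powr_powr)
  obtain M where M: "\<And>m n. m \<ge> M \<Longrightarrow> n \<ge> M \<Longrightarrow> W (\<lambda>x. s m x - s n x) < \<eta>"
    using represents_Cauchy[OF s \<eta>(1)] by blast
  show "\<forall>\<^sub>F k in sequentially. mass \<Omega> q (\<lambda>x. ground_mult (s k) x - ground_mult v x) \<le> ennreal e"
    using eventually_ge_at_top[of M]
  proof eventually_elim
    fix k assume k: "M \<le> k"
    show "mass \<Omega> q (\<lambda>x. ground_mult (s k) x - ground_mult v x) \<le> ennreal e"
    \<comment> \<open>Here k stays fixed and i tends to infinity, so the Cauchy estimate for two
      members becomes an estimate for the distance to the limit.\<close>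
    proof (rule mass_Fatou[where h="\<lambda>i x. ground_mult (s k) x - ground_mult (s (r i)) x" and M=M])
      fix i assume "M \<le> i"
      then have "M \<le> r i" using seq_suble[OF r(1), of i] by simp
      then have "mass \<Omega> q (ground_mult (\<lambda>x. s k x - s (r i) x)) \<le> ennreal (Cq q * \<eta> powr q)"
        using M[OF k] \<eta> by (intro mass_test q test_functions_diff sT) (auto intro: less_imp_le)
      then show "mass \<Omega> q (\<lambda>x. ground_mult (s k) x - ground_mult (s (r i)) x) \<le> ennreal e"
        by (simp add: ground_mult_diff[abs_def] \<eta>)
    qed (use q r(2) set_borel_measurable_diff[OF test_measurable(2)[OF sT] test_measurable(2)[OF sT]]
         in \<open>auto intro!: tendsto_intros elim!: eventually_mono\<close>)
  qed
qed

text \<open>Since \<rho> exceeds the limit \<open>l\<close> strictly, a tail of the sequence has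
  energy norm below \<rho>, and Fatou's lemma carries its bound over.\<close>

lemma represents_mass_le:
  assumes s: "represents T W \<Omega> s v" and q: "subcritical q" and l: "(\<lambda>k. W (s k)) \<longlonglongrightarrow> l" "l < \<rho>" "\<rho> > 0"
  shows "mass \<Omega> q (ground_mult v) \<le> ennreal (Cq q * \<rho> powr q)"
proof -
  have sT: "s k \<in> T" for k using s by (simp add: represents_def)
  obtain r where r: "strict_mono (r :: nat \<Rightarrow> nat)" "AE x in lebesgue. x \<in> \<Omega> \<longrightarrow> (\<lambda>i. ground_mult (s (r i)) x) \<longlonglongrightarrow> ground_mult v x"
    using represents_AE(2)[OF s] by blast
  obtain M where M: "\<And>k. k \<ge> M \<Longrightarrow> W (s k) < \<rho>"
    using order_tendstoD(2)[OF l(1,2)] by (auto simp: eventually_sequentially)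
  show ?thesis
  proof (rule mass_Fatou[where h="\<lambda>i. ground_mult (s (r i))" and M=M])
    fix i assume "M \<le> i"
    then have "M \<le> r i" using seq_suble[OF r(1), of i] by simp
    then show "mass \<Omega> q (ground_mult (s (r i))) \<le> ennreal (Cq q * \<rho> powr q)"
      using M l by (intro mass_test q sT) (auto intro: less_imp_le)
  qed (use q r(2) in \<open>auto intro!: test_measurable sT\<close>)
qed

lemma represents_norm_convergent:
  assumes s: "represents T W \<Omega> s v"
  shows "\<exists>l\<ge>0. (\<lambda>k. W (s k)) \<longlonglongrightarrow> l"
proof -
  have sT: "s k \<in> T" for k using s by (simp add: represents_def)
  have tri: "W (s m) \<le> W (s n) + W (\<lambda>x. s m x - s n x)" for m n
  proof -
    have "W (\<lambda>x. s n x + 1 * (s m x - s n x)) \<le> W (s n) + W (\<lambda>x. s m x - s n x)"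
      by (intro W_norm0_lincomb_le dim sT test_functions_diff bounded_dom) auto
    then show ?thesis by simp
  qed
  have "Cauchy (\<lambda>k. W (s k))"
  proof (rule CauchyI)
    fix e :: real assume "e > 0"
    then obtain M where M: "\<And>m n. m \<ge> M \<Longrightarrow> n \<ge> M \<Longrightarrow> W (\<lambda>x. s m x - s n x) < e"
      using represents_Cauchy[OF s] by blast
    have "norm (W (s m) - W (s n)) < e" if "m \<ge> M" "n \<ge> M" for m n
      using tri[of m n] tri[of n m] M[OF that] M[OF that(2,1)] by (simp add: abs_less_iff)
    then show "\<exists>M. \<forall>m\<ge>M. \<forall>n\<ge>M. norm (W (s m) - W (s n)) < e" by blast
  qed
  then obtain l where "(\<lambda>k. W (s k)) \<longlonglongrightarrow> l" by (auto simp: Cauchy_convergent_iff convergent_def)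
  moreover from this have "l \<ge> 0" by (rule LIMSEQ_le_const) (auto intro: W_norm0_nonneg)
  ultimately show ?thesis by blast
qed

definition norm_limits :: "('a \<Rightarrow> real) \<Rightarrow> real set" where
  "norm_limits v = {l. \<exists>s. represents T W \<Omega> s v \<and> (\<lambda>k. W (s k)) \<longlonglongrightarrow> l}"

lemma norm_limits:
  assumes "v \<in> W_space \<Omega>"
  shows "norm_limits v \<noteq> {}" "\<And>l. l \<in> norm_limits v \<Longrightarrow> l \<ge> 0" "W_norm \<Omega> v = Inf (norm_limits v)" "W_norm \<Omega> v \<ge> 0"
proof -
  show ne: "norm_limits v \<noteq> {}"
    using assms represents_norm_convergent by (fastforce simp: W_space_def completion_def norm_limits_def)
  show nn: "\<And>l. l \<in> norm_limits v \<Longrightarrow> l \<ge> 0"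
    unfolding norm_limits_def by (auto intro!: LIMSEQ_le_const W_norm0_nonneg)
  show eq: "W_norm \<Omega> v = Inf (norm_limits v)"
    by (simp add: W_norm_def completion_norm_def norm_limits_def)
  show "W_norm \<Omega> v \<ge> 0" unfolding eq using ne nn by (rule cInf_greatest)
qed

text \<open>\<open>W_norm\<close> is an infimum of limits, so any \<rho> above it exceeds the limit
  for some representing sequence. Later estimates reach the norm of the completion through this
  choice.\<close>

lemma W_norm_lessE:
  assumes "v \<in> W_space \<Omega>" "W_norm \<Omega> v < \<rho>"
  obtains s l where "represents T W \<Omega> s v" "(\<lambda>k. W (s k)) \<longlonglongrightarrow> l" "l < \<rho>" "0 \<le> l"
proof -
  obtain l where "l \<in> norm_limits v" "l < \<rho>"
    using cInf_lessD[OF norm_limits(1)[OF assms(1)]] assms norm_limits(3)[OF assms(1)] by auto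
  then show ?thesis using that norm_limits(2)[OF assms(1)] unfolding norm_limits_def by blast
qed

lemma W_space_measurable: "v \<in> W_space \<Omega> \<Longrightarrow> set_borel_measurable lebesgue \<Omega> v"
  using represents_AE(1) by (auto simp: W_space_def completion_def)

lemma W_space_mass_le:
  assumes "v \<in> W_space \<Omega>" "W_norm \<Omega> v < \<rho>" "subcritical q"
  shows "mass \<Omega> q (ground_mult v) \<le> ennreal (Cq q * \<rho> powr q)"
  using W_norm_lessE[OF assms(1,2)] represents_mass_le[OF _ assms(3)] by (metis le_less_trans)

section \<open>The transform maps into H(\<Omega>)\<close>

lemma represents_ground_mult:
  assumes s: "represents T W \<Omega> s v"
  shows "represents (ground_mult ` T) (H_norm0 \<Omega>) \<Omega> (\<lambda>k. ground_mult (s k)) (ground_mult v)"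
  unfolding represents_def
proof (intro conjI allI)
  have sT: "s k \<in> T" for k using s by (simp add: represents_def)
  then show "ground_mult (s k) \<in> ground_mult ` T" for k by simp
  show "Cauchy_wrt (H_norm0 \<Omega>) (\<lambda>k. ground_mult (s k))"
    using s H_norm0_ground_mult[OF dim test_functions_diff[OF sT sT] bounded_dom open_dom]
    by (simp add: represents_def Cauchy_wrt_def ground_mult_diff[abs_def])
  \<comment> \<open>The weight may be unbounded on K, so the local convergence of \<open>s\<close>
    cannot simply be multiplied by it. The convergence of the transforms in L^1(\<Omega>), already
    proved from the energy, is used instead.\<close>
  show "tendsto_L1_loc \<Omega> (\<lambda>k. ground_mult (s k)) (ground_mult v)"
    unfolding tendsto_L1_loc_def
  proof (intro allI impI conjI)
    fix K assume K: "compact K \<and> K \<subseteq> \<Omega>"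
    let ?d = "\<lambda>k x. ground_mult (s k) x - ground_mult v x"
    have Ks: "K \<in> sets lebesgue" using K by (simp add: compact_imp_closed)
    have dm: "set_borel_measurable lebesgue \<Omega> (?d k)" for k
      by (intro set_borel_measurable_diff test_measurable sT ground_mult_measurable represents_AE[OF s])
    have iK: "(\<lambda>x. indicator K x *\<^sub>R ?d k x) = (\<lambda>x. indicator K x *\<^sub>R (indicator \<Omega> x *\<^sub>R ?d k x))" for k
      using K by (auto simp: fun_eq_iff indicator_def)
    have mK: "(\<lambda>x. indicator K x *\<^sub>R ?d k x) \<in> borel_measurable lebesgue" for k
      unfolding iK using dm[of k] Ks unfolding set_borel_measurable_def by measurable
    have le: "(\<integral>\<^sup>+x. ennreal (norm (indicator K x *\<^sub>R ?d k x)) \<partial>lebesgue) \<le> mass \<Omega> 1 (?d k)" for k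
      unfolding mass_def using K by (intro nn_integral_mono) (auto simp: indicator_def)
    have lim: "(\<lambda>k. mass \<Omega> 1 (?d k)) \<longlonglongrightarrow> 0" by (rule represents_tendsto[OF s subcritical_1])
    have fin: "mass \<Omega> 1 (?d k) < \<infinity>" for k
    proof -
      obtain l where l: "(\<lambda>k. W (s k)) \<longlonglongrightarrow> l" "l \<ge> 0" using represents_norm_convergent[OF s] by blast
      have "mass \<Omega> 1 (ground_mult v) \<le> ennreal (Cq 1 * (l + 1) powr 1)"
        using l by (intro represents_mass_le[OF s subcritical_1]) auto
      moreover have "mass \<Omega> 1 (ground_mult (s k)) \<le> ennreal (Cq 1 * (W (s k) + 1) powr 1)"
        using W_norm0_nonneg[of \<Omega> "s k"] by (intro mass_test subcritical_1 sT) auto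
      ultimately have "ennreal (2 powr 1) * (mass \<Omega> 1 (ground_mult (s k)) + mass \<Omega> 1 (ground_mult v)) < \<infinity>"
        by (auto simp: ennreal_mult_less_top intro: le_less_trans)
      then show ?thesis
        by (rule le_less_trans[OF mass_diff_le[OF test_measurable(2)[OF sT] ground_mult_measurable[OF represents_AE(1)[OF s]]], rotated]) simp
    qed
    show int: "set_integrable lebesgue K (?d k)" for k
      unfolding set_integrable_def using le[of k] fin[of k] by (intro integrableI_bounded mK) (auto intro: le_less_trans)
    show "(\<lambda>k. LINT x:K|lebesgue. \<bar>?d k x\<bar>) \<longlonglongrightarrow> 0"
    proof (rule tendsto_sandwich[OF _ _ tendsto_const])
      show "\<forall>\<^sub>F k in sequentially. 0 \<le> (LINT x:K|lebesgue. \<bar>?d k x\<bar>)"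
        by (auto simp: set_lebesgue_integral_def intro!: always_eventually Bochner_Integration.integral_nonneg)
      show "\<forall>\<^sub>F k in sequentially. (LINT x:K|lebesgue. \<bar>?d k x\<bar>) \<le> enn2real (mass \<Omega> 1 (?d k))"
      proof (intro always_eventually allI)
        fix k
        have "ennreal (LINT x:K|lebesgue. \<bar>?d k x\<bar>) = ennreal (LINT x|lebesgue. norm (indicator K x *\<^sub>R ?d k x))"
          by (simp add: set_lebesgue_integral_def abs_mult)
        also have "\<dots> = (\<integral>\<^sup>+x. ennreal (norm (indicator K x *\<^sub>R ?d k x)) \<partial>lebesgue)"
          using int[of k] unfolding set_integrable_def by (intro nn_integral_eq_integral[symmetric] integrable_norm) auto
        also have "\<dots> \<le> mass \<Omega> 1 (?d k)" by (rule le)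
        also have "\<dots> = ennreal (enn2real (mass \<Omega> 1 (?d k)))" using fin[of k] by simp
        finally show "(LINT x:K|lebesgue. \<bar>?d k x\<bar>) \<le> enn2real (mass \<Omega> 1 (?d k))" by simp
      qed
      show "(\<lambda>k. enn2real (mass \<Omega> 1 (?d k))) \<longlonglongrightarrow> 0" using lim by (intro tendsto_enn2real) auto
    qed
  qed
qed

text \<open>The isometry sends a sequence representing \<open>v\<close> to one representing its
  transform, with the same norms. Hence the infimum for the H-norm runs over at least as many
  limits.\<close>

lemma H_space_ground_mult:
  assumes v: "v \<in> W_space \<Omega>"
  shows "ground_mult v \<in> H_space \<Omega>" "H_norm \<Omega> (ground_mult v) \<le> W_norm \<Omega> v"
proof -
  show "ground_mult v \<in> H_space \<Omega>"
    using v represents_ground_mult unfolding W_space_def H_space_def completion_def by blast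
  let ?H = "{l. \<exists>s. represents (ground_mult ` T) (H_norm0 \<Omega>) \<Omega> s (ground_mult v) \<and> (\<lambda>k. H_norm0 \<Omega> (s k)) \<longlonglongrightarrow> l}"
  have sub: "norm_limits v \<subseteq> ?H"
  proof
    fix l assume "l \<in> norm_limits v"
    then obtain s where s: "represents T W \<Omega> s v" "(\<lambda>k. W (s k)) \<longlonglongrightarrow> l" unfolding norm_limits_def by blast
    have "H_norm0 \<Omega> (ground_mult (s k)) = W (s k)" for k
      using s(1) by (intro H_norm0_ground_mult dim bounded_dom open_dom) (simp add: represents_def)
    then show "l \<in> ?H" using represents_ground_mult[OF s(1)] s(2) by (auto intro!: exI[of _ "\<lambda>k. ground_mult (s k)"])
  qed
  \<comment> \<open>\<open>Inf\<close> is unspecified on sets that are not bounded below, so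
    comparing the two infima requires this.\<close>
  have "bdd_below ?H"
  proof (rule bdd_belowI[of _ 0])
    fix l assume "l \<in> ?H"
    then obtain s where s: "\<And>k. s k \<in> ground_mult ` T" "(\<lambda>k. H_norm0 \<Omega> (s k)) \<longlonglongrightarrow> l"
      by (auto simp: represents_def)
    have "H_norm0 \<Omega> (s k) \<ge> 0" for k
      using s(1)[of k] H_norm0_ground_mult[OF dim _ bounded_dom open_dom] W_norm0_nonneg by auto
    then show "0 \<le> l" using s(2) by (intro LIMSEQ_le_const) auto
  qed
  then have "Inf ?H \<le> Inf (norm_limits v)"
    using sub norm_limits(1)[OF v] by (intro cInf_superset_mono)
  then show "H_norm \<Omega> (ground_mult v) \<le> W_norm \<Omega> v"
    unfolding norm_limits(3)[OF v] H_norm_def completion_norm_def .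
qed

section \<open>Compactness of bounded sequences\<close>

lemma grad_L1_bound:
  assumes f: "f \<in> T" and B: "W f \<le> B"
  shows "(\<integral>\<^sup>+x. ennreal (norm (grad f x)) \<partial>lborel) \<le>
    ennreal (measure lborel (ball (0::'a) rad) + rad powr (real DIM('a) - 2) * B\<^sup>2)"
proof -
  let ?b = "real DIM('a) - 2" and ?V = "measure lborel (ball (0::'a) rad)"
  interpret C1_supported f "grad f" rad by (rule C1[OF f])
  have b: "?b \<ge> 0" using dim by simp
  have "(\<integral>\<^sup>+x. ennreal (norm (grad f x)) \<partial>lborel) \<le>
    (\<integral>\<^sup>+x. indicator (ball 0 rad) x + ennreal (rad powr ?b) * ennreal (norm x powr (- ?b) * (norm (grad f x))\<^sup>2) \<partial>lborel)"
  proof (intro nn_integral_mono_AE, use AE_lborel_singleton[of "0::'a"] in eventually_elim)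
    fix x :: 'a assume x: "x \<noteq> 0"
    let ?t = "norm (grad f x)"
    show "ennreal ?t \<le> indicator (ball 0 rad) x + ennreal (rad powr ?b) * ennreal (norm x powr (- ?b) * ?t\<^sup>2)"
    proof (cases "norm x < rad")
      case True
      \<comment> \<open>Inside the ball the weight |x|^(2-N) is at least rad^(2-N), so t <= 1 + t^2
        bounds the L^1 norm of the gradient by the volume of the ball plus a multiple of the
        energy.\<close>
      have "norm x powr ?b * norm x powr (- ?b) = 1" using x by (simp add: powr_add[symmetric])
      moreover have "norm x powr ?b \<le> rad powr ?b" using True b by (intro powr_mono2) auto
      ultimately have "1 \<le> rad powr ?b * norm x powr (- ?b)"
        by (metis mult_right_mono powr_ge_zero)
      then have "1 * ?t\<^sup>2 \<le> rad powr ?b * norm x powr (- ?b) * ?t\<^sup>2" by (intro mult_right_mono) auto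
      moreover have "?t \<le> 1 + ?t\<^sup>2"
      proof -
        have "0 \<le> (?t - 1 / 2)\<^sup>2" by simp
        then show ?thesis by (simp add: power2_eq_square algebra_simps)
      qed
      ultimately have "?t \<le> 1 + rad powr ?b * (norm x powr (- ?b) * ?t\<^sup>2)" by (simp add: mult.assoc)
      from ennreal_leI[OF this] show ?thesis using True by (simp add: ennreal_mult)
    qed (simp add: outside)
  qed
  also have "\<dots> = emeasure lborel (ball (0::'a) rad) + ennreal (rad powr ?b) * ennreal ((W f)\<^sup>2)"
    unfolding W_norm0_sq(2)[OF dim f bounded_dom]
    by (subst nn_integral_add) (auto simp: nn_integral_cmult)
  also have "\<dots> \<le> ennreal ?V + ennreal (rad powr ?b) * ennreal (B\<^sup>2)"
    using B W_norm0_nonneg[of \<Omega> f]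
    by (intro add_mono mult_left_mono ennreal_leI power_mono) (auto simp: emeasure_lborel_ball)
  also have "\<dots> = ennreal (?V + rad powr ?b * B\<^sup>2)"
    by (simp add: ennreal_mult[symmetric] ennreal_plus[symmetric] del: ennreal_plus)
  finally show ?thesis .
qed

text \<open>Near the origin, where \<open>|x|\<^bsup>-a\<^esup>\<close> is unbounded, the \<open>L\<^sup>2\<close> bound on \<open>|x|\<^bsup>-a\<^esup> f\<close> gives smallness in \<open>L\<^sup>1\<close>.\<close>

lemma mass_1_small:
  assumes B: "B > 0" and e: "e > 0"
  obtains \<eta> where "\<eta> > 0"
    "\<And>f. f \<in> T \<Longrightarrow> W f \<le> B \<Longrightarrow> (\<integral>\<^sup>+x. ennreal \<bar>f x\<bar> \<partial>lborel) \<le> ennreal \<eta> \<Longrightarrow> mass \<Omega> 1 (ground_mult f) \<le> ennreal e"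
proof -
  let ?w = "measure lborel (ball (0::'a) 1)"
  define C where "C = Cq 2 * B powr 2"
  have C: "C > 0" using B Cq(1)[OF subcritical_2] by (simp add: C_def)
  \<comment> \<open>The bound \<open>e\<close> is shared in thirds: \<kappa> C for the quadratic
    term, m/\<kappa> for the small ball, \<delta>^(-a) \<eta> for the rest. Hence the order of
    choice \<kappa>, \<delta>, \<eta>.\<close>
  define \<kappa> where "\<kappa> = e / (3 * C)"
  have \<kappa>: "\<kappa> > 0" "\<kappa> * C = e / 3" using C e by (auto simp: \<kappa>_def)
  \<comment> \<open>The bound by 1 allows \<delta>^N to be replaced by \<delta> in the volume of the
    small ball.\<close>
  define \<delta> where "\<delta> = min 1 (e * \<kappa> / (3 * (?w + 1)))"
  have \<delta>: "\<delta> > 0" "\<delta> \<le> 1" using e \<kappa> by (auto simp: \<delta>_def add_nonneg_pos)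
  define m where "m = measure lborel (ball (0::'a) \<delta>)"
  have m: "m \<ge> 0" "1 / \<kappa> * m \<le> e / 3"
  proof -
    show "m \<ge> 0" by (simp add: m_def)
    have "m = \<delta> ^ DIM('a) * ?w" using content_ball_conv_unit_ball[of \<delta> "0::'a"] \<delta> by (simp add: m_def)
    also have "\<dots> \<le> \<delta> ^ 1 * ?w"
      using \<delta> dim by (intro mult_right_mono power_decreasing) auto
    also have "\<dots> \<le> \<delta> * (?w + 1)" using \<delta> by (simp add: mult_left_mono)
    also have "\<dots> \<le> e * \<kappa> / (3 * (?w + 1)) * (?w + 1)"
      by (intro mult_right_mono) (auto simp: \<delta>_def)
    also have "\<dots> = e * \<kappa> / 3"
    proof -
      have "?w + 1 \<noteq> 0" by (smt (verit) measure_nonneg)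
      then show ?thesis by (simp add: field_simps)
    qed
    finally show "1 / \<kappa> * m \<le> e / 3" using \<kappa> by (simp add: field_simps)
  qed
  define \<eta> where "\<eta> = e / 3 * \<delta> powr a"
  have \<eta>: "\<eta> > 0" "\<delta> powr (- a) * \<eta> = e / 3" using e \<delta> by (auto simp: \<eta>_def powr_minus field_simps)
  show ?thesis
  proof (rule that[OF \<eta>(1)])
    fix f assume f: "f \<in> T" and W: "W f \<le> B" and L1: "(\<integral>\<^sup>+x. ennreal \<bar>f x\<bar> \<partial>lborel) \<le> ennreal \<eta>"
    have [measurable]: "f \<in> borel_measurable lborel" using test_borel[OF f] by simp
    have fm[measurable]: "f \<in> borel_measurable lebesgue" by (intro measurable_completion) measurable
    have [measurable]: "ball (0::'a) \<delta> \<in> sets lebesgue" by simp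
    note [measurable] = mass_integrand_measurable[OF test_measurable(2)[OF f]]
    have "mass \<Omega> 1 (ground_mult f) \<le> (\<integral>\<^sup>+x. ennreal \<kappa> * (ennreal (\<bar>ground_mult f x\<bar> powr 2) * indicator \<Omega> x) +
       (ennreal (1 / \<kappa>) * indicator (ball 0 \<delta>) x + ennreal (\<delta> powr (- a)) * ennreal \<bar>f x\<bar>) \<partial>lebesgue)"
      unfolding mass_def
    proof (intro nn_integral_mono)
      fix x
      let ?t = "\<bar>ground_mult f x\<bar>"
      \<comment> \<open>In the small ball either t <= 1/\<kappa> or t <= \<kappa> t^2; outside it
        the weight is at most \<delta>^(-a).\<close>
      have "?t \<le> \<kappa> * ?t powr 2 + (1 / \<kappa> * indicator (ball 0 \<delta>) x + \<delta> powr (- a) * \<bar>f x\<bar>)"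
      proof (cases "x \<in> ball 0 \<delta>")
        case True
        have "?t \<le> \<kappa> * ?t\<^sup>2 + 1 / \<kappa>"
        proof (cases "?t \<le> 1 / \<kappa>")
          case False
          then have "1 \<le> \<kappa> * ?t" using \<kappa> by (simp add: field_simps)
          then have "1 * ?t \<le> \<kappa> * ?t * ?t" by (intro mult_right_mono) auto
          then show ?thesis using \<kappa> by (simp add: power2_eq_square add_increasing2)
        qed (use \<kappa> in \<open>simp add: add_increasing\<close>)
        moreover have "\<delta> powr (- a) * \<bar>f x\<bar> \<ge> 0" by simp
        ultimately have "?t \<le> \<kappa> * ?t\<^sup>2 + (1 / \<kappa> + \<delta> powr (- a) * \<bar>f x\<bar>)" by linarith
        then show ?thesis using True by simp
      next
        case False
        then have "norm x powr (- a) \<le> \<delta> powr (- a)" using \<delta> a_pos by (intro powr_mono2') auto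
        then have "?t \<le> \<delta> powr (- a) * \<bar>f x\<bar>" by (simp add: ground_mult_eq abs_mult mult_right_mono)
        moreover have "\<kappa> * ?t powr 2 \<ge> 0" using \<kappa> by simp
        ultimately show ?thesis using False by simp
      qed
      from ennreal_leI[OF this]
      have "ennreal ?t \<le> ennreal \<kappa> * ennreal (?t powr 2) + (ennreal (1 / \<kappa>) * indicator (ball 0 \<delta>) x + ennreal (\<delta> powr (- a)) * ennreal \<bar>f x\<bar>)"
        using \<kappa> by (cases "x \<in> ball 0 \<delta>") (simp_all add: ennreal_mult)
      then show "ennreal (?t powr 1) * indicator \<Omega> x \<le> ennreal \<kappa> * (ennreal (?t powr 2) * indicator \<Omega> x) +
         (ennreal (1 / \<kappa>) * indicator (ball 0 \<delta>) x + ennreal (\<delta> powr (- a)) * ennreal \<bar>f x\<bar>)"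
        by (cases "x \<in> \<Omega>") auto
    qed
    also have "\<dots> = (\<integral>\<^sup>+x. ennreal \<kappa> * (ennreal (\<bar>ground_mult f x\<bar> powr 2) * indicator \<Omega> x) \<partial>lebesgue) +
       (\<integral>\<^sup>+x. ennreal (1 / \<kappa>) * indicator (ball 0 \<delta>) x + ennreal (\<delta> powr (- a)) * ennreal \<bar>f x\<bar> \<partial>lebesgue)"
      by (intro nn_integral_add) measurable
    also have "(\<integral>\<^sup>+x. ennreal \<kappa> * (ennreal (\<bar>ground_mult f x\<bar> powr 2) * indicator \<Omega> x) \<partial>lebesgue) = ennreal \<kappa> * mass \<Omega> 2 (ground_mult f)"
      unfolding mass_def by (intro nn_integral_cmult) measurable
    also have "(\<integral>\<^sup>+x. ennreal (1 / \<kappa>) * indicator (ball 0 \<delta>) x + ennreal (\<delta> powr (- a)) * ennreal \<bar>f x\<bar> \<partial>lebesgue) =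
       (\<integral>\<^sup>+x. ennreal (1 / \<kappa>) * indicator (ball (0::'a) \<delta>) x \<partial>lborel) + (\<integral>\<^sup>+x. ennreal (\<delta> powr (- a)) * ennreal \<bar>f x\<bar> \<partial>lborel)"
      unfolding nn_integral_completion by (intro nn_integral_add) measurable
    also have "(\<integral>\<^sup>+x. ennreal (1 / \<kappa>) * indicator (ball (0::'a) \<delta>) x \<partial>lborel) = ennreal (1 / \<kappa>) * ennreal m"
      by (subst nn_integral_cmult_indicator) (auto simp: m_def emeasure_lborel_ball)
    also have "(\<integral>\<^sup>+x. ennreal (\<delta> powr (- a)) * ennreal \<bar>f x\<bar> \<partial>lborel) = ennreal (\<delta> powr (- a)) * (\<integral>\<^sup>+x. ennreal \<bar>f x\<bar> \<partial>lborel)"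
      by (intro nn_integral_cmult) measurable
    also have "ennreal \<kappa> * mass \<Omega> 2 (ground_mult f) + (ennreal (1 / \<kappa>) * ennreal m + ennreal (\<delta> powr (- a)) * (\<integral>\<^sup>+x. ennreal \<bar>f x\<bar> \<partial>lborel))
      \<le> ennreal \<kappa> * ennreal C + (ennreal (1 / \<kappa>) * ennreal m + ennreal (\<delta> powr (- a)) * ennreal \<eta>)"
      using mass_test[OF subcritical_2 f W B] by (intro add_mono mult_left_mono L1) (auto simp: C_def)
    also have "\<dots> = ennreal (\<kappa> * C + (1 / \<kappa> * m + \<delta> powr (- a) * \<eta>))"
      using \<kappa> C m \<eta> by (simp add: ennreal_mult[symmetric] ennreal_plus[symmetric] del: ennreal_plus)
    also have "\<dots> \<le> ennreal e" using \<kappa> m \<eta> by (intro ennreal_leI) linarith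
    finally show "mass \<Omega> 1 (ground_mult f) \<le> ennreal e" .
  qed
qed

text \<open>Each \<open>v n\<close> is replaced by a test function whose transform is within 1/(n +
  1) in L^1. Rellich's theorem applies to these test functions, and \<open>mass_1_small\<close>,
  used on their differences of energy norm at most 2 B, transfers L^1 convergence to the transforms.
  One subsequence and one limit serve every subcritical q; the test functions are returned because
  membership in \<open>Lq_closure\<close> needs approximants.\<close>

lemma W_space_compact:
  assumes v: "bounded_seq_in (W_space \<Omega>) (W_norm \<Omega>) v"
  shows "\<exists>r F f. strict_mono (r :: nat \<Rightarrow> nat) \<and> F \<in> borel_measurable lebesgue \<and> (\<forall>n. f n \<in> T) \<and>
    (\<forall>q. subcritical q \<longrightarrow> mass \<Omega> q F < \<infinity> \<and>
      (\<lambda>n. mass \<Omega> q (\<lambda>x. ground_mult (v (r n)) x - F x)) \<longlonglongrightarrow> 0 \<and>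
      (\<lambda>n. mass \<Omega> q (\<lambda>x. ground_mult (f n) x - F x)) \<longlonglongrightarrow> 0)"
proof -
  have vW: "v n \<in> W_space \<Omega>" for n using v by (simp add: bounded_seq_in_def)
  obtain B0 where B0: "\<And>n. W_norm \<Omega> (v n) \<le> B0" using v by (auto simp: bounded_seq_in_def)
  define B where "B = \<bar>B0\<bar> + 1"
  have B: "B > 0" "W_norm \<Omega> (v n) < B" for n using B0[of n] by (auto simp: B_def)
  have "\<exists>f\<in>T. W f < B \<and> mass \<Omega> 1 (\<lambda>x. ground_mult f x - ground_mult (v n) x) \<le> ennreal (inverse (real (Suc n)))" for n
  proof -
    obtain s l where s: "represents T W \<Omega> s (v n)" "(\<lambda>k. W (s k)) \<longlonglongrightarrow> l" "l < B"
      using W_norm_lessE[OF vW B(2)] by blast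
    have "\<forall>\<^sub>F k in sequentially. W (s k) < B \<and> mass \<Omega> 1 (\<lambda>x. ground_mult (s k) x - ground_mult (v n) x) \<le> ennreal (inverse (real (Suc n)))"
      using order_tendstoD(2)[OF s(2,3)] tendsto_ennreal_zeroD[OF represents_tendsto[OF s(1) subcritical_1], of "inverse (real (Suc n))"]
      by (intro eventually_conj) auto
    then obtain k where "W (s k) < B" "mass \<Omega> 1 (\<lambda>x. ground_mult (s k) x - ground_mult (v n) x) \<le> ennreal (inverse (real (Suc n)))"
      by (auto dest!: eventually_happens)
    then show ?thesis using s(1) by (auto simp: represents_def)
  qed
  then obtain g where g: "\<And>n. g n \<in> T" "\<And>n. W (g n) < B"
    "\<And>n. mass \<Omega> 1 (\<lambda>x. ground_mult (g n) x - ground_mult (v n) x) \<le> ennreal (inverse (real (Suc n)))"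
    by metis
  obtain r where r: "strict_mono (r :: nat \<Rightarrow> nat)"
    "\<And>e. e > 0 \<Longrightarrow> \<exists>M. \<forall>m\<ge>M. \<forall>n\<ge>M. (\<integral>\<^sup>+x. ennreal \<bar>g (r m) x - g (r n) x\<bar> \<partial>lborel) \<le> ennreal e"
    using Rellich_L1[OF C1[OF g(1)] grad_L1_bound[OF g(1) less_imp_le[OF g(2)]]] by force
  define f where "f n = g (r n)" for n
  have fT: "f n \<in> T" and fW: "W (f n) < B" for n using g by (auto simp: f_def)
  have fm: "set_borel_measurable lebesgue \<Omega> (ground_mult (f n))" for n by (rule test_measurable(2)[OF fT])
  have vm: "set_borel_measurable lebesgue \<Omega> (ground_mult (v n))" for n
    by (rule ground_mult_measurable[OF W_space_measurable[OF vW]])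
  have fmass: "mass \<Omega> q (ground_mult (f n)) \<le> ennreal (Cq q * B powr q)" if "subcritical q" for q n
    by (rule mass_test[OF that fT less_imp_le[OF fW] B(1)])
  have vmass: "mass \<Omega> q (ground_mult (v n)) \<le> ennreal (Cq q * B powr q)" if "subcritical q" for q n
    by (rule W_space_mass_le[OF vW B(2) that])
  have Cau: "\<exists>M. \<forall>m\<ge>M. \<forall>n\<ge>M. mass \<Omega> 1 (\<lambda>x. ground_mult (f m) x - ground_mult (f n) x) \<le> ennreal e" if e: "e > 0" for e
  proof -
    have "2 * B > 0" using B by simp
    then obtain \<eta> where \<eta>: "\<eta> > 0"
      "\<And>f. f \<in> T \<Longrightarrow> W f \<le> 2 * B \<Longrightarrow> (\<integral>\<^sup>+x. ennreal \<bar>f x\<bar> \<partial>lborel) \<le> ennreal \<eta> \<Longrightarrow> mass \<Omega> 1 (ground_mult f) \<le> ennreal e"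
      using mass_1_small[OF _ e] by blast
    obtain M where M: "\<And>m n. m \<ge> M \<Longrightarrow> n \<ge> M \<Longrightarrow> (\<integral>\<^sup>+x. ennreal \<bar>f m x - f n x\<bar> \<partial>lborel) \<le> ennreal \<eta>"
      using r(2)[OF \<eta>(1)] unfolding f_def by blast
    have "mass \<Omega> 1 (\<lambda>x. ground_mult (f m) x - ground_mult (f n) x) \<le> ennreal e" if "m \<ge> M" "n \<ge> M" for m n
    proof -
      have "W (\<lambda>x. f m x + - 1 * f n x) \<le> W (f m) + W (f n)"
        by (intro W_norm0_lincomb_le dim fT bounded_dom) simp
      then have "W (\<lambda>x. f m x - f n x) \<le> 2 * B" using fW[of m] fW[of n] by simp
      then have "mass \<Omega> 1 (ground_mult (\<lambda>x. f m x - f n x)) \<le> ennreal e"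
        by (intro \<eta> test_functions_diff fT M that)
      then show ?thesis by (simp add: ground_mult_diff[abs_def])
    qed
    then show ?thesis by blast
  qed
  have fin: "mass \<Omega> 1 (ground_mult (f n)) < \<infinity>" for n
    using fmass[OF subcritical_1, of n] by (auto intro: le_less_trans)
  \<comment> \<open>This further subsequence only produces the limit F. The whole sequence f then
    converges to F, by the Cauchy property and Fatou's lemma.\<close>
  obtain r' F where r': "strict_mono (r' :: nat \<Rightarrow> nat)" and Fm: "F \<in> borel_measurable lebesgue"
    and F: "AE x in lebesgue. x \<in> \<Omega> \<longrightarrow> (\<lambda>i. ground_mult (f (r' i)) x) \<longlonglongrightarrow> F x"
    by (rule mass_Cauchy_AE_subseq[of \<Omega> "\<lambda>n. ground_mult (f n)", OF fm fin Cau])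
  have Fs: "set_borel_measurable lebesgue \<Omega> F" by (rule set_measurable_borel[OF Fm])
  have Fmass: "mass \<Omega> q F \<le> ennreal (Cq q * B powr q)" if q: "subcritical q" for q
    by (rule mass_Fatou[where h="\<lambda>i. ground_mult (f (r' i))" and M=0]) (use fmass q fm F in auto)
  have f1: "(\<lambda>n. mass \<Omega> 1 (\<lambda>x. ground_mult (f n) x - F x)) \<longlonglongrightarrow> 0"
  proof (rule tendsto_ennreal_zeroI)
    fix e :: real assume "e > 0"
    then obtain M where M: "\<And>m n. m \<ge> M \<Longrightarrow> n \<ge> M \<Longrightarrow> mass \<Omega> 1 (\<lambda>x. ground_mult (f m) x - ground_mult (f n) x) \<le> ennreal e"
      using Cau by blast
    show "\<forall>\<^sub>F n in sequentially. mass \<Omega> 1 (\<lambda>x. ground_mult (f n) x - F x) \<le> ennreal e"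
      using eventually_ge_at_top[of M]
    proof eventually_elim
      fix n assume n: "M \<le> n"
      show "mass \<Omega> 1 (\<lambda>x. ground_mult (f n) x - F x) \<le> ennreal e"
      proof (rule mass_Fatou[where h="\<lambda>i x. ground_mult (f n) x - ground_mult (f (r' i)) x" and M=M])
        fix i assume "M \<le> i"
        then have "M \<le> r' i" using seq_suble[OF r', of i] by simp
        then show "mass \<Omega> 1 (\<lambda>x. ground_mult (f n) x - ground_mult (f (r' i)) x) \<le> ennreal e" by (rule M[OF n])
      qed (use F set_borel_measurable_diff[OF fm fm] in \<open>auto intro!: tendsto_intros elim!: eventually_mono\<close>)
    qed
  qed
  have v1: "(\<lambda>n. mass \<Omega> 1 (\<lambda>x. ground_mult (v (r n)) x - F x)) \<longlonglongrightarrow> 0"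
  proof (rule tendsto_sandwich[OF _ _ tendsto_const])
    have 1: "(\<lambda>n. mass \<Omega> 1 (\<lambda>x. ground_mult (f n) x - ground_mult (v (r n)) x)) \<longlonglongrightarrow> 0"
    proof (rule tendsto_sandwich[OF _ _ tendsto_const])
      have "(\<lambda>n. ennreal (inverse (real (Suc n)))) \<longlonglongrightarrow> ennreal 0"
        by (intro tendsto_ennrealI LIMSEQ_inverse_real_of_nat)
      then show "(\<lambda>n. ennreal (inverse (real (Suc (r n))))) \<longlonglongrightarrow> 0"
        using LIMSEQ_subseq_LIMSEQ[OF _ r(1)] by (fastforce simp: o_def)
    qed (use g(3) in \<open>auto simp: f_def intro!: always_eventually\<close>)
    have "(\<lambda>n. ennreal (2 powr 1) * (mass \<Omega> 1 (\<lambda>x. ground_mult (f n) x - F x) + mass \<Omega> 1 (\<lambda>x. ground_mult (f n) x - ground_mult (v (r n)) x)))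
       \<longlonglongrightarrow> ennreal (2 powr 1) * (0 + 0)"
      by (intro ennreal_tendsto_cmult tendsto_add f1 1) simp
    then show "(\<lambda>n. ennreal (2 powr 1) * (mass \<Omega> 1 (\<lambda>x. ground_mult (f n) x - F x) + mass \<Omega> 1 (\<lambda>x. ground_mult (f n) x - ground_mult (v (r n)) x)))
       \<longlonglongrightarrow> 0" by simp
    show "\<forall>\<^sub>F n in sequentially. mass \<Omega> 1 (\<lambda>x. ground_mult (v (r n)) x - F x) \<le>
       ennreal (2 powr 1) * (mass \<Omega> 1 (\<lambda>x. ground_mult (f n) x - F x) + mass \<Omega> 1 (\<lambda>x. ground_mult (f n) x - ground_mult (v (r n)) x))"
    proof (intro always_eventually allI)
      fix n
      show "mass \<Omega> 1 (\<lambda>x. ground_mult (v (r n)) x - F x) \<le>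
       ennreal (2 powr 1) * (mass \<Omega> 1 (\<lambda>x. ground_mult (f n) x - F x) + mass \<Omega> 1 (\<lambda>x. ground_mult (f n) x - ground_mult (v (r n)) x))"
        \<comment> \<open>Both differences contain the same f n, which cancels on
          subtraction.\<close>
        using mass_diff_le[OF set_borel_measurable_diff[OF fm Fs] set_borel_measurable_diff[OF fm vm], of 1 n n "r n"] by simp
    qed
  qed simp
  have bound: "mass \<Omega> p (\<lambda>x. h x - F x) \<le> ennreal (2 powr p * (Cq p * B powr p + Cq p * B powr p))"
    if p: "subcritical p" and h: "set_borel_measurable lebesgue \<Omega> h" "mass \<Omega> p h \<le> ennreal (Cq p * B powr p)" for p h
  proof -
    have "mass \<Omega> p (\<lambda>x. h x - F x) \<le> ennreal (2 powr p) * (mass \<Omega> p h + mass \<Omega> p F)"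
      using p by (intro mass_diff_le h Fs) simp
    also have "\<dots> \<le> ennreal (2 powr p) * (ennreal (Cq p * B powr p) + ennreal (Cq p * B powr p))"
      by (intro mult_left_mono add_mono h Fmass p) simp
    also have "\<dots> = ennreal (2 powr p * (Cq p * B powr p + Cq p * B powr p))"
      using Cq(1)[OF p] by (simp add: ennreal_mult[symmetric] ennreal_plus[symmetric] del: ennreal_plus)
    finally show ?thesis .
  qed
  show ?thesis
  proof (intro exI[of _ r] exI[of _ F] exI[of _ f] conjI allI impI r(1) Fm fT)
    fix q assume q: "subcritical q"
    \<comment> \<open>The strict inequality q < 2N/(N - 2) leaves room for a larger subcritical p,
      whose uniform bound drives the interpolation.\<close>
    obtain p where p: "subcritical p" "q < p" using subcritical_larger[OF q] by blast
    show "mass \<Omega> q F < \<infinity>" using Fmass[OF q] by (auto intro: le_less_trans)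
    show "(\<lambda>n. mass \<Omega> q (\<lambda>x. ground_mult (v (r n)) x - F x)) \<longlonglongrightarrow> 0"
      using q by (intro mass_interpolation[OF set_borel_measurable_diff[OF vm Fs] v1 _ p(2) bound[OF p(1) vm vmass[OF p(1)]]]) simp
    show "(\<lambda>n. mass \<Omega> q (\<lambda>x. ground_mult (f n) x - F x)) \<longlonglongrightarrow> 0"
      using q by (intro mass_interpolation[OF set_borel_measurable_diff[OF fm Fs] f1 _ p(2) bound[OF p(1) fm fmass[OF p(1)]]]) simp
  qed
qed

section \<open>The weighted imbeddings\<close>

lemma mass_lift:
  assumes "q \<ge> 0"
  shows "mass \<Omega> q (\<lambda>x. G x - ground_mult (\<lambda>x. norm x powr a * F x) x) = mass \<Omega> q (\<lambda>x. G x - F x)"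
    and "mass \<Omega> q (ground_mult (\<lambda>x. norm x powr a * F x)) = mass \<Omega> q F"
proof -
  have AE0: "AE x in lebesgue. (x::'a) \<noteq> 0" by (intro AE_completion AE_lborel_singleton)
  \<comment> \<open>Off the origin, a null set, |x|^a undoes \<open>ground_mult\<close>; a limit F
    of transforms thus comes from |x|^a F.\<close>
  have eq: "ground_mult (\<lambda>x. norm x powr a * F x) x = F x" if "x \<noteq> 0" for x :: 'a
    using that by (simp add: ground_mult_eq mult.assoc[symmetric] powr_add[symmetric])
  show "mass \<Omega> q (\<lambda>x. G x - ground_mult (\<lambda>x. norm x powr a * F x) x) = mass \<Omega> q (\<lambda>x. G x - F x)"
    "mass \<Omega> q (ground_mult (\<lambda>x. norm x powr a * F x)) = mass \<Omega> q F"
    using assms AE0 by (auto intro!: mass_cong elim!: eventually_mono simp: eq)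
qed

text \<open>The last hypothesis reduces a weight to the transform: the weighted norm is dominated by
  the \<open>mass\<close> of \<open>ground_mult f\<close>, for which bounds, density of test
  functions and compactness are already known.\<close>

lemma compactly_imbedded_weighted:
  fixes w :: "'a \<Rightarrow> real"
  assumes q: "subcritical q" and w: "w \<in> borel_measurable borel" "\<And>x. w x \<ge> 0" and D: "D \<ge> 0"
    and le: "\<And>f x. x \<in> \<Omega> \<Longrightarrow> w x * \<bar>f x\<bar> powr q \<le> D * \<bar>ground_mult f x\<bar> powr q"
  shows "compactly_imbedded (W_space \<Omega>) (W_norm \<Omega>) (Lq_closure w \<Omega> q) (Lq_norm w \<Omega> q)"
proof -
  have q0: "q > 0" using q by simp
  have bnd: "f \<in> Lq_finite w \<Omega> q" "Lq_norm w \<Omega> q f \<le> (D * m) powr (1 / q)"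
    if "set_borel_measurable lebesgue \<Omega> f" "mass \<Omega> q (ground_mult f) \<le> ennreal m" "m \<ge> 0" for f m
    using weighted_Lq_bound(1,3)[OF that(1) w D le ground_mult_measurable[OF that(1)] that(2,3) q0] by simp_all
  have lim: "(\<lambda>n. Lq_norm w \<Omega> q (\<lambda>x. f n x - g x)) \<longlonglongrightarrow> 0"
    if "\<And>n. set_borel_measurable lebesgue \<Omega> (f n)" "set_borel_measurable lebesgue \<Omega> g"
      "(\<lambda>n. mass \<Omega> q (\<lambda>x. ground_mult (f n) x - ground_mult g x)) \<longlonglongrightarrow> 0" for f g
    using that set_borel_measurable_diff[OF that(1,2)]
    by (intro weighted_Lq_tendsto[OF _ w D le ground_mult_measurable _ q0]) (auto simp: ground_mult_diff[abs_def])
  have T_fin: "f \<in> T \<inter> Lq_finite w \<Omega> q" if f: "f \<in> T" for f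
    using bnd(1)[OF test_measurable(1)[OF f] mass_test[OF q f, of "W f + 1"]] f
      W_norm0_nonneg[of \<Omega> f] Cq(1)[OF q] by simp
  have W_fin: "v \<in> Lq_finite w \<Omega> q" "Lq_norm w \<Omega> q v \<le> (D * (Cq q * \<rho> powr q)) powr (1 / q)"
    if v: "v \<in> W_space \<Omega>" "W_norm \<Omega> v < \<rho>" for v \<rho>
    using bnd[OF W_space_measurable[OF v(1)] W_space_mass_le[OF v q]]
      Cq(1)[OF q] by simp_all
  show ?thesis
    unfolding compactly_imbedded_def
  proof (intro conjI subsetI allI impI)
    fix v assume v: "v \<in> W_space \<Omega>"
    obtain s where s: "represents T W \<Omega> s v" using v by (auto simp: W_space_def completion_def)
    have sT: "s k \<in> T" for k using s by (simp add: represents_def)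
    have "(\<lambda>k. Lq_norm w \<Omega> q (\<lambda>x. s k x - v x)) \<longlonglongrightarrow> 0"
      by (intro lim test_measurable sT W_space_measurable[OF v] represents_tendsto[OF s q])
    then show "v \<in> Lq_closure w \<Omega> q"
      using W_fin(1)[OF v, of "W_norm \<Omega> v + 1"] T_fin[OF sT] by (auto simp: Lq_closure_def)
  next
    define C where "C = (D * Cq q) powr (1 / q)"
    have C: "C \<ge> 0" by (simp add: C_def)
    have "Lq_norm w \<Omega> q v \<le> C * W_norm \<Omega> v" if v: "v \<in> W_space \<Omega>" for v
    proof (rule field_le_epsilon)
      fix e :: real assume e: "e > 0"
      \<comment> \<open>The bound is available only for \<rho> strictly above the norm. This slack
        costs at most \<open>e\<close> after multiplication by \<open>C\<close>, also when
        \<open>C = 0\<close>.\<close>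
      define \<rho> where "\<rho> = W_norm \<Omega> v + e / (C + 1)"
      have \<rho>: "W_norm \<Omega> v < \<rho>" using e C by (simp add: \<rho>_def add_nonneg_pos)
      have "Lq_norm w \<Omega> q v \<le> (D * (Cq q * \<rho> powr q)) powr (1 / q)" by (rule W_fin(2)[OF v \<rho>])
      also have "\<dots> = C * \<rho>"
        using D Cq(1)[OF q] q0 \<rho> norm_limits(4)[OF v]
        by (simp add: C_def powr_mult powr_powr mult.assoc[symmetric])
      also have "\<dots> = C * W_norm \<Omega> v + e * (C / (C + 1))" by (simp add: \<rho>_def algebra_simps)
      also have "\<dots> \<le> C * W_norm \<Omega> v + e"
      proof -
        have "C / (C + 1) \<le> 1" using C by simp
        from mult_left_mono[OF this, of e] show ?thesis using e by simp
      qed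
      finally show "Lq_norm w \<Omega> q v \<le> C * W_norm \<Omega> v + e" .
    qed
    then show "\<exists>C. \<forall>v\<in>W_space \<Omega>. Lq_norm w \<Omega> q v \<le> C * W_norm \<Omega> v" by blast
  next
    fix v assume v: "bounded_seq_in (W_space \<Omega>) (W_norm \<Omega>) v"
    then have vW: "v n \<in> W_space \<Omega>" for n by (simp add: bounded_seq_in_def)
    obtain r F f where r: "strict_mono (r :: nat \<Rightarrow> nat)" and F: "F \<in> borel_measurable lebesgue" and f: "\<And>n. f n \<in> T"
      and "\<forall>q. subcritical q \<longrightarrow> mass \<Omega> q F < \<infinity> \<and>
        (\<lambda>n. mass \<Omega> q (\<lambda>x. ground_mult (v (r n)) x - F x)) \<longlonglongrightarrow> 0 \<and>
        (\<lambda>n. mass \<Omega> q (\<lambda>x. ground_mult (f n) x - F x)) \<longlonglongrightarrow> 0"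
      using W_space_compact[OF v] by blast
    then have Ffin: "mass \<Omega> q F < \<infinity>" and vF: "(\<lambda>n. mass \<Omega> q (\<lambda>x. ground_mult (v (r n)) x - F x)) \<longlonglongrightarrow> 0"
      and fF: "(\<lambda>n. mass \<Omega> q (\<lambda>x. ground_mult (f n) x - F x)) \<longlonglongrightarrow> 0"
      using q by blast+
    define u where "u x = norm x powr a * F x" for x
    have "(\<lambda>x::'a. norm x powr a) \<in> borel_measurable lebesgue" by (intro measurable_completion) measurable
    with F have um: "set_borel_measurable lebesgue \<Omega> u"
      unfolding u_def by (intro set_measurable_borel borel_measurable_times)
    have lift: "mass \<Omega> q (\<lambda>x. G x - ground_mult u x) = mass \<Omega> q (\<lambda>x. G x - F x)" "mass \<Omega> q (ground_mult u) = mass \<Omega> q F" for G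
      using mass_lift(1)[of q G F] mass_lift(2)[of q F] q0 by (simp_all add: u_def[abs_def])
    have "(\<lambda>n. Lq_norm w \<Omega> q (\<lambda>x. f n x - u x)) \<longlonglongrightarrow> 0"
      using fF by (intro lim test_measurable f um) (simp add: lift)
    moreover have "u \<in> Lq_finite w \<Omega> q"
      using Ffin by (intro bnd(1)[OF um, of "enn2real (mass \<Omega> q F)"]) (auto simp: lift)
    ultimately have "u \<in> Lq_closure w \<Omega> q"
      using T_fin[OF f] by (auto simp: Lq_closure_def)
    moreover have "(\<lambda>n. Lq_norm w \<Omega> q (\<lambda>x. v (r n) x - u x)) \<longlonglongrightarrow> 0"
      using vF by (intro lim W_space_measurable vW um) (simp add: lift)
    ultimately show "\<exists>r u. strict_mono r \<and> u \<in> Lq_closure w \<Omega> q \<and> (\<lambda>n. Lq_norm w \<Omega> q (\<lambda>x. v (r n) x - u x)) \<longlonglongrightarrow> 0"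
      using r by blast
  qed
qed

lemma ground_mult_powr:
  "\<bar>ground_mult f x\<bar> powr q = norm (x::'a) powr (- a * q) * \<bar>f x\<bar> powr q"
  by (simp add: ground_mult_eq abs_mult powr_mult powr_powr)

lemma ground_state_imbedding:
  assumes q: "subcritical q"
  shows "compactly_imbedded (W_space \<Omega>) (W_norm \<Omega>)
    (Lq_closure (\<lambda>x. norm x powr (- q * (real DIM('a) - 2) / 2)) \<Omega> q) (Lq_norm (\<lambda>x. norm x powr (- q * (real DIM('a) - 2) / 2)) \<Omega> q)"
proof (rule compactly_imbedded_weighted[OF q, where D=1])
  have "- q * (real DIM('a) - 2) / 2 = - a * q" by (simp add: a_def)
  then show "norm x powr (- q * (real DIM('a) - 2) / 2) * \<bar>f x\<bar> powr q \<le> 1 * \<bar>ground_mult f x\<bar> powr q" for f and x :: 'a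
    by (simp only: ground_mult_powr mult_1 order_refl)
qed auto

text \<open>For nonzero x, |x|^(-a) is |x|^(a (q - 1)) times the weight |x|^(-a q) of the other
  imbedding, and the first factor is bounded on \<Omega> because q >= 1.\<close>

lemma linear_weight_imbedding:
  assumes q: "subcritical q"
  shows "compactly_imbedded (W_space \<Omega>) (W_norm \<Omega>)
    (Lq_closure (\<lambda>x. norm x powr (- (real DIM('a) - 2) / 2)) \<Omega> q) (Lq_norm (\<lambda>x. norm x powr (- (real DIM('a) - 2) / 2)) \<Omega> q)"
proof (rule compactly_imbedded_weighted[OF q, where D="rad powr (a * (q - 1))"])
  fix f and x :: 'a assume x: "x \<in> \<Omega>"
  have e: "- (real DIM('a) - 2) / 2 = - a" unfolding a_def by (rule minus_divide_left[symmetric])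
  show "norm x powr (- (real DIM('a) - 2) / 2) * \<bar>f x\<bar> powr q \<le> rad powr (a * (q - 1)) * \<bar>ground_mult f x\<bar> powr q"
  proof (cases "x = 0")
    case False
    have "norm x < rad" using x rad(2) by auto
    then have "norm x powr (a * (q - 1)) \<le> rad powr (a * (q - 1))"
      using q a_pos by (intro powr_mono2) auto
    then have "norm x powr (a * (q - 1)) * (norm x powr (- a * q) * \<bar>f x\<bar> powr q) \<le>
        rad powr (a * (q - 1)) * (norm x powr (- a * q) * \<bar>f x\<bar> powr q)"
      by (intro mult_right_mono) auto
    moreover have "norm x powr (a * (q - 1)) * norm x powr (- a * q) = norm x powr (- a)"
      by (simp add: powr_add[symmetric] algebra_simps)
    ultimately show ?thesis
      unfolding e ground_mult_powr by (simp add: mult.assoc[symmetric])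
  qed simp
qed auto

lemma ground_mult_bounded_compact:
  assumes v: "bounded_seq_in (W_space \<Omega>) (W_norm \<Omega>) v"
  shows "bounded_seq_in (H_space \<Omega>) (H_norm \<Omega>) (\<lambda>n. ground_mult (v n))"
    and "\<exists>r u. strict_mono (r :: nat \<Rightarrow> nat) \<and> (\<forall>q. subcritical q \<longrightarrow>
      u \<in> Lq_finite (\<lambda>x. 1) \<Omega> q \<and> (\<forall>n. ground_mult (v n) \<in> Lq_finite (\<lambda>x. 1) \<Omega> q) \<and>
      (\<lambda>n. Lq_norm (\<lambda>x. 1) \<Omega> q (\<lambda>x. ground_mult (v (r n)) x - u x)) \<longlonglongrightarrow> 0)"
proof -
  have vW: "v n \<in> W_space \<Omega>" for n using v by (simp add: bounded_seq_in_def)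
  show "bounded_seq_in (H_space \<Omega>) (H_norm \<Omega>) (\<lambda>n. ground_mult (v n))"
    using v H_space_ground_mult[OF vW] unfolding bounded_seq_in_def by (meson order_trans)
  obtain r F where r: "strict_mono (r :: nat \<Rightarrow> nat)" and F: "F \<in> borel_measurable lebesgue"
    and lim: "\<forall>q. subcritical q \<longrightarrow> mass \<Omega> q F < \<infinity> \<and>
      (\<lambda>n. mass \<Omega> q (\<lambda>x. ground_mult (v (r n)) x - F x)) \<longlonglongrightarrow> 0"
    using W_space_compact[OF v] by blast
  have Fm: "set_borel_measurable lebesgue \<Omega> F" by (rule set_measurable_borel[OF F])
  have vm: "set_borel_measurable lebesgue \<Omega> (ground_mult (v n))" for n
    by (rule ground_mult_measurable[OF W_space_measurable[OF vW]])
  have fin: "h \<in> Lq_finite (\<lambda>x. 1) \<Omega> q"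
    if "set_borel_measurable lebesgue \<Omega> h" "mass \<Omega> q h < \<infinity>" "subcritical q" for h q
    using that by (intro weighted_Lq_bound(1)[where D=1 and h=h and m="enn2real (mass \<Omega> q h)"]) auto
  have "F \<in> Lq_finite (\<lambda>x. 1) \<Omega> q \<and> (\<forall>n. ground_mult (v n) \<in> Lq_finite (\<lambda>x. 1) \<Omega> q) \<and>
      (\<lambda>n. Lq_norm (\<lambda>x. 1) \<Omega> q (\<lambda>x. ground_mult (v (r n)) x - F x)) \<longlonglongrightarrow> 0" if q: "subcritical q" for q
  proof (intro conjI allI)
    show "F \<in> Lq_finite (\<lambda>x. 1) \<Omega> q" using lim q by (intro fin Fm) blast+
    show "ground_mult (v n) \<in> Lq_finite (\<lambda>x. 1) \<Omega> q" for n
      using W_space_mass_le[OF vW _ q, of n "W_norm \<Omega> (v n) + 1"]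
      by (intro fin[OF vm _ q]) (auto intro: le_less_trans)
    show "(\<lambda>n. Lq_norm (\<lambda>x. 1) \<Omega> q (\<lambda>x. ground_mult (v (r n)) x - F x)) \<longlonglongrightarrow> 0"
      using q by (intro weighted_Lq_tendsto[OF set_borel_measurable_diff[OF vm Fm] _ _ _ _
        set_borel_measurable_diff[OF vm Fm] conjunct2[OF lim[rule_format, OF q]], where D=1]) auto
  qed
  then show "\<exists>r u. strict_mono (r :: nat \<Rightarrow> nat) \<and> (\<forall>q. subcritical q \<longrightarrow>
      u \<in> Lq_finite (\<lambda>x. 1) \<Omega> q \<and> (\<forall>n. ground_mult (v n) \<in> Lq_finite (\<lambda>x. 1) \<Omega> q) \<and>
      (\<lambda>n. Lq_norm (\<lambda>x. 1) \<Omega> q (\<lambda>x. ground_mult (v (r n)) x - u x)) \<longlonglongrightarrow> 0)"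
    using r by blast
qed

end

theorem corollary2p1:
  fixes \<Omega> :: "'a::euclidean_space set"
  assumes "DIM('a) \<ge> 3"
    and "open \<Omega>" and "connected \<Omega>" and "bounded \<Omega>" and "0 \<in> \<Omega>"
  shows "(\<forall>v. bounded_seq_in (W_space \<Omega>) (W_norm \<Omega>) v \<longrightarrow>
            bounded_seq_in (H_space \<Omega>) (H_norm \<Omega>) (\<lambda>n. ground_mult (v n)) \<and>
            (\<exists>r u. strict_mono (r :: nat \<Rightarrow> nat) \<and>
               (\<forall>q::real. 1 \<le> q \<and> q < 2 * real DIM('a) / (real DIM('a) - 2) \<longrightarrow>
                  u \<in> Lq_finite (\<lambda>x. 1) \<Omega> q \<and>
                  (\<forall>n. ground_mult (v n) \<in> Lq_finite (\<lambda>x. 1) \<Omega> q) \<and>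
                  (\<lambda>n. Lq_norm (\<lambda>x. 1) \<Omega> q (\<lambda>x. ground_mult (v (r n)) x - u x))
                    \<longlonglongrightarrow> 0)))
       \<and> (\<forall>q::real. 1 \<le> q \<and> q < 2 * real DIM('a) / (real DIM('a) - 2) \<longrightarrow>
            (let w = (\<lambda>x. norm x powr (- q * (real DIM('a) - 2) / 2)) in
             compactly_imbedded (W_space \<Omega>) (W_norm \<Omega>)
               (Lq_closure w \<Omega> q) (Lq_norm w \<Omega> q)))
       \<and> (\<forall>q::real. 1 \<le> q \<and> q < 2 * real DIM('a) / (real DIM('a) - 2) \<longrightarrow>
            (let w = (\<lambda>x. norm x powr (- (real DIM('a) - 2) / 2)) in
             compactly_imbedded (W_space \<Omega>) (W_norm \<Omega>)
               (Lq_closure w \<Omega> q) (Lq_norm w \<Omega> q)))"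
proof -
  interpret weighted_domain \<Omega> using assms by unfold_locales auto
  show ?thesis
    unfolding Let_def subcritical_def[symmetric]
    using ground_mult_bounded_compact ground_state_imbedding linear_weight_imbedding by blast
qed

end
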